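(* For all objects $A,B$ of $\mathbf Q$, the homset $\mathbf Q(A,B)$ is a continuous Kegelspitze, and for any morphism $\varphi:A\to B$ in $\mathbf Q$ and any object $C$ of $\mathbf Q$, the maps $\mathbf Q(C,\varphi):\mathbf Q(C,A)\to\mathbf Q(C,B)$, $\psi\mapsto\varphi\circ\psi$, and $\mathbf Q(\varphi,C):\mathbf Q(B,C)\to\mathbf Q(A,C)$, $\psi\mapsto\psi\circ\varphi$, are Scott-continuous and linear.
   Context: $\mathbf Q$ is the opposite of the category of hereditarily atomic von Neumann algebras (those $*$-isomorphic to an $\ell^\infty$-product of full matrix algebras $\mathrm{M}_n(\mathbb C)$) and normal, completely positive, subunital linear maps. Homsets are ordered by $\varphi\le\psi$ iff $\psi-\varphi$ is completely positive, with convex structure $\varphi+_r\psi=r\varphi+(1-r)\psi$ and distinguished element the zero map. A Kegelspitze is a dcpo $K$ with a distinguished element $\bot$ and binary operations $+_r$ ($r\in[0,1]$) satisfying $a+_1b=a$, $a+_rb=b+_{1-r}a$, $a+_ra=a$, and $(a+_pb)+_rc=a+_{pr}(b+_{\frac{r-pr}{1-pr}}c)$ for $r,p<1$, such that $(a,b)\mapsto a+_rb$ and scalar multiplication $(r,a)\mapsto a+_r\bot$ (on $[0,1]\times K$) are Scott-continuous; it is continuous if the underlying dcpo is continuous (every element is a directed supremum of elements way-below it). A map is linear if it preserves $\bot$ and every $+_r$. *)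

theory Defs
  imports
    "HOL-Library.FuncSet"
    "HOL-Algebra.QuotRing"
    "Jordan_Normal_Form.Schur_Decomposition"
begin

hide_const (open) Multiset.mult Polynomial.smult

section \<open>Directed-complete orders and Kegelspitzen\<close>

definition directed :: "('a, 'm) gorder_scheme \<Rightarrow> 'a set \<Rightarrow> bool" where
  "directed L D \<longleftrightarrow>
     D \<noteq> {} \<and> D \<subseteq> carrier L \<and> (\<forall>x\<in>D. \<forall>y\<in>D. \<exists>z\<in>D. x \<sqsubseteq>\<^bsub>L\<^esub> z \<and> y \<sqsubseteq>\<^bsub>L\<^esub> z)"

locale dcpo = partial_order L for L (structure) +
  assumes directed_complete: "directed L D \<Longrightarrow> \<exists>s. is_lub L s D"

(* Monotonicity is implied: if x lies below y, then y is the supremum of the directed set {x, y}. *)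
definition scott_continuous ::
    "('a, 'm) gorder_scheme \<Rightarrow> ('b, 'n) gorder_scheme \<Rightarrow> ('a \<Rightarrow> 'b) \<Rightarrow> bool" where
  "scott_continuous L M f \<longleftrightarrow>
     f \<in> carrier L \<rightarrow> carrier M \<and>
     (\<forall>D s. directed L D \<and> is_lub L s D \<longrightarrow> is_lub M (f s) (f ` D))"

definition way_below :: "('a, 'm) gorder_scheme \<Rightarrow> 'a \<Rightarrow> 'a \<Rightarrow> bool" where
  "way_below L x y \<longleftrightarrow>
     x \<in> carrier L \<and> y \<in> carrier L \<and>
     (\<forall>D s. directed L D \<and> is_lub L s D \<and> y \<sqsubseteq>\<^bsub>L\<^esub> s \<longrightarrow> (\<exists>z\<in>D. x \<sqsubseteq>\<^bsub>L\<^esub> z))"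

locale continuous_dcpo = dcpo L for L (structure) +
  assumes approximated:
    "y \<in> carrier L \<Longrightarrow> \<exists>D. directed L D \<and> (\<forall>x\<in>D. way_below L x y) \<and> is_lub L y D"

definition prod_gorder :: "('a, 'm) gorder_scheme \<Rightarrow> ('b, 'n) gorder_scheme \<Rightarrow> ('a \<times> 'b) gorder" where
  "prod_gorder L M =
     \<lparr>carrier = carrier L \<times> carrier M, eq = (=),
      le = (\<lambda>x y. fst x \<sqsubseteq>\<^bsub>L\<^esub> fst y \<and> snd x \<sqsubseteq>\<^bsub>M\<^esub> snd y)\<rparr>"

definition unit_interval :: "real gorder" where
  "unit_interval = \<lparr>carrier = {0..1}, eq = (=), le = (\<le>)\<rparr>"

record 'a ordered_barycentric = "'a gorder" +
  base :: 'a
  cc :: "real \<Rightarrow> 'a \<Rightarrow> 'a \<Rightarrow> 'a"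

locale kegelspitze = dcpo K for K :: "('a, 'm) ordered_barycentric_scheme" (structure) +
  assumes base_closed: "base K \<in> carrier K"
    and cc_closed:
      "\<lbrakk>0 \<le> r; r \<le> 1; a \<in> carrier K; b \<in> carrier K\<rbrakk> \<Longrightarrow> cc K r a b \<in> carrier K"
    and cc_one: "\<lbrakk>a \<in> carrier K; b \<in> carrier K\<rbrakk> \<Longrightarrow> cc K 1 a b = a"
    and cc_comm:
      "\<lbrakk>0 \<le> r; r \<le> 1; a \<in> carrier K; b \<in> carrier K\<rbrakk> \<Longrightarrow> cc K r a b = cc K (1 - r) b a"
    and cc_idem: "\<lbrakk>0 \<le> r; r \<le> 1; a \<in> carrier K\<rbrakk> \<Longrightarrow> cc K r a a = a"
    and cc_assoc:
      "\<lbrakk>0 \<le> r; r < 1; 0 \<le> p; p < 1; a \<in> carrier K; b \<in> carrier K; c \<in> carrier K\<rbrakk> \<Longrightarrow>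
         cc K r (cc K p a b) c = cc K (p * r) a (cc K ((r - p * r) / (1 - p * r)) b c)"
    and cc_scott:
      "\<lbrakk>0 \<le> r; r \<le> 1\<rbrakk> \<Longrightarrow> scott_continuous (prod_gorder K K) K (\<lambda>(a, b). cc K r a b)"
    and scale_scott:
      "scott_continuous (prod_gorder unit_interval K) K (\<lambda>(r, a). cc K r a (base K))"

locale continuous_kegelspitze =
  kegelspitze K + continuous_dcpo K for K :: "('a, 'm) ordered_barycentric_scheme" (structure)

definition kegelspitze_linear ::
    "('a, 'm) ordered_barycentric_scheme \<Rightarrow> ('b, 'n) ordered_barycentric_scheme \<Rightarrow>
     ('a \<Rightarrow> 'b) \<Rightarrow> bool" where
  "kegelspitze_linear K L f \<longleftrightarrow>
     f \<in> carrier K \<rightarrow> carrier L \<and>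
     f (base K) = base L \<and>
     (\<forall>r\<in>{0..1}. \<forall>a\<in>carrier K. \<forall>b\<in>carrier K. f (cc K r a b) = cc L r (f a) (f b))"


section \<open>Hereditarily atomic von Neumann algebras\<close>

record 'a star_algebra = "(complex, 'a) module" +
  star :: "'a \<Rightarrow> 'a"

text \<open>Unital complex *-algebras; the zero algebra is allowed.\<close>

locale star_algebra = ring A + Module.module class_ring A
  for A :: "('a, 'm) star_algebra_scheme" (structure) +
  assumes smult_mult_left:
      "\<lbrakk>x \<in> carrier A; y \<in> carrier A\<rbrakk> \<Longrightarrow> (c \<odot> x) \<otimes> y = c \<odot> (x \<otimes> y)"
    and smult_mult_right:
      "\<lbrakk>x \<in> carrier A; y \<in> carrier A\<rbrakk> \<Longrightarrow> x \<otimes> (c \<odot> y) = c \<odot> (x \<otimes> y)"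
    and star_closed: "x \<in> carrier A \<Longrightarrow> star A x \<in> carrier A"
    and star_star: "x \<in> carrier A \<Longrightarrow> star A (star A x) = x"
    and star_add:
      "\<lbrakk>x \<in> carrier A; y \<in> carrier A\<rbrakk> \<Longrightarrow> star A (x \<oplus> y) = star A x \<oplus> star A y"
    and star_mult:
      "\<lbrakk>x \<in> carrier A; y \<in> carrier A\<rbrakk> \<Longrightarrow> star A (x \<otimes> y) = star A y \<otimes> star A x"
    and star_smult: "x \<in> carrier A \<Longrightarrow> star A (c \<odot> x) = cnj c \<odot> star A x"

definition euclidean_norm :: "complex vec \<Rightarrow> real" where
  "euclidean_norm v = sqrt (\<Sum>i<dim_vec v. (cmod (v $ i))\<^sup>2)"

definition opnorm_le :: "complex mat \<Rightarrow> real \<Rightarrow> bool" where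
  "opnorm_le X C \<longleftrightarrow>
     (\<forall>v\<in>carrier_vec (dim_col X). euclidean_norm (X *\<^sub>v v) \<le> C * euclidean_norm v)"

text \<open>The product of the matrix algebras of sizes \<open>d i\<close>, \<open>i \<in> I\<close>: families that are
  uniformly bounded in operator norm, with componentwise operations.\<close>

definition linf_matrix_product :: "'i set \<Rightarrow> ('i \<Rightarrow> nat) \<Rightarrow> ('i \<Rightarrow> complex mat) star_algebra" where
  "linf_matrix_product I d =
     \<lparr>carrier = {x \<in> \<Pi>\<^sub>E i\<in>I. carrier_mat (d i) (d i). \<exists>C. \<forall>i\<in>I. opnorm_le (x i) C},
      mult = (\<lambda>x y. \<lambda>i\<in>I. x i * y i),
      one = (\<lambda>i\<in>I. 1\<^sub>m (d i)),
      zero = (\<lambda>i\<in>I. 0\<^sub>m (d i) (d i)),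
      add = (\<lambda>x y. \<lambda>i\<in>I. x i + y i),
      smult = (\<lambda>c x. \<lambda>i\<in>I. c \<cdot>\<^sub>m x i),
      star = (\<lambda>x. \<lambda>i\<in>I. mat_adjoint (x i))\<rparr>"

definition star_iso ::
    "('a, 'm) star_algebra_scheme \<Rightarrow> ('b, 'n) star_algebra_scheme \<Rightarrow> ('a \<Rightarrow> 'b) set" where
  "star_iso A B =
     {h \<in> ring_iso A B. \<forall>x\<in>carrier A.
        (\<forall>c. h (c \<odot>\<^bsub>A\<^esub> x) = c \<odot>\<^bsub>B\<^esub> h x) \<and> h (star A x) = star B (h x)}"

text \<open>The index set is taken inside the type of the elements of the algebra. This is no
  restriction: since \<open>d i > 0\<close>, the index set of any such product injects into the product by
  sending \<open>i\<close> to the family that is the unit matrix at \<open>i\<close> and zero elsewhere.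

  A *-algebra that is *-isomorphic to such a product is a von Neumann algebra in exactly one way
  (its norm, its order and its ultraweak topology are determined by the *-algebra structure),
  so that no further structure is recorded.\<close>

locale hereditarily_atomic = star_algebra A for A :: "('a, 'm) star_algebra_scheme" (structure) +
  assumes atomic_decomposition:
    "\<exists>(I :: 'a set) (d :: 'a \<Rightarrow> nat).
       (\<forall>i\<in>I. d i > 0) \<and> star_iso A (linf_matrix_product I d) \<noteq> {}"


section \<open>Normal completely positive subunital maps\<close>

definition positive :: "('a, 'm) star_algebra_scheme \<Rightarrow> 'a \<Rightarrow> bool" where
  "positive A a \<longleftrightarrow> (\<exists>b\<in>carrier A. a = star A b \<otimes>\<^bsub>A\<^esub> b)"

definition matrix_algebra :: "('a, 'm) star_algebra_scheme \<Rightarrow> nat \<Rightarrow> 'a mat star_algebra" where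
  "matrix_algebra A n =
     \<lparr>carrier = {X \<in> carrier_mat n n. elements_mat X \<subseteq> carrier A},
      mult = (\<lambda>X Y. mat n n (\<lambda>(i, j). \<Oplus>\<^bsub>A\<^esub>k\<in>{..<n}. X $$ (i, k) \<otimes>\<^bsub>A\<^esub> Y $$ (k, j))),
      one = mat n n (\<lambda>(i, j). if i = j then \<one>\<^bsub>A\<^esub> else \<zero>\<^bsub>A\<^esub>),
      zero = mat n n (\<lambda>(i, j). \<zero>\<^bsub>A\<^esub>),
      add = (\<lambda>X Y. mat n n (\<lambda>(i, j). X $$ (i, j) \<oplus>\<^bsub>A\<^esub> Y $$ (i, j))),
      smult = (\<lambda>c X. mat n n (\<lambda>(i, j). c \<odot>\<^bsub>A\<^esub> X $$ (i, j))),
      star = (\<lambda>X. mat n n (\<lambda>(i, j). star A (X $$ (j, i))))\<rparr>"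

definition completely_positive ::
    "('a, 'm) star_algebra_scheme \<Rightarrow> ('b, 'n) star_algebra_scheme \<Rightarrow> ('a \<Rightarrow> 'b) \<Rightarrow> bool" where
  "completely_positive A B f \<longleftrightarrow>
     (\<forall>n. \<forall>X\<in>carrier (matrix_algebra A n).
        positive (matrix_algebra A n) X \<longrightarrow> positive (matrix_algebra B n) (map_mat f X))"

definition self_adjoint_order :: "('a, 'm) star_algebra_scheme \<Rightarrow> 'a gorder" where
  "self_adjoint_order A =
     \<lparr>carrier = {x \<in> carrier A. star A x = x}, eq = (=),
      le = (\<lambda>x y. positive A (y \<ominus>\<^bsub>A\<^esub> x))\<rparr>"

text \<open>A positive map between von Neumann algebras is normal iff it preserves suprema of
  bounded increasing nets of self-adjoint elements; in a von Neumann algebra a directed set of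
  self-adjoint elements has a supremum iff it is bounded.\<close>

definition normal_map ::
    "('a, 'm) star_algebra_scheme \<Rightarrow> ('b, 'n) star_algebra_scheme \<Rightarrow> ('a \<Rightarrow> 'b) \<Rightarrow> bool" where
  "normal_map A B f \<longleftrightarrow> scott_continuous (self_adjoint_order A) (self_adjoint_order B) f"

definition subunital ::
    "('a, 'm) star_algebra_scheme \<Rightarrow> ('b, 'n) star_algebra_scheme \<Rightarrow> ('a \<Rightarrow> 'b) \<Rightarrow> bool" where
  "subunital A B f \<longleftrightarrow> positive B (\<one>\<^bsub>B\<^esub> \<ominus>\<^bsub>B\<^esub> f \<one>\<^bsub>A\<^esub>)"

definition ncpsu ::
    "('a, 'm) star_algebra_scheme \<Rightarrow> ('b, 'n) star_algebra_scheme \<Rightarrow> ('a \<Rightarrow> 'b) set" where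
  "ncpsu A B =
     {f \<in> carrier A \<rightarrow>\<^sub>E carrier B.
        f \<in> LinearCombinations.module_hom class_ring A B \<and>
        normal_map A B f \<and> completely_positive A B f \<and> subunital A B f}"


section \<open>The category Q\<close>

text \<open>Q is the opposite category: a morphism from \<open>A\<close> to \<open>B\<close> is a map from the algebra \<open>B\<close> to
  the algebra \<open>A\<close>.\<close>

definition Q_hom ::
    "('a, 'm) star_algebra_scheme \<Rightarrow> ('b, 'n) star_algebra_scheme \<Rightarrow>
     ('b \<Rightarrow> 'a) ordered_barycentric" where
  "Q_hom A B =
     \<lparr>carrier = ncpsu B A, eq = (=),
      le = (\<lambda>f g. completely_positive B A (\<lambda>x. g x \<ominus>\<^bsub>A\<^esub> f x)),
      base = (\<lambda>x\<in>carrier B. \<zero>\<^bsub>A\<^esub>),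
      cc = (\<lambda>r f g. \<lambda>x\<in>carrier B.
              complex_of_real r \<odot>\<^bsub>A\<^esub> f x \<oplus>\<^bsub>A\<^esub> complex_of_real (1 - r) \<odot>\<^bsub>A\<^esub> g x)\<rparr>"

text \<open>The composite in Q of \<open>g\<close> after \<open>f\<close>, where \<open>C\<close> is the codomain of \<open>g\<close> in Q.\<close>

definition Q_comp ::
    "('c, 'm) star_algebra_scheme \<Rightarrow> ('c \<Rightarrow> 'b) \<Rightarrow> ('b \<Rightarrow> 'a) \<Rightarrow> 'c \<Rightarrow> 'a" where
  "Q_comp C g f = compose (carrier C) f g"

end

theory Submission
  imports Defs
begin

text \<open>An algebra that is an \<open>\<ell>\<^sup>\<infinity>\<close>-product of matrix algebras is described by the matrix entries of
  its elements. Positivity in \<open>M\<^sub>n(A)\<close> means that a quadratic form is nonnegative on every block, and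
  the supremum of a bounded monotone net is its entrywise limit. A monotone net of maps therefore
  converges pointwise: this is clear on positive elements, which span the algebra. The limit is again
  normal because two monotone suprema commute, so the homsets are directed complete, and Scott
  continuity of all operations becomes continuity of addition, scaling and composition under
  pointwise limits (postcomposition uses normality of the map that is applied last).

  For continuity, a map \<open>f\<close> is the limit of its compressions to finitely many blocks of the source and
  of the target, scaled by \<open>t < 1\<close>. Such an approximant is way below \<open>f\<close>: by Choi's theorem the order on
  compressions is the order of finitely many positive semidefinite matrices, and if such matrices
  \<open>q\<close> increase to \<open>s\<close>, then eventually \<open>q \<ge> t s\<close>, since \<open>s\<close> is strictly positive on its own range.\<close>

section \<open>Directed nets\<close>

text \<open>Positivity is given algebraically, by a factorisation \<open>a = star b b\<close>, and
  no topology is given; both are recovered from the quadratic forms of the blocks. The delicate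
  point is that factors found block by block form an element of the algebra only if they are
  uniformly bounded; the diagonal entries of the Gram identity supply the bound. The order knows
  only suprema, while sums and composites are governed by limits. Besides passing from limits to
  suprema one has to return: a limit exists for every bounded monotone net, so a given supremum
  equals it by uniqueness. Both restrictions on the approximants have a reason. The maps
  \<open>(1 - 1/n) f\<close> increase to \<open>f\<close>, but none of them dominates a nonzero
  \<open>f\<close>; hence \<open>t < 1\<close>. A stage of a directed set that dominates
  \<open>t s\<close> is found for one pair of blocks at a time, and directedness joins finitely many
  stages; hence finitely many blocks. That these compressions still exhaust \<open>f\<close> is due
  to its normality: on a positive element the cuts to finitely many source blocks increase to that
  element.\<close>

definition dnet :: "('a \<Rightarrow> 'a \<Rightarrow> bool) \<Rightarrow> 'a set \<Rightarrow> bool" where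
  "dnet R D \<longleftrightarrow> D \<noteq> {} \<and> (\<forall>x\<in>D. R x x) \<and>
     (\<forall>x\<in>D. \<forall>y\<in>D. \<forall>z\<in>D. R x y \<longrightarrow> R y z \<longrightarrow> R x z) \<and>
     (\<forall>x\<in>D. \<forall>y\<in>D. \<exists>z\<in>D. R x z \<and> R y z)"

lemma dnet_nonempty: "dnet R D \<Longrightarrow> D \<noteq> {}"
  unfolding dnet_def by (elim conjE)

lemma dnet_directed:
  assumes "dnet R D" "x \<in> D" "y \<in> D"
  obtains z where "z \<in> D" "R x z" "R y z"
  using assms unfolding dnet_def by blast

text \<open>The section filter of the net: convergence along a directed set becomes
  \<open>tendsto\<close>, and the calculus of limits applies. The index relation is separate from
  the order of the values, so that pairs and index triples can serve as indices.\<close>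

definition net_filter :: "('a \<Rightarrow> 'a \<Rightarrow> bool) \<Rightarrow> 'a set \<Rightarrow> 'a filter" where
  "net_filter R D = (INF d\<in>D. principal {e\<in>D. R d e})"

text \<open>Directedness makes the tails a filter base, so a single tail decides.\<close>

lemma eventually_net_filter:
  assumes "dnet R D"
  shows "eventually P (net_filter R D) \<longleftrightarrow> (\<exists>d\<in>D. \<forall>e\<in>D. R d e \<longrightarrow> P e)"
proof -
  have "eventually P (net_filter R D) \<longleftrightarrow> (\<exists>d\<in>D. eventually P (principal {e\<in>D. R d e}))"
    unfolding net_filter_def
  proof (rule eventually_INF_base)
    show "D \<noteq> {}" by (rule dnet_nonempty) fact
    fix a b assume ab: "a \<in> D" "b \<in> D"
    then obtain z where z: "z \<in> D" "R a z" "R b z" using dnet_directed[OF assms] by blast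
    have "{e\<in>D. R z e} \<subseteq> {e\<in>D. R a e} \<inter> {e\<in>D. R b e}"
      using ab z assms unfolding dnet_def by blast
    then show "\<exists>x\<in>D. principal {e\<in>D. R x e} \<le> inf (principal {e\<in>D. R a e}) (principal {e\<in>D. R b e})"
      using z(1) by auto
  qed
  then show ?thesis by (auto simp: eventually_principal)
qed

lemma net_filter_neq_bot:
  assumes "dnet R D"
  shows "net_filter R D \<noteq> bot"
  unfolding trivial_limit_def eventually_net_filter[OF assms]
  using assms unfolding dnet_def by blast

lemma eventually_net_filter_ge:
  assumes "dnet R D" "d \<in> D"
  shows "eventually (\<lambda>e. e \<in> D \<and> R d e) (net_filter R D)"
  unfolding eventually_net_filter[OF assms(1)] using assms(2) by blast

lemma eventually_in_net:
  assumes "dnet R D"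
  shows "eventually (\<lambda>e. e \<in> D) (net_filter R D)"
  unfolding eventually_net_filter[OF assms] using assms unfolding dnet_def by blast

text \<open>The limit is the supremum of the values: one index above a threshold keeps its whole
  tail above it.\<close>

lemma bounded_monotone_net_converges:
  fixes u :: "'a \<Rightarrow> real"
  assumes D: "dnet R D"
    and mono: "\<And>x y. x \<in> D \<Longrightarrow> y \<in> D \<Longrightarrow> R x y \<Longrightarrow> u x \<le> u y"
    and bd: "\<And>x. x \<in> D \<Longrightarrow> u x \<le> B"
  obtains l where "(u \<longlongrightarrow> l) (net_filter R D)" and "\<And>x. x \<in> D \<Longrightarrow> u x \<le> l"
proof
  have bdd: "bdd_above (u ` D)" by (rule bdd_aboveI2) (rule bd)
  show le_sup: "u x \<le> (SUP x\<in>D. u x)" if "x \<in> D" for x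
    using that bdd by (rule cSUP_upper)
  show "(u \<longlongrightarrow> (SUP x\<in>D. u x)) (net_filter R D)"
  proof (rule order_tendstoI)
    fix a assume "a < (SUP x\<in>D. u x)"
    then obtain d where d: "d \<in> D" "a < u d"
      using dnet_nonempty[OF D] bdd by (auto simp: less_cSUP_iff)
    show "eventually (\<lambda>x. a < u x) (net_filter R D)"
      unfolding eventually_net_filter[OF D] using d mono by force
  next
    fix a assume "(SUP x\<in>D. u x) < a"
    then show "eventually (\<lambda>x. u x < a) (net_filter R D)"
      using eventually_in_net[OF D] le_sup by (auto elim!: eventually_mono intro: le_less_trans)
  qed
qed


section \<open>Positive semidefinite kernels on finite sets\<close>

lemma complex_nonneg_iff: "0 \<le> z \<longleftrightarrow> 0 \<le> Re z \<and> Im z = 0"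
  by (auto simp: less_eq_complex_def)

text \<open>In the order of the complex numbers \<open>0 \<le> z\<close> says that \<open>z\<close>
  is real and nonnegative; both conditions are closed.\<close>

lemma tendsto_complex_nonneg:
  fixes f :: "'a \<Rightarrow> complex"
  assumes "(f \<longlongrightarrow> l) F" "F \<noteq> bot" "eventually (\<lambda>x. 0 \<le> f x) F"
  shows "0 \<le> l"
proof -
  have "0 \<le> Re l"
    by (rule tendsto_lowerbound[OF tendsto_Re[OF assms(1)]])
      (use assms(2,3) in \<open>auto simp: complex_nonneg_iff elim!: eventually_mono\<close>)
  moreover have "((\<lambda>x. Im (f x)) \<longlongrightarrow> 0) F"
    by (rule tendsto_eventually) (use assms(3) in \<open>auto simp: complex_nonneg_iff elim!: eventually_mono\<close>)
  then have "Im l = 0" by (rule tendsto_unique[OF assms(2) tendsto_Im[OF assms(1)]])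
  ultimately show ?thesis by (simp add: complex_nonneg_iff)
qed

lemma sum_swap3:
  "(\<Sum>k\<in>K. \<Sum>l\<in>L. \<Sum>m\<in>M. f k l m) = (\<Sum>m\<in>M. \<Sum>k\<in>K. \<Sum>l\<in>L. f k l m)"
proof -
  have "(\<Sum>k\<in>K. \<Sum>l\<in>L. \<Sum>m\<in>M. f k l m) = (\<Sum>k\<in>K. \<Sum>m\<in>M. \<Sum>l\<in>L. f k l m)"
    by (rule sum.cong[OF refl], rule sum.swap)
  then show ?thesis by (simp only: sum.swap[of _ M K])
qed

section \<open>Sesquilinear forms of finite kernels\<close>

definition unit_fun :: "'k \<Rightarrow> 'k \<Rightarrow> complex" where
  "unit_fun k = (\<lambda>l. if l = k then 1 else 0)"

text \<open>Vectors and kernels are total functions of which only the values on \<open>K\<close>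
  enter, so that blocks of different sizes share one type.\<close>

definition sesq :: "'k set \<Rightarrow> ('k \<Rightarrow> 'k \<Rightarrow> complex) \<Rightarrow> ('k \<Rightarrow> complex) \<Rightarrow> ('k \<Rightarrow> complex) \<Rightarrow> complex" where
  "sesq K q v w = (\<Sum>k\<in>K. \<Sum>l\<in>K. cnj (v k) * q k l * w l)"

definition psd :: "'k set \<Rightarrow> ('k \<Rightarrow> 'k \<Rightarrow> complex) \<Rightarrow> bool" where
  "psd K q \<longleftrightarrow> (\<forall>v. 0 \<le> sesq K q v v)"

definition sqsum :: "'k set \<Rightarrow> ('k \<Rightarrow> complex) \<Rightarrow> real" where
  "sqsum K v = (\<Sum>k\<in>K. (cmod (v k))\<^sup>2)"

lemma sqsum_nonneg: "0 \<le> sqsum K v"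
  by (simp add: sqsum_def sum_nonneg)

lemma sesq_cong:
  assumes "\<And>k l. k \<in> K \<Longrightarrow> l \<in> K \<Longrightarrow> q k l = q' k l"
    and "\<And>k. k \<in> K \<Longrightarrow> v k = v' k" "\<And>k. k \<in> K \<Longrightarrow> w k = w' k"
  shows "sesq K q v w = sesq K q' v' w'"
  unfolding sesq_def by (intro sum.cong refl) (simp add: assms)

lemma sesq_add_left: "sesq K q (\<lambda>k. v k + v' k) w = sesq K q v w + sesq K q v' w"
  by (simp add: sesq_def algebra_simps sum.distrib)

lemma sesq_add_right: "sesq K q v (\<lambda>k. w k + w' k) = sesq K q v w + sesq K q v w'"
  by (simp add: sesq_def algebra_simps sum.distrib)

lemma sesq_scale_left: "sesq K q (\<lambda>k. c * v k) w = cnj c * sesq K q v w"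
  by (simp add: sesq_def sum_distrib_left mult.assoc)

lemma sesq_scale_right: "sesq K q v (\<lambda>k. c * w k) = c * sesq K q v w"
  by (simp add: sesq_def sum_distrib_left mult_ac)

lemma sesq_sum_left: "sesq K q (\<lambda>k. \<Sum>m\<in>M. v m k) w = (\<Sum>m\<in>M. sesq K q (v m) w)"
proof -
  have "sesq K q (\<lambda>k. \<Sum>m\<in>M. v m k) w = (\<Sum>k\<in>K. \<Sum>l\<in>K. \<Sum>m\<in>M. cnj (v m k) * q k l * w l)"
    by (simp add: sesq_def sum_distrib_right)
  also have "\<dots> = (\<Sum>m\<in>M. \<Sum>k\<in>K. \<Sum>l\<in>K. cnj (v m k) * q k l * w l)"
    by (rule sum_swap3)
  finally show ?thesis by (simp add: sesq_def)
qed

lemma sesq_sum_right: "sesq K q v (\<lambda>k. \<Sum>m\<in>M. w m k) = (\<Sum>m\<in>M. sesq K q v (w m))"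
proof -
  have "sesq K q v (\<lambda>k. \<Sum>m\<in>M. w m k) = (\<Sum>k\<in>K. \<Sum>l\<in>K. \<Sum>m\<in>M. cnj (v k) * q k l * w m l)"
    by (simp add: sesq_def sum_distrib_left)
  also have "\<dots> = (\<Sum>m\<in>M. \<Sum>k\<in>K. \<Sum>l\<in>K. cnj (v k) * q k l * w m l)"
    by (rule sum_swap3)
  finally show ?thesis by (simp add: sesq_def)
qed

lemma sesq_kernel_add: "sesq K (\<lambda>k l. q k l + q' k l) v w = sesq K q v w + sesq K q' v w"
  by (simp add: sesq_def algebra_simps sum.distrib)

lemma sesq_kernel_diff: "sesq K (\<lambda>k l. q k l - q' k l) v w = sesq K q v w - sesq K q' v w"
  by (simp add: sesq_def algebra_simps sum_subtractf)

lemma sesq_kernel_scale: "sesq K (\<lambda>k l. c * q k l) v w = c * sesq K q v w"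
  by (simp add: sesq_def sum_distrib_left mult_ac)

lemma sesq_unit_left:
  assumes "finite K" "m \<in> K"
  shows "sesq K q (unit_fun m) w = (\<Sum>l\<in>K. q m l * w l)"
proof -
  have "sesq K q (unit_fun m) w = (\<Sum>k\<in>K. if k = m then (\<Sum>l\<in>K. q m l * w l) else 0)"
    unfolding sesq_def by (intro sum.cong refl) (auto simp: unit_fun_def)
  then show ?thesis using assms by simp
qed

lemma sesq_unit_right:
  assumes "finite K" "m \<in> K"
  shows "sesq K q v (unit_fun m) = (\<Sum>k\<in>K. cnj (v k) * q k m)"
proof -
  have "sesq K q v (unit_fun m) = (\<Sum>k\<in>K. \<Sum>l\<in>K. if l = m then cnj (v k) * q k m else 0)"
    unfolding sesq_def by (intro sum.cong refl) (auto simp: unit_fun_def)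
  then show ?thesis using assms by simp
qed

lemma sesq_unit_unit:
  assumes "finite K" "m \<in> K" "n \<in> K"
  shows "sesq K q (unit_fun m) (unit_fun n) = q m n"
  by (subst sesq_unit_left[OF assms(1,2)]) (use assms in \<open>simp add: unit_fun_def if_distrib cong: if_cong\<close>)

text \<open>Diagonal values determine the form for an arbitrary kernel. This is how matrix entries
  are recovered from quadratic forms.\<close>

lemma sesq_polarization:
  "4 * sesq K q v w =
     sesq K q (\<lambda>k. v k + w k) (\<lambda>k. v k + w k) - sesq K q (\<lambda>k. v k - w k) (\<lambda>k. v k - w k)
     - \<i> * sesq K q (\<lambda>k. v k + \<i> * w k) (\<lambda>k. v k + \<i> * w k)
     + \<i> * sesq K q (\<lambda>k. v k - \<i> * w k) (\<lambda>k. v k - \<i> * w k)"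
  (is "_ = ?a - ?b - _ * ?c + _ * ?d")
proof -
  have *: "sesq K q (\<lambda>k. v k + c * w k) (\<lambda>k. v k + c * w k) =
     sesq K q v v + c * sesq K q v w + cnj c * sesq K q w v + cnj c * c * sesq K q w w" for c
    by (simp add: sesq_add_left sesq_add_right sesq_scale_left sesq_scale_right algebra_simps)
  have a: "?a = sesq K q v v + sesq K q v w + sesq K q w v + sesq K q w w" using *[of 1] by simp
  have b: "?b = sesq K q v v - sesq K q v w - sesq K q w v + sesq K q w w" using *[of "-1"] by simp
  have c: "?c = sesq K q v v + \<i> * sesq K q v w - \<i> * sesq K q w v + sesq K q w w"
    using *[of \<i>] by simp
  have d: "?d = sesq K q v v - \<i> * sesq K q v w + \<i> * sesq K q w v + sesq K q w w"
    using *[of "-\<i>"] by simp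
  show ?thesis unfolding a b c d by (simp add: algebra_simps)
qed

lemma sqsum_add_le: "sqsum K (\<lambda>k. v k + w k) \<le> 2 * sqsum K v + 2 * sqsum K w"
proof -
  have *: "(cmod (a + b))\<^sup>2 \<le> 2 * (cmod a)\<^sup>2 + 2 * (cmod b)\<^sup>2" for a b
  proof -
    have "(cmod (a + b))\<^sup>2 \<le> (cmod a + cmod b)\<^sup>2"
      by (intro power_mono norm_triangle_ineq) simp
    also have "\<dots> \<le> 2 * (cmod a)\<^sup>2 + 2 * (cmod b)\<^sup>2"
      using sum_squares_ge_zero[of "cmod a - cmod b" 0] by (simp add: power2_eq_square algebra_simps)
    finally show ?thesis .
  qed
  show ?thesis unfolding sqsum_def sum_distrib_left sum.distrib[symmetric] by (intro sum_mono *)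
qed

section \<open>Semidefinite kernels: symmetry, Cauchy-Schwarz, factorisation\<close>

lemma psdD: "psd K q \<Longrightarrow> 0 \<le> sesq K q v v"
  by (simp add: psd_def)

lemma psd_cong:
  assumes "\<And>k l. k \<in> K \<Longrightarrow> l \<in> K \<Longrightarrow> q k l = q' k l"
  shows "psd K q \<longleftrightarrow> psd K q'"
  unfolding psd_def using sesq_cong[of K q q', OF assms] by metis

lemma psd_expand:
  assumes "psd K q"
  shows "0 \<le> sesq K q v v + c * sesq K q v w + cnj c * sesq K q w v + cnj c * c * sesq K q w w"
  using psdD[OF assms, of "\<lambda>k. v k + c * w k"]
  by (simp add: sesq_add_left sesq_add_right sesq_scale_left sesq_scale_right algebra_simps)

text \<open>The form is real at \<open>v + w\<close> and at \<open>v + \<i> w\<close>; the first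
  fact compares the imaginary parts of the two mixed values, the second their real parts.\<close>

lemma psd_hermitian:
  assumes "psd K q"
  shows "sesq K q w v = cnj (sesq K q v w)"
proof -
  have "Im (sesq K q v v) = 0" "Im (sesq K q w w) = 0"
    using psdD[OF assms] by (auto simp: complex_nonneg_iff)
  then show ?thesis
    using psd_expand[OF assms, of v 1 w] psd_expand[OF assms, of v \<i> w]
    by (auto simp: complex_nonneg_iff complex_eq_iff)
qed

lemma psd_Cauchy_Schwarz:
  assumes "psd K q"
  shows "(cmod (sesq K q v w))\<^sup>2 \<le> Re (sesq K q v v) * Re (sesq K q w w)"
proof -
  define a b s where "a = Re (sesq K q v v)" and "b = Re (sesq K q w w)" and "s = sesq K q v w"
  have ab: "sesq K q v v = of_real a" "sesq K q w w = of_real b" "0 \<le> a" "0 \<le> b"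
    using psdD[OF assms, of v] psdD[OF assms, of w]
    by (auto simp: a_def b_def complex_nonneg_iff complex_eq_iff)
  have ss: "cnj s * s = of_real ((cmod s)\<^sup>2)" by (metis complex_norm_square mult.commute)
  \<comment> \<open>Moving from \<open>v\<close> in the direction \<open>- t (cnj s) w\<close> turns
    both cross terms into \<open>- t |s|^2\<close> and leaves a real polynomial in
    \<open>t\<close>.\<close>
  have key: "0 \<le> a - 2 * t * (cmod s)\<^sup>2 + t\<^sup>2 * (cmod s)\<^sup>2 * b" for t
  proof -
    have "0 \<le> of_real a + (- of_real t * cnj s) * s + cnj (- of_real t * cnj s) * cnj s
        + cnj (- of_real t * cnj s) * (- of_real t * cnj s) * of_real b"
      using psd_expand[OF assms, of v "- of_real t * cnj s" w]
      unfolding psd_hermitian[OF assms, of w v] ab s_def .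
    also have "\<dots> = of_real a - 2 * of_real t * (cnj s * s) + (of_real t)\<^sup>2 * (cnj s * s) * of_real b"
      by (simp add: algebra_simps power2_eq_square)
    also have "\<dots> = of_real (a - 2 * t * (cmod s)\<^sup>2 + t\<^sup>2 * (cmod s)\<^sup>2 * b)"
      unfolding ss by simp
    finally show ?thesis by (simp add: complex_nonneg_iff)
  qed
  have "(cmod s)\<^sup>2 \<le> a * b"
  proof (cases "b = 0")
    case True
    have "(cmod s)\<^sup>2 = 0"
    proof (rule ccontr)
      assume n: "(cmod s)\<^sup>2 \<noteq> 0"
      \<comment> \<open>For \<open>b = 0\<close> the polynomial is linear, and at this point its
        value is \<open>- a - 2\<close>.\<close>
      show False using key[of "(a + 1) / (cmod s)\<^sup>2"] True n ab(3) by simp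
    qed
    then show ?thesis using True by simp
  next
    case False
    \<comment> \<open>The minimiser of the quadratic polynomial.\<close>
    then show ?thesis using key[of "1 / b"] ab(4) by (simp add: field_simps power2_eq_square)
  qed
  then show ?thesis by (simp add: a_def b_def s_def)
qed

text \<open>The induction eliminates one row and column at a time (Schur complement).\<close>

lemma psd_Parseval_aux:
  assumes "finite L" "finite K" "L \<subseteq> K" "psd K q"
    and "\<And>k l. k \<in> K \<Longrightarrow> l \<in> K \<Longrightarrow> k \<notin> L \<or> l \<notin> L \<Longrightarrow> q k l = 0"
  shows "\<exists>u. \<forall>v w. sesq K q v w = (\<Sum>m\<in>L. sesq K q v (u m) * sesq K q (u m) w)"
  using assms(1,3-5)
proof (induction L arbitrary: q rule: finite_induct)
  case empty
  then show ?case by (simp add: sesq_def)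
next
  case (insert n L)
  define e where "e = (unit_fun n :: 'a \<Rightarrow> complex)"
  have n: "n \<in> K" using insert.prems by simp
  define b where "b = q n n"
  have b: "b = sesq K q e e" using n assms(2) by (simp add: e_def b_def sesq_unit_unit)
  have b0: "0 \<le> b" unfolding b by (rule psdD) fact
  have row: "q n k = sesq K q e (unit_fun k)" and col: "q k n = sesq K q (unit_fun k) e" if "k \<in> K" for k
    using n that assms(2) by (simp_all add: e_def sesq_unit_unit)
  show ?case
  proof (cases "b = 0")
    case True
    \<comment> \<open>By Cauchy-Schwarz a zero diagonal entry makes its row and column vanish, so
      the kernel already lives on \<open>L\<close> and \<open>n\<close> contributes the zero
      vector.\<close>
    have "sesq K q e v = 0" "sesq K q v e = 0" for v
      using psd_Cauchy_Schwarz[OF insert.prems(2), of e v] True b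
        psd_hermitian[OF insert.prems(2), of e v] by auto
    then have "q k l = 0" if "k \<in> K" "l \<in> K" "k \<notin> L \<or> l \<notin> L" for k l
      using that insert.prems(3)[of k l] row[of l] col[of k] by (cases "k = n"; cases "l = n") auto
    then obtain u where u: "\<And>v w. sesq K q v w = (\<Sum>m\<in>L. sesq K q v (u m) * sesq K q (u m) w)"
      using insert.IH[OF _ insert.prems(2)] insert.prems(1) by blast
    define u' where "u' = (\<lambda>m. if m = n then (\<lambda>_. 0) else u m)"
    have "sesq K q v w = (\<Sum>m\<in>insert n L. sesq K q v (u' m) * sesq K q (u' m) w)" for v w
    proof -
      have "sesq K q v (u' n) = 0" by (simp add: sesq_def u'_def)
      moreover have "(\<Sum>m\<in>L. sesq K q v (u' m) * sesq K q (u' m) w)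
          = (\<Sum>m\<in>L. sesq K q v (u m) * sesq K q (u m) w)"
        by (rule sum.cong) (use insert.hyps in \<open>auto simp: u'_def\<close>)
      ultimately show ?thesis using u[of v w] insert.hyps by simp
    qed
    then show ?thesis by blast
  next
    case False
    define q' where "q' = (\<lambda>k l. q k l - q k n * q n l / b)"
    have q': "sesq K q' v w = sesq K q v w - sesq K q v e * sesq K q e w / b" for v w
    proof -
      have "sesq K q v e * sesq K q e w / b
          = (\<Sum>k\<in>K. \<Sum>l\<in>K. cnj (v k) * q k n * (q n l * w l)) / b"
        unfolding e_def sesq_unit_left[OF assms(2) n] sesq_unit_right[OF assms(2) n] sum_product ..
      also have "\<dots> = (\<Sum>k\<in>K. \<Sum>l\<in>K. cnj (v k) * (q k n * q n l / b) * w l)"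
        by (simp add: sum_divide_distrib mult_ac)
      finally have "sesq K q v e * sesq K q e w / b = \<dots>" .
      then show ?thesis
        unfolding q'_def sesq_kernel_diff by (simp add: sesq_def)
    qed
    have br: "b = of_real (Re b)" and br0: "Re b > 0"
      using b0 False by (auto simp: complex_nonneg_iff complex_eq_iff)
    have "psd K q'"
      unfolding psd_def
    proof
      fix v
      have 1: "sesq K q v e * sesq K q e v = of_real ((cmod (sesq K q v e))\<^sup>2)"
        unfolding psd_hermitian[OF insert.prems(2), of e v] by (metis complex_norm_square)
      have 2: "sesq K q v v = of_real (Re (sesq K q v v))"
        using psdD[OF insert.prems(2), of v] by (simp add: complex_nonneg_iff complex_eq_iff)
      have 3: "(cmod (sesq K q v e))\<^sup>2 / Re b \<le> Re (sesq K q v v)"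
        using psd_Cauchy_Schwarz[OF insert.prems(2), of v e] br0
        by (simp add: b[symmetric] field_simps)
      have "sesq K q' v v = of_real (Re (sesq K q v v) - (cmod (sesq K q v e))\<^sup>2 / Re b)"
        unfolding q' 1 by (subst 2, subst br) simp
      then show "0 \<le> sesq K q' v v" using 3 by (simp add: complex_nonneg_iff)
    qed
    moreover have "q' k l = 0" if "k \<in> K" "l \<in> K" "k \<notin> L \<or> l \<notin> L" for k l
      using that insert.prems(3) n False by (cases "k = n"; cases "l = n") (auto simp: q'_def b_def)
    ultimately obtain u' where
      u': "\<And>v w. sesq K q' v w = (\<Sum>m\<in>L. sesq K q' v (u' m) * sesq K q' (u' m) w)"
      using insert.IH[of q'] insert.prems(1) by blast
    \<comment> \<open>The vector \<open>u n\<close> is scaled so that it reproduces the subtracted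
      rank-one term. The others are made orthogonal to \<open>e\<close> with respect to
      \<open>q\<close>; pairing with them under \<open>q\<close> is then pairing with
      \<open>u'\<close> under \<open>q'\<close>.\<close>
    define u where "u = (\<lambda>m. if m = n then (\<lambda>k. complex_of_real (1 / sqrt (Re b)) * e k)
       else (\<lambda>k. u' m k + (- sesq K q e (u' m) / b) * e k))"
    have un: "sesq K q v (u n) * sesq K q (u n) w = sesq K q v e * sesq K q e w / b" for v w
    proof -
      have *: "complex_of_real (1 / sqrt (Re b)) * complex_of_real (1 / sqrt (Re b)) = 1 / b"
        unfolding of_real_mult[symmetric] using br0 by (subst br) simp
      have "sesq K q v (u n) * sesq K q (u n) w = complex_of_real (1 / sqrt (Re b)) *
          complex_of_real (1 / sqrt (Re b)) * (sesq K q v e * sesq K q e w)"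
        unfolding u_def if_P[OF refl] sesq_scale_left sesq_scale_right complex_cnj_complex_of_real
        by (simp only: mult_ac)
      then show ?thesis unfolding * by simp
    qed
    have um1: "sesq K q v (u m) = sesq K q' v (u' m)" if "m \<in> L" for v m
    proof -
      have "u m = (\<lambda>k. u' m k + (- sesq K q e (u' m) / b) * e k)"
        using that insert.hyps by (auto simp: u_def)
      then show ?thesis by (simp only: q' sesq_add_right sesq_scale_right) simp
    qed
    have um2: "sesq K q (u m) w = sesq K q' (u' m) w" if "m \<in> L" for w m
      using um1[OF that, of w] psd_hermitian[OF insert.prems(2), of "u m" w]
        psd_hermitian[OF \<open>psd K q'\<close>, of "u' m" w] by simp
    have "sesq K q v w = (\<Sum>m\<in>insert n L. sesq K q v (u m) * sesq K q (u m) w)" for v w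
    proof -
      have "sesq K q v w = sesq K q v (u n) * sesq K q (u n) w + sesq K q' v w"
        by (simp add: un q')
      also have "sesq K q' v w = (\<Sum>m\<in>L. sesq K q v (u m) * sesq K q (u m) w)"
        using um1 um2 by (subst u') (simp cong: sum.cong)
      finally show ?thesis using insert.hyps by simp
    qed
    then show ?thesis by blast
  qed
qed

text \<open>A Parseval system stands in for an orthonormal basis of a possibly degenerate form. Null
  vectors are allowed in it, which avoids ranks and eigenvalues.\<close>

lemma psd_Parseval:
  assumes "finite K" "psd K q"
  obtains u where "\<And>v w. sesq K q v w = (\<Sum>m\<in>K. sesq K q v (u m) * sesq K q (u m) w)"
  using psd_Parseval_aux[OF assms(1,1) subset_refl assms(2)] by blast

text \<open>The factor \<open>y m k\<close> is the pairing of the Parseval vector \<open>u m\<close>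
  with the unit vector at \<open>k\<close>. It is indexed by \<open>K\<close> again, so the factor
  has the same size as the kernel.\<close>

lemma psd_Cholesky:
  assumes "finite K" "psd K q"
  obtains y where "\<And>k l. k \<in> K \<Longrightarrow> l \<in> K \<Longrightarrow> q k l = (\<Sum>m\<in>K. cnj (y m k) * y m l)"
proof -
  obtain u where u: "\<And>v w. sesq K q v w = (\<Sum>m\<in>K. sesq K q v (u m) * sesq K q (u m) w)"
    using psd_Parseval[OF assms] by blast
  have "q k l = (\<Sum>m\<in>K. cnj (sesq K q (u m) (unit_fun k)) * sesq K q (u m) (unit_fun l))"
    if "k \<in> K" "l \<in> K" for k l
    using u[of "unit_fun k" "unit_fun l"] that assms(1)
    by (simp add: sesq_unit_unit psd_hermitian[OF assms(2), symmetric])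
  then show ?thesis by (rule that)
qed

lemma Gram_form:
  "(\<Sum>k\<in>K. \<Sum>l\<in>K. cnj (v k) * (\<Sum>m\<in>M. cnj (y m k) * y m l) * v l) =
     of_real (sqsum M (\<lambda>m. \<Sum>l\<in>K. y m l * v l))"
proof -
  have "(\<Sum>k\<in>K. \<Sum>l\<in>K. cnj (v k) * (\<Sum>m\<in>M. cnj (y m k) * y m l) * v l) =
      (\<Sum>k\<in>K. \<Sum>l\<in>K. \<Sum>m\<in>M. cnj (y m k * v k) * (y m l * v l))"
    by (simp add: sum_distrib_left sum_distrib_right mult_ac)
  also have "\<dots> = (\<Sum>m\<in>M. \<Sum>k\<in>K. \<Sum>l\<in>K. cnj (y m k * v k) * (y m l * v l))"
    by (rule sum_swap3)
  also have "\<dots> = (\<Sum>m\<in>M. cnj (\<Sum>l\<in>K. y m l * v l) * (\<Sum>l\<in>K. y m l * v l))"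
    by (simp add: sum_product)
  also have "\<dots> = of_real (sqsum M (\<lambda>m. \<Sum>l\<in>K. y m l * v l))"
    unfolding sqsum_def of_real_sum by (intro sum.cong refl) (metis complex_norm_square mult.commute)
  finally show ?thesis .
qed

text \<open>Factoring \<open>p\<close> turns the sum into a sum of values of the form of
  \<open>q\<close>. This is the weak form of the Schur product theorem that is used for Choi's
  theorem.\<close>

lemma psd_Schur_product_nonneg:
  assumes "finite K" "psd K p" "psd K q"
  shows "0 \<le> (\<Sum>k\<in>K. \<Sum>l\<in>K. p k l * q k l)"
proof -
  obtain y where y: "\<And>k l. k \<in> K \<Longrightarrow> l \<in> K \<Longrightarrow> p k l = (\<Sum>m\<in>K. cnj (y m k) * y m l)"
    using psd_Cholesky[OF assms(1,2)] by blast
  have "(\<Sum>k\<in>K. \<Sum>l\<in>K. p k l * q k l) = (\<Sum>k\<in>K. \<Sum>l\<in>K. \<Sum>m\<in>K. cnj (y m k) * q k l * y m l)"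
    by (intro sum.cong refl) (simp add: y sum_distrib_left sum_distrib_right mult_ac)
  also have "\<dots> = (\<Sum>m\<in>K. sesq K q (y m) (y m))"
    unfolding sesq_def by (rule sum_swap3)
  also have "\<dots> \<ge> 0" by (intro sum_nonneg psdD assms(3))
  finally show ?thesis .
qed

text \<open>In the coordinates given by a Parseval system of \<open>s\<close>, the difference \<open>s - q x\<close> is small
  compared with the identity, and \<open>s\<close> is the identity.\<close>

lemma psd_limit_absorbs:
  assumes K: "finite K" and s: "psd K s"
    and diff: "eventually (\<lambda>x. psd K (\<lambda>k l. s k l - q x k l)) F"
    and q: "eventually (\<lambda>x. psd K (q x)) F"
    and lim: "\<And>k l. k \<in> K \<Longrightarrow> l \<in> K \<Longrightarrow> ((\<lambda>x. q x k l) \<longlongrightarrow> s k l) F"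
    and t: "t < 1"
  shows "eventually (\<lambda>x. psd K (\<lambda>k l. q x k l - of_real t * s k l)) F"
proof -
  obtain u where u: "\<And>v w. sesq K s v w = (\<Sum>m\<in>K. sesq K s v (u m) * sesq K s (u m) w)"
    using psd_Parseval[OF K s] by blast
  \<comment> \<open>Chosen so that a row of \<open>card K\<close> entries smaller than
    \<open>\<eta>\<close> adds up to at most \<open>1 - t\<close>; the summand 1 covers the empty
    \<open>K\<close>.\<close>
  define \<eta> where "\<eta> = (1 - t) / (real (card K) + 1)"
  have \<eta>: "0 < \<eta>" "\<eta> * card K \<le> 1 - t"
    using t by (auto simp: \<eta>_def field_simps)
  define \<delta> where "\<delta> = (\<lambda>x k l. s k l - q x k l)"
  have "((\<lambda>x. sesq K (\<delta> x) (u m) (u n)) \<longlongrightarrow> 0) F" for m n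
  proof -
    have "((\<lambda>x. sesq K (\<delta> x) (u m) (u n)) \<longlongrightarrow> (\<Sum>k\<in>K. \<Sum>l\<in>K. cnj (u m k) * (s k l - s k l) * u n l)) F"
      unfolding sesq_def \<delta>_def by (intro tendsto_intros lim)
    then show ?thesis by simp
  qed
  then have "eventually (\<lambda>x. cmod (sesq K (\<delta> x) (u m) (u n)) < \<eta>) F" for m n
    using \<eta>(1) order_tendstoD(2)[OF tendsto_norm_zero] by blast
  then have small: "eventually (\<lambda>x. \<forall>m\<in>K. \<forall>n\<in>K. cmod (sesq K (\<delta> x) (u m) (u n)) < \<eta>) F"
    using K by (auto simp: eventually_ball_finite_distrib)
  show ?thesis
    using small diff q
  proof eventually_elim
    case (elim x)
    have \<delta>: "psd K (\<delta> x)" using elim(2) by (simp add: \<delta>_def)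
    show ?case
      unfolding psd_def
    proof
      fix v
      define c where "c = (\<lambda>m. sesq K s (u m) v)"
      \<comment> \<open>The expansion of \<open>v\<close> in the Parseval system; it pairs under
        \<open>s\<close> exactly as \<open>v\<close> does, so the remainder \<open>z\<close> is null
        for \<open>s\<close>.\<close>
      define y where "y = (\<lambda>k. \<Sum>m\<in>K. c m * u m k)"
      define z where "z = (\<lambda>k. v k + (-1) * y k)"
      have "sesq K s w z = 0" for w
      proof -
        have "sesq K s w y = sesq K s w v"
          unfolding y_def sesq_sum_right sesq_scale_right c_def by (subst (2) u) (simp add: mult.commute)
        then show ?thesis unfolding z_def sesq_add_right sesq_scale_right by simp
      qed
      moreover have "sesq K s z z = sesq K (\<delta> x) z z + sesq K (q x) z z"
        by (simp add: \<delta>_def sesq_kernel_diff)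
      \<comment> \<open>The value of \<open>s\<close> at \<open>z\<close> is zero and is the sum of
        two nonnegative values, so \<open>z\<close> is null for the difference as well and only
        \<open>y\<close> matters.\<close>
      ultimately have "Re (sesq K (\<delta> x) z z) = 0"
        using psdD[OF \<delta>, of z] psdD[OF elim(3), of z]
        by (auto simp: complex_nonneg_iff complex_eq_iff)
      then have z0: "sesq K (\<delta> x) w z = 0" "sesq K (\<delta> x) z w = 0" for w
        using psd_Cauchy_Schwarz[OF \<delta>, of w z] psd_hermitian[OF \<delta>, of w z] by auto
      have v: "v = (\<lambda>k. y k + z k)" by (simp add: z_def)
      have "sesq K (\<delta> x) v v = sesq K (\<delta> x) y y"
        unfolding v sesq_add_left sesq_add_right by (simp add: z0)
      also have "\<dots> = (\<Sum>m\<in>K. \<Sum>n\<in>K. cnj (c m) * (c n * sesq K (\<delta> x) (u m) (u n)))"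
        unfolding y_def sesq_sum_left sesq_sum_right sesq_scale_left sesq_scale_right
        by (simp add: sum_distrib_left)
      finally have \<delta>v: "sesq K (\<delta> x) v v = \<dots>" .
      have "Re (sesq K (\<delta> x) v v) \<le> cmod (sesq K (\<delta> x) v v)" by (rule complex_Re_le_cmod)
      also have "\<dots> \<le> (\<Sum>m\<in>K. \<Sum>n\<in>K. \<eta> * (((cmod (c m))\<^sup>2 + (cmod (c n))\<^sup>2) / 2))"
        unfolding \<delta>v
      proof (intro sum_norm_le)
        fix m n assume mn: "m \<in> K" "n \<in> K"
        have "cmod (c m) * cmod (c n) \<le> ((cmod (c m))\<^sup>2 + (cmod (c n))\<^sup>2) / 2"
          using sum_squares_bound[of "cmod (c m)" "cmod (c n)"] by simp
        then have "cmod (sesq K (\<delta> x) (u m) (u n)) * (cmod (c m) * cmod (c n))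
            \<le> \<eta> * (((cmod (c m))\<^sup>2 + (cmod (c n))\<^sup>2) / 2)"
          using elim(1) mn \<eta>(1) by (intro mult_mono) (auto intro: less_imp_le)
        then show "norm (cnj (c m) * (c n * sesq K (\<delta> x) (u m) (u n)))
            \<le> \<eta> * (((cmod (c m))\<^sup>2 + (cmod (c n))\<^sup>2) / 2)"
          by (simp add: norm_mult mult_ac)
      qed
      also have "\<dots> = \<eta> * card K * (\<Sum>m\<in>K. (cmod (c m))\<^sup>2)"
        by (simp add: sum_distrib_left[symmetric] sum_divide_distrib[symmetric] sum.distrib)
      also have "\<dots> \<le> (1 - t) * (\<Sum>m\<in>K. (cmod (c m))\<^sup>2)"
        by (intro mult_right_mono \<eta> sum_nonneg) simp
      \<comment> \<open>Parseval: the squared coefficients of \<open>v\<close> add up to the value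
        of \<open>s\<close> at \<open>v\<close>.\<close>
      also have "(\<Sum>m\<in>K. (cmod (c m))\<^sup>2) = Re (sesq K s v v)"
      proof -
        have "sesq K s v v = (\<Sum>m\<in>K. of_real ((cmod (c m))\<^sup>2))"
          unfolding c_def by (subst u, intro sum.cong refl)
            (metis psd_hermitian[OF s] complex_norm_square mult.commute)
        then show ?thesis by simp
      qed
      finally have le: "Re (sesq K (\<delta> x) v v) \<le> (1 - t) * Re (sesq K s v v)" .
      have eq: "sesq K (\<lambda>k l. q x k l - of_real t * s k l) v v
          = sesq K s v v - sesq K (\<delta> x) v v - of_real t * sesq K s v v"
        by (simp add: \<delta>_def sesq_kernel_diff sesq_kernel_scale)
      show "0 \<le> sesq K (\<lambda>k l. q x k l - of_real t * s k l) v v"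
        unfolding eq complex_nonneg_iff
        using le psdD[OF \<delta>, of v] psdD[OF s, of v] by (simp add: complex_nonneg_iff algebra_simps)
    qed
  qed
qed


text \<open>Identifies an \<open>n\<close> by \<open>n\<close> matrix over blocks of size
  \<open>m\<close> with a single kernel on pairs of an outer and an inner index.\<close>

lemma sesq_Times:
  "sesq ({..<n} \<times> {..<m}) q u w =
     (\<Sum>k<n. \<Sum>l<n. sesq {..<m} (\<lambda>a b. q (k, a) (l, b)) (\<lambda>a. u (k, a)) (\<lambda>b. w (l, b)))"
  for n m :: nat
proof -
  have "sesq ({..<n} \<times> {..<m}) q u w =
      (\<Sum>k<n. \<Sum>a<m. \<Sum>l<n. \<Sum>b<m. cnj (u (k, a)) * q (k, a) (l, b) * w (l, b))"
    unfolding sesq_def by (simp add: sum.cartesian_product')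
  also have "\<dots> = (\<Sum>k<n. \<Sum>l<n. \<Sum>a<m. \<Sum>b<m. cnj (u (k, a)) * q (k, a) (l, b) * w (l, b))"
    by (rule sum.cong[OF refl], rule sum.swap)
  finally show ?thesis by (simp add: sesq_def)
qed

section \<open>Gram kernels; numerical radius against operator norm\<close>

lemma psd_Gram:
  assumes "\<And>k l. k \<in> K \<Longrightarrow> l \<in> K \<Longrightarrow> q k l = (\<Sum>m\<in>M. cnj (y m k) * y m l)"
  shows "sesq K q v v = of_real (sqsum M (\<lambda>m. \<Sum>l\<in>K. y m l * v l))"
    and "psd K q"
proof -
  show *: "sesq K q v v = of_real (sqsum M (\<lambda>m. \<Sum>l\<in>K. y m l * v l))" for v
    unfolding Gram_form[symmetric] sesq_def using assms by (intro sum.cong refl) simp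
  show "psd K q" unfolding psd_def * by (simp add: complex_nonneg_iff sqsum_nonneg)
qed

lemma cmod_sum_product_le:
  "cmod (\<Sum>k\<in>K. cnj (v k) * w k) \<le> sqsum K v + sqsum K w"
proof -
  have "cmod (\<Sum>k\<in>K. cnj (v k) * w k) \<le> (\<Sum>k\<in>K. (cmod (v k))\<^sup>2 + (cmod (w k))\<^sup>2)"
  proof (rule sum_norm_le)
    fix k
    show "norm (cnj (v k) * w k) \<le> (cmod (v k))\<^sup>2 + (cmod (w k))\<^sup>2"
      using sum_squares_bound[of "cmod (v k)" "cmod (w k)"]
        mult_nonneg_nonneg[of "cmod (v k)" "cmod (w k)", OF norm_ge_zero norm_ge_zero]
      unfolding norm_mult complex_mod_cnj by linarith
  qed
  then show ?thesis by (simp add: sqsum_def sum.distrib)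
qed

lemma sesq_eq_sum: "sesq K q v w = (\<Sum>k\<in>K. cnj (v k) * (\<Sum>l\<in>K. q k l * w l))"
  by (simp add: sesq_def sum_distrib_left mult.assoc)

lemma sqsum_scale: "sqsum K (\<lambda>k. c * v k) = (cmod c)\<^sup>2 * sqsum K v"
  by (simp add: sqsum_def norm_mult power_mult_distrib sum_distrib_left)

text \<open>Polarization bounds the mixed values of the form; the mixed value of \<open>q w\<close>
  with \<open>w\<close> is the squared norm of \<open>q w\<close>.\<close>

lemma operator_bound_of_numerical_bound:
  assumes C: "\<And>v. cmod (sesq K q v v) \<le> C * sqsum K v" and "C > 0"
  shows "sqsum K (\<lambda>k. \<Sum>l\<in>K. q k l * w l) \<le> (4 * C)\<^sup>2 * sqsum K w"
proof -
  have bd: "cmod (sesq K q (\<lambda>k. v k + c * w k) (\<lambda>k. v k + c * w k)) \<le> 2 * C * (sqsum K v + sqsum K w)"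
    if "cmod c = 1" for v c
  proof -
    have "C * sqsum K (\<lambda>k. v k + c * w k) \<le> C * (2 * sqsum K v + 2 * sqsum K w)"
      using sqsum_add_le[of K v "\<lambda>k. c * w k"] \<open>C > 0\<close> that
      by (intro mult_left_mono) (simp_all add: sqsum_scale)
    then show ?thesis using C[of "\<lambda>k. v k + c * w k"] by (simp add: algebra_simps)
  qed
  have *: "cmod (sesq K q v w) \<le> 2 * C * (sqsum K v + sqsum K w)" for v
  proof -
    have tri: "cmod (a - b - \<i> * c + \<i> * d) \<le> cmod a + cmod b + cmod c + cmod d" for a b c d
      using norm_triangle_ineq[of "a - b - \<i> * c" "\<i> * d"] norm_triangle_ineq4[of "a - b" "\<i> * c"]
        norm_triangle_ineq4[of a b] by (simp add: norm_mult)
    have "4 * cmod (sesq K q v w) = cmod (4 * sesq K q v w)" by (simp add: norm_mult)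
    also have "\<dots> \<le> 4 * (2 * C * (sqsum K v + sqsum K w))"
      unfolding sesq_polarization
      using tri bd[of 1 v] bd[of "-1" v] bd[of \<i> v] bd[of "-\<i>" v]
      by (intro order_trans[OF tri]) simp
    finally show ?thesis by simp
  qed
  define N where "N = sqsum K (\<lambda>k. \<Sum>l\<in>K. q k l * w l)"
  \<comment> \<open>With this scale the estimate reads
    \<open>N / (4 C) \<le> N / (8 C) + 2 C |w|^2\<close>, so half of the left side survives and
    yields the constant \<open>(4 C)^2\<close>.\<close>
  define s where "s = 1 / (4 * C)"
  have "s > 0" using \<open>C > 0\<close> by (simp add: s_def)
  have "sesq K q (\<lambda>k. \<Sum>l\<in>K. q k l * w l) w = of_real N"
    unfolding sesq_eq_sum N_def sqsum_def of_real_sum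
    by (intro sum.cong refl) (metis complex_norm_square mult.commute)
  then have "sesq K q (\<lambda>k. of_real s * (\<Sum>l\<in>K. q k l * w l)) w = of_real (s * N)"
    by (simp add: sesq_scale_left)
  moreover have "cmod (of_real (s * N)) = s * N"
    using \<open>s > 0\<close> sqsum_nonneg[of K "\<lambda>k. \<Sum>l\<in>K. q k l * w l"]
    unfolding norm_of_real N_def by simp
  ultimately have "s * N \<le> 2 * C * (s\<^sup>2 * N + sqsum K w)"
    using *[of "\<lambda>k. of_real s * (\<Sum>l\<in>K. q k l * w l)"] \<open>s > 0\<close>
    by (simp add: sqsum_scale N_def del: of_real_mult)
  then show ?thesis
    using \<open>C > 0\<close> unfolding N_def[symmetric] s_def by (simp add: field_simps power2_eq_square)
qed


section \<open>Matrix coordinates\<close>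

text \<open>Uniform boundedness of a family of matrices is expressed by the numerical radius, which is
  equivalent to the operator norm and needs only the quadratic forms.\<close>

locale coords = star_algebra A for A :: "'a star_algebra" (structure) +
  fixes I :: "'i set" and d :: "'i \<Rightarrow> nat" and co :: "'i \<Rightarrow> 'a \<Rightarrow> nat \<Rightarrow> nat \<Rightarrow> complex"
  assumes d_pos: "i \<in> I \<Longrightarrow> 0 < d i"
    and co_add: "\<lbrakk>x \<in> carrier A; y \<in> carrier A; i \<in> I; a < d i; b < d i\<rbrakk> \<Longrightarrow>
      co i (x \<oplus> y) a b = co i x a b + co i y a b"
    and co_smult: "\<lbrakk>x \<in> carrier A; i \<in> I; a < d i; b < d i\<rbrakk> \<Longrightarrow> co i (c \<odot> x) a b = c * co i x a b"
    and co_mult: "\<lbrakk>x \<in> carrier A; y \<in> carrier A; i \<in> I; a < d i; b < d i\<rbrakk> \<Longrightarrow>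
      co i (x \<otimes> y) a b = (\<Sum>c<d i. co i x a c * co i y c b)"
    and co_one: "\<lbrakk>i \<in> I; a < d i; b < d i\<rbrakk> \<Longrightarrow> co i \<one> a b = (if a = b then 1 else 0)"
    and co_star: "\<lbrakk>x \<in> carrier A; i \<in> I; a < d i; b < d i\<rbrakk> \<Longrightarrow> co i (star A x) a b = cnj (co i x b a)"
    and co_eqI: "\<lbrakk>x \<in> carrier A; y \<in> carrier A;
      \<And>i a b. \<lbrakk>i \<in> I; a < d i; b < d i\<rbrakk> \<Longrightarrow> co i x a b = co i y a b\<rbrakk> \<Longrightarrow> x = y"
    and co_bounded: "x \<in> carrier A \<Longrightarrow>
      \<exists>C. \<forall>i\<in>I. \<forall>v. cmod (sesq {..<d i} (co i x) v v) \<le> C * sqsum {..<d i} v"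
    and co_surj: "\<forall>i\<in>I. \<forall>v. cmod (sesq {..<d i} (m i) v v) \<le> C * sqsum {..<d i} v \<Longrightarrow>
      \<exists>x\<in>carrier A. \<forall>i\<in>I. \<forall>a<d i. \<forall>b<d i. co i x a b = m i a b"
begin

section \<open>Quadratic forms of algebra elements\<close>

definition sf :: "'i \<Rightarrow> 'a \<Rightarrow> (nat \<Rightarrow> complex) \<Rightarrow> (nat \<Rightarrow> complex) \<Rightarrow> complex" where
  "sf i x v w = sesq {..<d i} (co i x) v w"

lemma smult_closed' [simp, intro]: "x \<in> carrier A \<Longrightarrow> c \<odot> x \<in> carrier A"
  by (rule smult_closed) simp_all

lemmas star_closed' [simp, intro] = star_closed

lemma co_zero: "\<lbrakk>i \<in> I; a < d i; b < d i\<rbrakk> \<Longrightarrow> co i \<zero> a b = 0"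
  using co_add[of \<zero> \<zero> i a b] by simp

lemma abelian_group_A: "abelian_group A"
  by (rule ring.is_abelian_group[OF star_algebra.axioms(1)[OF star_algebra_axioms]])

lemmas minus_closed' [simp, intro] = abelian_group.minus_closed[OF abelian_group_A]

lemmas finsum_closed' = abelian_monoid.finsum_closed[OF abelian_group.axioms(1)[OF abelian_group_A]]

lemmas finsum_cong'' = abelian_monoid.finsum_cong'[OF abelian_group.axioms(1)[OF abelian_group_A]]

lemma co_minus: "\<lbrakk>x \<in> carrier A; y \<in> carrier A; i \<in> I; a < d i; b < d i\<rbrakk> \<Longrightarrow>
    co i (x \<ominus> y) a b = co i x a b - co i y a b"
proof -
  assume *: "x \<in> carrier A" "y \<in> carrier A" "i \<in> I" "a < d i" "b < d i"

  have "co i (y \<oplus> \<ominus> y) a b = 0" using * by (simp add: abelian_group.r_neg[OF abelian_group_A] co_zero)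
  then show ?thesis using * by (simp add: a_minus_def co_add eq_neg_iff_add_eq_0 add.commute)
qed

lemma co_finsum:
  assumes "finite M" "f \<in> M \<rightarrow> carrier A" "i \<in> I" "a < d i" "b < d i"
  shows "co i (\<Oplus>m\<in>M. f m) a b = (\<Sum>m\<in>M. co i (f m) a b)"
  using assms(1,2)
proof (induction M rule: finite_induct)
  case empty
  then show ?case using assms by (simp add: co_zero)
next
  case (insert m M)
  then have "f \<in> M \<rightarrow> carrier A" "f m \<in> carrier A" by auto
  then show ?case using insert assms by (simp add: co_add finsum_closed)
qed

lemma sf_add: "\<lbrakk>x \<in> carrier A; y \<in> carrier A; i \<in> I\<rbrakk> \<Longrightarrow> sf i (x \<oplus> y) v w = sf i x v w + sf i y v w"
  unfolding sf_def sesq_kernel_add[symmetric] by (rule sesq_cong) (simp_all add: co_add)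

lemma sf_minus: "\<lbrakk>x \<in> carrier A; y \<in> carrier A; i \<in> I\<rbrakk> \<Longrightarrow> sf i (x \<ominus> y) v w = sf i x v w - sf i y v w"
  unfolding sf_def sesq_kernel_diff[symmetric] by (rule sesq_cong) (simp_all add: co_minus)

lemma sf_smult: "\<lbrakk>x \<in> carrier A; i \<in> I\<rbrakk> \<Longrightarrow> sf i (c \<odot> x) v w = c * sf i x v w"
  unfolding sf_def sesq_kernel_scale[symmetric] by (rule sesq_cong) (simp_all add: co_smult)

lemma sf_zero: "i \<in> I \<Longrightarrow> sf i \<zero> v w = 0"
  unfolding sf_def sesq_def by (simp add: co_zero)

lemma sf_finsum:
  assumes "finite M" "f \<in> M \<rightarrow> carrier A" "i \<in> I"
  shows "sf i (\<Oplus>m\<in>M. f m) v w = (\<Sum>m\<in>M. sf i (f m) v w)"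
  using assms(1,2)
proof (induction M rule: finite_induct)
  case empty
  then show ?case using assms by (simp add: sf_zero)
next
  case (insert m M)
  then have "f \<in> M \<rightarrow> carrier A" "f m \<in> carrier A" by auto
  then show ?case using insert assms by (simp add: sf_add finsum_closed)
qed

lemma sf_one: "i \<in> I \<Longrightarrow> sf i \<one> v v = of_real (sqsum {..<d i} v)"
proof -
  assume i: "i \<in> I"
  have "sf i \<one> v v = (\<Sum>k<d i. \<Sum>l<d i. if l = k then cnj (v k) * v k else 0)"
    unfolding sf_def sesq_def using i by (intro sum.cong refl) (auto simp: co_one)
  also have "\<dots> = (\<Sum>k<d i. cnj (v k) * v k)" by simp
  also have "\<dots> = of_real (sqsum {..<d i} v)"
    unfolding sqsum_def of_real_sum by (intro sum.cong refl) (metis complex_norm_square mult.commute)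
  finally show ?thesis .
qed

lemma sf_star: "\<lbrakk>x \<in> carrier A; i \<in> I\<rbrakk> \<Longrightarrow> sf i (star A x) v w = cnj (sf i x w v)"
proof -
  assume *: "x \<in> carrier A" "i \<in> I"
  have "sf i (star A x) v w = (\<Sum>k<d i. \<Sum>l<d i. cnj (cnj (w l) * co i x l k * v k))"
    unfolding sf_def sesq_def using * by (intro sum.cong refl) (simp add: co_star mult_ac)
  also have "\<dots> = cnj (sf i x w v)" unfolding sf_def sesq_def by (subst sum.swap) simp
  finally show ?thesis .
qed

lemma co_eq_sf: "\<lbrakk>i \<in> I; a < d i; b < d i\<rbrakk> \<Longrightarrow> co i x a b = sf i x (unit_fun a) (unit_fun b)"
  unfolding sf_def by (subst sesq_unit_unit) auto

lemma sf_polarization: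
  "sf i x v w = (sf i x (\<lambda>k. v k + w k) (\<lambda>k. v k + w k) - sf i x (\<lambda>k. v k - w k) (\<lambda>k. v k - w k)
     - \<i> * sf i x (\<lambda>k. v k + \<i> * w k) (\<lambda>k. v k + \<i> * w k)
     + \<i> * sf i x (\<lambda>k. v k - \<i> * w k) (\<lambda>k. v k - \<i> * w k)) / 4"
  unfolding sf_def by (subst sesq_polarization[symmetric]) simp

lemma sf_eqI:
  assumes "x \<in> carrier A" "y \<in> carrier A" "\<And>i v. i \<in> I \<Longrightarrow> sf i x v v = sf i y v v"
  shows "x = y"
  using assms(1,2)
proof (rule co_eqI)
  fix i a b assume "i \<in> I" "a < d i" "b < d i"
  then show "co i x a b = co i y a b"
    using assms(3) by (simp add: co_eq_sf sf_polarization[of i _ "unit_fun a" "unit_fun b"])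
qed

section \<open>Positivity in matrix algebras over the algebra\<close>

definition bform :: "'i \<Rightarrow> nat \<Rightarrow> (nat \<Rightarrow> nat \<Rightarrow> 'a) \<Rightarrow> (nat \<Rightarrow> nat \<Rightarrow> complex) \<Rightarrow> complex" where
  "bform i n X v = (\<Sum>k<n. \<Sum>l<n. sf i (X k l) (v k) (v l))"

definition block_nonneg :: "nat \<Rightarrow> (nat \<Rightarrow> nat \<Rightarrow> 'a) \<Rightarrow> bool" where
  "block_nonneg n X \<longleftrightarrow> (\<forall>i\<in>I. \<forall>v. 0 \<le> bform i n X v)"

text \<open>Families of \<open>n\<close> vectors on a block and vectors on the product index set
  correspond by currying.\<close>

lemma block_nonneg_iff_psd:
  "block_nonneg n X \<longleftrightarrow>
     (\<forall>i\<in>I. psd ({..<n} \<times> {..<d i}) (\<lambda>(k, a) (l, b). co i (X k l) a b))"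
  unfolding block_nonneg_def bform_def psd_def sesq_Times sf_def split
proof (intro ball_cong refl iffI allI)
  fix i v assume *: "\<forall>v. 0 \<le> (\<Sum>k<n. \<Sum>l<n. sesq {..<d i} (co i (X k l)) (v k) (v l))"
  show "0 \<le> (\<Sum>k<n. \<Sum>l<n. sesq {..<d i} (\<lambda>a b. co i (X k l) a b) (\<lambda>a. v (k, a)) (\<lambda>b. v (l, b)))"
    using *[rule_format, of "\<lambda>k a. v (k, a)"] .
next
  fix i v assume *: "\<forall>v. 0 \<le> (\<Sum>k<n. \<Sum>l<n. sesq {..<d i} (\<lambda>a b. co i (X k l) a b) (\<lambda>a. v (k, a)) (\<lambda>b. v (l, b)))"
  show "0 \<le> (\<Sum>k<n. \<Sum>l<n. sesq {..<d i} (co i (X k l)) (v k) (v l))"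
    using *[rule_format, of "\<lambda>(k, a). v k a"] by simp
qed

lemma co_star_mult_finsum:
  fixes n :: nat
  assumes "\<And>m k. m < n \<Longrightarrow> k < n \<Longrightarrow> Y m k \<in> carrier A" "k < n" "l < n" "i \<in> I" "a < d i" "b < d i"
  shows "co i (\<Oplus>m\<in>{..<n}. star A (Y m k) \<otimes> Y m l) a b =
    (\<Sum>(m, c)\<in>{..<n} \<times> {..<d i}. cnj (co i (Y m k) c a) * co i (Y m l) c b)"
proof -
  have "co i (\<Oplus>m\<in>{..<n}. star A (Y m k) \<otimes> Y m l) a b = (\<Sum>m<n. co i (star A (Y m k) \<otimes> Y m l) a b)"
    by (rule co_finsum) (use assms in auto)
  also have "\<dots> = (\<Sum>m<n. \<Sum>c<d i. cnj (co i (Y m k) c a) * co i (Y m l) c b)"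
    using assms by (intro sum.cong refl) (simp add: co_mult co_star)
  finally show ?thesis by (simp add: sum.cartesian_product)
qed

lemma Gram_block_nonneg:
  assumes "\<And>m k. m < n \<Longrightarrow> k < n \<Longrightarrow> Y m k \<in> carrier A"
  shows "block_nonneg n (\<lambda>k l. \<Oplus>m\<in>{..<n}. star A (Y m k) \<otimes> Y m l)"
  unfolding block_nonneg_iff_psd
proof
  fix i assume i: "i \<in> I"
  show "psd ({..<n} \<times> {..<d i}) (\<lambda>(k, a) (l, b). co i (\<Oplus>m\<in>{..<n}. star A (Y m k) \<otimes> Y m l) a b)"
    by (rule psd_Gram(2)[where M = "{..<n} \<times> {..<d i}" and y = "\<lambda>(m, c) (k, a). co i (Y m k) c a"])
      (use assms i co_star_mult_finsum[of n Y] in \<open>auto simp: case_prod_unfold\<close>)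
qed

text \<open>The factors are taken on each block separately. Their size matches, so they assemble
  into an \<open>n\<close> by \<open>n\<close> matrix of families; what remains is a bound that is
  uniform over the blocks.\<close>

lemma block_nonneg_Gram:
  assumes X: "\<And>k l. k < n \<Longrightarrow> l < n \<Longrightarrow> X k l \<in> carrier A" and pos: "block_nonneg n X"
  obtains Y where "\<And>m k. m < n \<Longrightarrow> k < n \<Longrightarrow> Y m k \<in> carrier A"
    and "\<And>k l. k < n \<Longrightarrow> l < n \<Longrightarrow> X k l = (\<Oplus>m\<in>{..<n}. star A (Y m k) \<otimes> Y m l)"
proof -
  have "\<exists>y. \<forall>k l a b. k < n \<longrightarrow> l < n \<longrightarrow> a < d i \<longrightarrow> b < d i \<longrightarrow>
      co i (X k l) a b = (\<Sum>m\<in>{..<n} \<times> {..<d i}. cnj (y m (k, a)) * y m (l, b))" if i: "i \<in> I" for i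
  proof -
    define q where "q = (\<lambda>(k, a) (l, b). co i (X k l) a b)"
    define K where "K = {..<n} \<times> {..<d i}"
    have "psd K q" "finite K"
      using pos i by (simp_all add: block_nonneg_iff_psd q_def K_def)
    then obtain y where y: "\<And>k l. k \<in> K \<Longrightarrow> l \<in> K \<Longrightarrow> q k l = (\<Sum>m\<in>K. cnj (y m k) * y m l)"
      using psd_Cholesky[of K q] by blast
    show ?thesis
    proof (intro exI[of _ y] allI impI)
      fix k l a b assume "k < n" "l < n" "a < d i" "b < d i"
      then have "(k, a) \<in> K" "(l, b) \<in> K" by (simp_all add: K_def)
      from y[OF this]
      show "co i (X k l) a b = (\<Sum>m\<in>{..<n} \<times> {..<d i}. cnj (y m (k, a)) * y m (l, b))"
        unfolding q_def K_def split .
    qed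
  qed
  then have "\<forall>i\<in>I. \<exists>y. \<forall>k l a b. k < n \<longrightarrow> l < n \<longrightarrow> a < d i \<longrightarrow> b < d i \<longrightarrow>
      co i (X k l) a b = (\<Sum>m\<in>{..<n} \<times> {..<d i}. cnj (y m (k, a)) * y m (l, b))" by blast
  from bchoice[OF this]
  obtain y where y: "\<And>i k l a b. i \<in> I \<Longrightarrow> k < n \<Longrightarrow> l < n \<Longrightarrow> a < d i \<Longrightarrow> b < d i \<Longrightarrow>
      co i (X k l) a b = (\<Sum>m\<in>{..<n} \<times> {..<d i}. cnj (y i m (k, a)) * y i m (l, b))"
    by blast
  have "\<exists>x\<in>carrier A. \<forall>i\<in>I. \<forall>c<d i. \<forall>b<d i. co i x c b = y i (m, c) (l, b)"
    if ml: "m < n" "l < n" for m l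
  proof -
    obtain C where C: "\<And>i v. i \<in> I \<Longrightarrow> cmod (sf i (X l l) v v) \<le> C * sqsum {..<d i} v"
      using co_bounded[OF X[OF ml(2) ml(2)]] unfolding sf_def by blast
    have "cmod (sesq {..<d i} (\<lambda>c b. y i (m, c) (l, b)) v v) \<le> (1 + C) * sqsum {..<d i} v"
      if i: "i \<in> I" for i v
    proof -
      let ?w = "\<lambda>m. \<Sum>b<d i. y i m (l, b) * v b"
      have "cmod (sesq {..<d i} (\<lambda>c b. y i (m, c) (l, b)) v v)
          \<le> sqsum {..<d i} v + sqsum {..<d i} (\<lambda>c. ?w (m, c))"
        unfolding sesq_eq_sum by (rule cmod_sum_product_le)
      also have "sqsum {..<d i} (\<lambda>c. ?w (m, c)) = sqsum ({m} \<times> {..<d i}) ?w"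
        unfolding sqsum_def by (simp add: sum.cartesian_product')
      \<comment> \<open>One row of the factor contributes at most what all rows contribute together,
        and that total is the form of the diagonal entry \<open>X l l\<close>, which is uniformly
        bounded.\<close>
      also have "\<dots> \<le> sqsum ({..<n} \<times> {..<d i}) ?w"
        unfolding sqsum_def using ml by (intro sum_mono2) auto
      also have "\<dots> = Re (sf i (X l l) v v)"
        unfolding sf_def
        by (subst psd_Gram(1)[where M = "{..<n} \<times> {..<d i}" and y = "\<lambda>m b. y i m (l, b)"])
          (use y i ml in auto)
      also have "\<dots> \<le> C * sqsum {..<d i} v"
        by (rule order_trans[OF complex_Re_le_cmod C[OF i]])
      finally show ?thesis by (simp add: algebra_simps)
    qed
    then show ?thesis by (intro co_surj) blast
  qed
  then obtain Y where Y: "\<And>m l. m < n \<Longrightarrow> l < n \<Longrightarrow> Y m l \<in> carrier A"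
    "\<And>m l i c b. m < n \<Longrightarrow> l < n \<Longrightarrow> i \<in> I \<Longrightarrow> c < d i \<Longrightarrow> b < d i \<Longrightarrow> co i (Y m l) c b = y i (m, c) (l, b)"
    by metis
  show ?thesis
  proof (rule that[of Y])
    show "Y m k \<in> carrier A" if "m < n" "k < n" for m k using Y(1) that .
    show "X k l = (\<Oplus>m\<in>{..<n}. star A (Y m k) \<otimes> Y m l)" if kl: "k < n" "l < n" for k l
    proof (rule co_eqI)
      show "X k l \<in> carrier A" using X kl .
      show "(\<Oplus>m\<in>{..<n}. star A (Y m k) \<otimes> Y m l) \<in> carrier A"
        by (rule finsum_closed') (use Y(1) kl in auto)
      fix i a b assume i: "i \<in> I" "a < d i" "b < d i"
      show "co i (X k l) a b = co i (\<Oplus>m\<in>{..<n}. star A (Y m k) \<otimes> Y m l) a b"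
      proof -
        have "co i (\<Oplus>m\<in>{..<n}. star A (Y m k) \<otimes> Y m l) a b =
            (\<Sum>(m, c)\<in>{..<n} \<times> {..<d i}. cnj (co i (Y m k) c a) * co i (Y m l) c b)"
          by (rule co_star_mult_finsum) (use Y(1) kl i in auto)
        also have "\<dots> = co i (X k l) a b"
          unfolding y[OF i(1) kl i(2,3)] by (intro sum.cong refl) (use Y(2) kl i in auto)
        finally show ?thesis ..
      qed
    qed
  qed
qed

lemma in_matrix_algebra_iff:
  "X \<in> carrier (matrix_algebra A n) \<longleftrightarrow> X \<in> carrier_mat n n \<and> (\<forall>k<n. \<forall>l<n. X $$ (k, l) \<in> carrier A)"
  unfolding matrix_algebra_def elements_mat_def
  by (auto simp: UN_subset_iff image_subset_iff)

lemma positive_matrix_iff: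
  assumes X: "X \<in> carrier (matrix_algebra A n)"
  shows "positive (matrix_algebra A n) X \<longleftrightarrow> block_nonneg n (\<lambda>k l. X $$ (k, l))"
proof
  assume "positive (matrix_algebra A n) X"
  then obtain Y where Y: "Y \<in> carrier (matrix_algebra A n)"
    "X = star (matrix_algebra A n) Y \<otimes>\<^bsub>matrix_algebra A n\<^esub> Y"
    unfolding positive_def by blast
  have *: "X $$ (k, l) = (\<Oplus>m\<in>{..<n}. star A (Y $$ (m, k)) \<otimes> Y $$ (m, l))" if "k < n" "l < n" for k l
    unfolding Y(2) using that Y(1) unfolding in_matrix_algebra_iff
    by (auto simp: matrix_algebra_def intro!: finsum_cong'')
  have "block_nonneg n (\<lambda>k l. \<Oplus>m\<in>{..<n}. star A (Y $$ (m, k)) \<otimes> Y $$ (m, l))"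
    by (rule Gram_block_nonneg) (use Y(1) in \<open>simp add: in_matrix_algebra_iff\<close>)
  then show "block_nonneg n (\<lambda>k l. X $$ (k, l))"
    unfolding block_nonneg_def bform_def by (simp add: *)
next
  assume pos: "block_nonneg n (\<lambda>k l. X $$ (k, l))"
  obtain Y where Y: "\<And>m k. m < n \<Longrightarrow> k < n \<Longrightarrow> Y m k \<in> carrier A"
    "\<And>k l. k < n \<Longrightarrow> l < n \<Longrightarrow> X $$ (k, l) = (\<Oplus>m\<in>{..<n}. star A (Y m k) \<otimes> Y m l)"
    using block_nonneg_Gram[OF _ pos] X unfolding in_matrix_algebra_iff by blast
  let ?Y = "mat n n (\<lambda>(m, k). Y m k)"
  have "?Y \<in> carrier (matrix_algebra A n)" unfolding in_matrix_algebra_iff using Y(1) by simp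
  moreover have "X = star (matrix_algebra A n) ?Y \<otimes>\<^bsub>matrix_algebra A n\<^esub> ?Y"
    using X Y unfolding in_matrix_algebra_iff
    by (intro eq_matI) (auto simp: matrix_algebra_def intro!: finsum_cong'')
  ultimately show "positive (matrix_algebra A n) X" unfolding positive_def by blast
qed

text \<open>Makes the criterion for matrices of size one available for the algebra itself.\<close>

lemma positive_iff_matrix:
  assumes "x \<in> carrier A"
  shows "positive A x \<longleftrightarrow> positive (matrix_algebra A 1) (mat 1 1 (\<lambda>_. x))"
proof
  assume "positive A x"
  then obtain b where "b \<in> carrier A" "x = star A b \<otimes> b" unfolding positive_def by blast
  then have "mat 1 1 (\<lambda>_. b) \<in> carrier (matrix_algebra A 1)"
    "mat 1 1 (\<lambda>_. x) = star (matrix_algebra A 1) (mat 1 1 (\<lambda>_. b)) \<otimes>\<^bsub>matrix_algebra A 1\<^esub> mat 1 1 (\<lambda>_. b)"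
    unfolding in_matrix_algebra_iff
    by (auto intro!: eq_matI simp: matrix_algebra_def lessThan_Suc)
  then show "positive (matrix_algebra A 1) (mat 1 1 (\<lambda>_. x))" unfolding positive_def by blast
next
  assume "positive (matrix_algebra A 1) (mat 1 1 (\<lambda>_. x))"
  then obtain Y where Y: "Y \<in> carrier (matrix_algebra A 1)"
    "mat 1 1 (\<lambda>_. x) = star (matrix_algebra A 1) Y \<otimes>\<^bsub>matrix_algebra A 1\<^esub> Y"
    unfolding positive_def by blast
  have "Y $$ (0, 0) \<in> carrier A" using Y(1) unfolding in_matrix_algebra_iff by simp
  moreover from this have "x = star A (Y $$ (0, 0)) \<otimes> Y $$ (0, 0)"
    using arg_cong[OF Y(2), of "\<lambda>M. M $$ (0, 0)"] by (simp add: matrix_algebra_def lessThan_Suc)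
  ultimately show "positive A x" unfolding positive_def by blast
qed

lemma positive_iff:
  assumes "x \<in> carrier A"
  shows "positive A x \<longleftrightarrow> (\<forall>i\<in>I. \<forall>v. 0 \<le> sf i x v v)"
proof -
  have "mat 1 1 (\<lambda>_. x) \<in> carrier (matrix_algebra A 1)"
    unfolding in_matrix_algebra_iff using assms by simp
  then show ?thesis
    unfolding positive_iff_matrix[OF assms]
    by (subst positive_matrix_iff) (auto simp: block_nonneg_def bform_def lessThan_Suc dest: spec[of _ "\<lambda>_. v" for v])
qed

end

section \<open>Coordinates of a hereditarily atomic algebra\<close>

lemma opnorm_le_iff_sqsum:
  assumes "X \<in> carrier_mat n n" "0 \<le> C"
  shows "opnorm_le X C \<longleftrightarrow> (\<forall>v. sqsum {..<n} (\<lambda>a. \<Sum>b<n. X $$ (a, b) * v b) \<le> C\<^sup>2 * sqsum {..<n} v)"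
proof -
  have 1: "euclidean_norm v = sqrt (sqsum {..<n} (\<lambda>a. v $ a))" if "v \<in> carrier_vec n" for v
    using that by (simp add: euclidean_norm_def sqsum_def)
  have 2: "sqsum {..<n} (\<lambda>a. (X *\<^sub>v v) $ a) = sqsum {..<n} (\<lambda>a. \<Sum>b<n. X $$ (a, b) * v $ b)"
    if "v \<in> carrier_vec n" for v
    unfolding sqsum_def using assms that
    by (intro sum.cong refl) (simp add: scalar_prod_def atLeast0LessThan)
  have 3: "sqrt a \<le> C * sqrt b \<longleftrightarrow> a \<le> C\<^sup>2 * b" for a b
  proof -
    have "C * sqrt b = sqrt (C\<^sup>2 * b)" using assms(2) by (simp add: real_sqrt_mult)
    then show ?thesis by simp
  qed
  have "opnorm_le X C \<longleftrightarrow> (\<forall>v\<in>carrier_vec n.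
      sqsum {..<n} (\<lambda>a. \<Sum>b<n. X $$ (a, b) * v $ b) \<le> C\<^sup>2 * sqsum {..<n} (\<lambda>a. v $ a))"
    unfolding opnorm_le_def using assms(1)
    by (auto simp: 1[OF mult_mat_vec_carrier[OF assms(1)]] 1 2 3)
  also have "\<dots> \<longleftrightarrow> (\<forall>v. sqsum {..<n} (\<lambda>a. \<Sum>b<n. X $$ (a, b) * v b) \<le> C\<^sup>2 * sqsum {..<n} v)"
  proof (intro iffI allI ballI)
    fix v assume *: "\<forall>v\<in>carrier_vec n.
      sqsum {..<n} (\<lambda>a. \<Sum>b<n. X $$ (a, b) * v $ b) \<le> C\<^sup>2 * sqsum {..<n} (\<lambda>a. v $ a)"
    show "sqsum {..<n} (\<lambda>a. \<Sum>b<n. X $$ (a, b) * v b) \<le> C\<^sup>2 * sqsum {..<n} v"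
      using *[rule_format, of "vec n v"] by (simp add: sqsum_def)
  qed blast
  finally show ?thesis .
qed

lemma opnorm_le_mono:
  assumes "opnorm_le X C" "C \<le> C'"
  shows "opnorm_le X C'"
proof -
  have "C * euclidean_norm v \<le> C' * euclidean_norm v" for v
    using assms(2) by (intro mult_right_mono) (simp_all add: euclidean_norm_def sum_nonneg)
  then show ?thesis using assms(1) unfolding opnorm_le_def by (meson order_trans)
qed

lemma mat_adjoint_index:
  fixes X :: "complex mat"
  assumes "X \<in> carrier_mat n n" "a < n" "b < n"
  shows "mat_adjoint X $$ (a, b) = cnj (X $$ (b, a))"
  using assms by (simp add: mat_adjoint_def mat_of_rows_def conjugate_complex_def)

text \<open>The coordinates are the matrix entries after the star isomorphism. Boundedness passes
  from the operator norm to the numerical radius by Cauchy-Schwarz type estimates and back by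
  polarization.\<close>

lemma hereditarily_atomic_coords:
  fixes A :: "'a star_algebra"
  assumes "hereditarily_atomic A"
  obtains I :: "'a set" and d co where "coords A I d co"
proof -
  interpret hereditarily_atomic A by fact
  obtain I :: "'a set" and d h where d: "\<And>i. i \<in> I \<Longrightarrow> d i > 0"
    and h: "h \<in> star_iso A (linf_matrix_product I d)"
    using atomic_decomposition by blast
  let ?P = "linf_matrix_product I d"
  have hh: "h \<in> Ring.ring_hom A ?P" and bij: "bij_betw h (carrier A) (carrier ?P)"
    using h by (auto simp: star_iso_def ring_iso_def)
  have hs: "h (c \<odot>\<^bsub>A\<^esub> x) = c \<odot>\<^bsub>?P\<^esub> h x" "h (star A x) = star ?P (h x)" if "x \<in> carrier A" for c x
    using h that by (auto simp: star_iso_def)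
  have mat: "h x i \<in> carrier_mat (d i) (d i)" if "x \<in> carrier A" "i \<in> I" for x i
    using ring_hom_closed[OF hh that(1)] that(2) by (auto simp: linf_matrix_product_def)
  define co where "co = (\<lambda>i x a b. h x i $$ (a, b))"
  have "coords A I d co"
  proof (intro coords.intro coords_axioms.intro)
    show "star_algebra A" by (rule star_algebra_axioms)
    show "0 < d i" if "i \<in> I" for i using d that .
    show "co i (x \<oplus>\<^bsub>A\<^esub> y) a b = co i x a b + co i y a b"
      if "x \<in> carrier A" "y \<in> carrier A" "i \<in> I" "a < d i" "b < d i" for x y i a b
      using mat[OF that(1,3)] mat[OF that(2,3)] that ring_hom_add[OF hh that(1,2)]
      by (simp add: co_def linf_matrix_product_def)
    show "co i (c \<odot>\<^bsub>A\<^esub> x) a b = c * co i x a b"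
      if "x \<in> carrier A" "i \<in> I" "a < d i" "b < d i" for x i a b c
      using mat[OF that(1,2)] that hs(1)[OF that(1), of c]
      by (simp add: co_def linf_matrix_product_def)
    show "co i (x \<otimes>\<^bsub>A\<^esub> y) a b = (\<Sum>c<d i. co i x a c * co i y c b)"
      if "x \<in> carrier A" "y \<in> carrier A" "i \<in> I" "a < d i" "b < d i" for x y i a b
      using mat[OF that(1,3)] mat[OF that(2,3)] that ring_hom_mult[OF hh that(1,2)]
      by (simp add: co_def linf_matrix_product_def scalar_prod_def atLeast0LessThan)
    show "co i \<one>\<^bsub>A\<^esub> a b = (if a = b then 1 else 0)" if "i \<in> I" "a < d i" "b < d i" for i a b
      using that ring_hom_one[OF hh] by (simp add: co_def linf_matrix_product_def)
    show "co i (star A x) a b = cnj (co i x b a)"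
      if "x \<in> carrier A" "i \<in> I" "a < d i" "b < d i" for x i a b
      using mat_adjoint_index[OF mat[OF that(1,2)] that(3,4)] that hs(2)[OF that(1)]
      by (simp add: co_def linf_matrix_product_def)
    show "x = y" if xy: "x \<in> carrier A" "y \<in> carrier A"
      and eq: "\<And>i a b. \<lbrakk>i \<in> I; a < d i; b < d i\<rbrakk> \<Longrightarrow> co i x a b = co i y a b" for x y
    proof -
      have "h x i = h y i" if "i \<in> I" for i
        using mat[OF xy(1) that] mat[OF xy(2) that] eq[OF that]
        by (intro eq_matI) (auto simp: co_def)
      moreover have "h x \<in> (\<Pi>\<^sub>E i\<in>I. carrier_mat (d i) (d i))" "h y \<in> (\<Pi>\<^sub>E i\<in>I. carrier_mat (d i) (d i))"
        using ring_hom_closed[OF hh xy(1)] ring_hom_closed[OF hh xy(2)]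
        by (auto simp: linf_matrix_product_def)
      ultimately have "h x = h y" by (intro PiE_ext)
      then show ?thesis using bij xy by (auto simp: bij_betw_def inj_on_def)
    qed
    show "\<exists>C. \<forall>i\<in>I. \<forall>v. cmod (sesq {..<d i} (co i x) v v) \<le> C * sqsum {..<d i} v"
      if x: "x \<in> carrier A" for x
    proof -
      obtain C where "\<forall>i\<in>I. opnorm_le (h x i) C"
        using ring_hom_closed[OF hh x] by (auto simp: linf_matrix_product_def)
      \<comment> \<open>The criterion for \<open>opnorm_le\<close> squares the bound and therefore
        needs it nonnegative.\<close>
      then have C: "opnorm_le (h x i) (max C 0)" if "i \<in> I" for i
        using that opnorm_le_mono[of _ C "max C 0"] by simp
      have "cmod (sesq {..<d i} (co i x) v v) \<le> (1 + (max C 0)\<^sup>2) * sqsum {..<d i} v" if i: "i \<in> I" for i v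
      proof -
        have "cmod (sesq {..<d i} (co i x) v v)
            \<le> sqsum {..<d i} v + sqsum {..<d i} (\<lambda>a. \<Sum>b<d i. h x i $$ (a, b) * v b)"
          unfolding sesq_eq_sum co_def by (rule cmod_sum_product_le)
        also have "\<dots> \<le> sqsum {..<d i} v + (max C 0)\<^sup>2 * sqsum {..<d i} v"
          using C[OF i] unfolding opnorm_le_iff_sqsum[OF mat[OF x i] max.cobounded2] by simp
        finally show ?thesis by (simp add: algebra_simps)
      qed
      then show ?thesis by blast
    qed
    show "\<exists>x\<in>carrier A. \<forall>i\<in>I. \<forall>a<d i. \<forall>b<d i. co i x a b = m i a b"
      if m: "\<forall>i\<in>I. \<forall>v. cmod (sesq {..<d i} (m i) v v) \<le> C * sqsum {..<d i} v" for m C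
    proof -
      \<comment> \<open>The estimate by polarization divides by the bound, so it is made strictly
        positive.\<close>
      define C' where "C' = max C 1"
      have C': "C' > 0" by (simp add: C'_def)
      define X where "X = (\<lambda>i\<in>I. mat (d i) (d i) (\<lambda>(a, b). m i a b))"
      have "opnorm_le (X i) (4 * C')" if i: "i \<in> I" for i
      proof -
        have "cmod (sesq {..<d i} (m i) v v) \<le> C' * sqsum {..<d i} v" for v
        proof -
          have "C * sqsum {..<d i} v \<le> C' * sqsum {..<d i} v"
            by (intro mult_right_mono sqsum_nonneg) (simp add: C'_def)
          then show ?thesis using m i by (meson order_trans)
        qed
        from operator_bound_of_numerical_bound[OF this C']
        have *: "sqsum {..<d i} (\<lambda>a. \<Sum>b<d i. m i a b * v b) \<le> (4 * C')\<^sup>2 * sqsum {..<d i} v" for v .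
        have Xi: "X i \<in> carrier_mat (d i) (d i)" using i by (simp add: X_def)
        show ?thesis
          by (subst opnorm_le_iff_sqsum[OF Xi]) (use C' * i in \<open>simp_all add: X_def sqsum_def\<close>)
      qed
      then have "X \<in> carrier ?P"
        by (auto simp: linf_matrix_product_def X_def)
      then have "X \<in> h ` carrier A" using bij by (simp add: bij_betw_def)
      then obtain x where "x \<in> carrier A" "h x = X" by blast
      then show ?thesis by (intro bexI[of _ x]) (auto simp: co_def X_def)
    qed
  qed
  then show ?thesis by (rule that)
qed


section \<open>Suprema of directed nets as entrywise limits\<close>

lemma is_lubI:
  assumes "D \<subseteq> carrier L" "s \<in> carrier L" "\<And>x. x \<in> D \<Longrightarrow> x \<sqsubseteq>\<^bsub>L\<^esub> s"
    and "\<And>u. u \<in> carrier L \<Longrightarrow> (\<And>x. x \<in> D \<Longrightarrow> x \<sqsubseteq>\<^bsub>L\<^esub> u) \<Longrightarrow> s \<sqsubseteq>\<^bsub>L\<^esub> u"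
  shows "is_lub L s D"
  using assms unfolding least_def Upper_def by blast

lemma is_lubD:
  assumes "is_lub L s D" "D \<subseteq> carrier L"
  shows "s \<in> carrier L" "\<And>x. x \<in> D \<Longrightarrow> x \<sqsubseteq>\<^bsub>L\<^esub> s"
    and "\<And>u. u \<in> carrier L \<Longrightarrow> (\<And>x. x \<in> D \<Longrightarrow> x \<sqsubseteq>\<^bsub>L\<^esub> u) \<Longrightarrow> s \<sqsubseteq>\<^bsub>L\<^esub> u"
  using assms unfolding least_def Upper_def by blast+

lemma directed_dnet:
  assumes "directed L D"
    and "\<And>x. x \<in> carrier L \<Longrightarrow> x \<sqsubseteq>\<^bsub>L\<^esub> x"
    and "\<And>x y z. x \<in> carrier L \<Longrightarrow> y \<in> carrier L \<Longrightarrow> z \<in> carrier L \<Longrightarrow> x \<sqsubseteq>\<^bsub>L\<^esub> y \<Longrightarrow> y \<sqsubseteq>\<^bsub>L\<^esub> z \<Longrightarrow> x \<sqsubseteq>\<^bsub>L\<^esub> z"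
  shows "dnet (le L) D"
  unfolding dnet_def
proof (intro conjI ballI impI)
  have D: "D \<subseteq> carrier L" using assms(1) by (simp add: directed_def)
  show "D \<noteq> {}" using assms(1) by (simp add: directed_def)
  show "x \<sqsubseteq>\<^bsub>L\<^esub> x" if "x \<in> D" for x using assms(2) D that by blast
  show "x \<sqsubseteq>\<^bsub>L\<^esub> z" if "x \<in> D" "y \<in> D" "z \<in> D" "x \<sqsubseteq>\<^bsub>L\<^esub> y" "y \<sqsubseteq>\<^bsub>L\<^esub> z" for x y z
    using assms(3)[OF _ _ _ that(4,5)] D that(1-3) by blast
  show "\<exists>z\<in>D. x \<sqsubseteq>\<^bsub>L\<^esub> z \<and> y \<sqsubseteq>\<^bsub>L\<^esub> z" if "x \<in> D" "y \<in> D" for x y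
    using assms(1) that unfolding directed_def by blast
qed

lemma tendsto_complex_mono:
  fixes f g :: "'a \<Rightarrow> complex"
  assumes "(f \<longlongrightarrow> a) F" "(g \<longlongrightarrow> b) F" "F \<noteq> bot" "eventually (\<lambda>x. f x \<le> g x) F"
  shows "a \<le> b"
proof -
  have "0 \<le> b - a"
    by (rule tendsto_complex_nonneg[OF tendsto_diff[OF assms(2,1)] assms(3)])
      (use assms(4) in \<open>auto elim!: eventually_mono\<close>)
  then show ?thesis by simp
qed

context coords
begin

text \<open>Convergence of all matrix entries; on norm bounded nets this is ultraweak
  convergence.\<close>

definition tconv :: "'x filter \<Rightarrow> ('x \<Rightarrow> 'a) \<Rightarrow> 'a \<Rightarrow> bool" where
  "tconv F x l \<longleftrightarrow> (\<forall>i\<in>I. \<forall>v w. ((\<lambda>e. sf i (x e) v w) \<longlongrightarrow> sf i l v w) F)"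

lemma tconvD: "tconv F x l \<Longrightarrow> i \<in> I \<Longrightarrow> ((\<lambda>e. sf i (x e) v w) \<longlongrightarrow> sf i l v w) F"
  by (simp add: tconv_def)

lemma tconv_diagI:
  assumes "\<And>i v. i \<in> I \<Longrightarrow> ((\<lambda>e. sf i (x e) v v) \<longlongrightarrow> sf i l v v) F"
  shows "tconv F x l"
  unfolding tconv_def
proof (intro ballI allI)
  fix i v w assume i: "i \<in> I"
  show "((\<lambda>e. sf i (x e) v w) \<longlongrightarrow> sf i l v w) F"
    unfolding sf_polarization[of i _ v w] by (intro tendsto_intros assms i) simp
qed

lemma tconv_const: "tconv F (\<lambda>_. x) x"
  by (simp add: tconv_def)

lemma tconv_cong:
  assumes "tconv F x l" "eventually (\<lambda>e. x e = y e) F"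
  shows "tconv F y l"
  unfolding tconv_def
proof (intro ballI allI)
  fix i v w assume "i \<in> I"
  then show "((\<lambda>e. sf i (y e) v w) \<longlongrightarrow> sf i l v w) F"
    using assms by (intro Lim_transform_eventually[OF tconvD[OF assms(1)]]) (auto elim!: eventually_mono)
qed

lemma tconv_add:
  assumes "tconv F x l" "tconv F y m" "l \<in> carrier A" "m \<in> carrier A"
    and "eventually (\<lambda>e. x e \<in> carrier A) F" "eventually (\<lambda>e. y e \<in> carrier A) F"
  shows "tconv F (\<lambda>e. x e \<oplus> y e) (l \<oplus> m)"
  unfolding tconv_def
proof (intro ballI allI)
  fix i v w assume i: "i \<in> I"
  have "((\<lambda>e. sf i (x e) v w + sf i (y e) v w) \<longlongrightarrow> sf i (l \<oplus> m) v w) F"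
    using assms(3,4) i by (simp add: sf_add) (intro tendsto_add tconvD assms i)
  moreover have "eventually (\<lambda>e. sf i (x e) v w + sf i (y e) v w = sf i (x e \<oplus> y e) v w) F"
    using assms(5,6) by eventually_elim (simp add: sf_add i)
  ultimately show "((\<lambda>e. sf i (x e \<oplus> y e) v w) \<longlongrightarrow> sf i (l \<oplus> m) v w) F"
    by (rule Lim_transform_eventually)
qed

lemma tconv_smult:
  assumes "(c \<longlongrightarrow> c0) F" "tconv F x l" "l \<in> carrier A" "eventually (\<lambda>e. x e \<in> carrier A) F"
  shows "tconv F (\<lambda>e. c e \<odot> x e) (c0 \<odot> l)"
  unfolding tconv_def
proof (intro ballI allI)
  fix i v w assume i: "i \<in> I"
  have "((\<lambda>e. c e * sf i (x e) v w) \<longlongrightarrow> sf i (c0 \<odot> l) v w) F"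
    using assms(3) i by (simp add: sf_smult) (intro tendsto_mult tconvD assms i)
  moreover have "eventually (\<lambda>e. c e * sf i (x e) v w = sf i (c e \<odot> x e) v w) F"
    using assms(4) by eventually_elim (simp add: sf_smult i)
  ultimately show "((\<lambda>e. sf i (c e \<odot> x e) v w) \<longlongrightarrow> sf i (c0 \<odot> l) v w) F"
    by (rule Lim_transform_eventually)
qed

lemma tconv_unique:
  assumes "F \<noteq> bot" "tconv F x l" "tconv F x m" "l \<in> carrier A" "m \<in> carrier A"
  shows "l = m"
  by (rule sf_eqI[OF assms(4,5)]) (rule tendsto_unique[OF assms(1) tconvD[OF assms(2)] tconvD[OF assms(3)]])

text \<open>The common bound passes to the limit on every block, and this makes the family of limit
  matrices an element of the algebra.\<close>

lemma tconv_exists: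
  assumes F: "F \<noteq> bot"
    and conv: "\<And>i v. i \<in> I \<Longrightarrow> \<exists>z. ((\<lambda>e. sf i (x e) v v) \<longlongrightarrow> z) F"
    and bd: "\<And>i v. i \<in> I \<Longrightarrow> eventually (\<lambda>e. cmod (sf i (x e) v v) \<le> C * sqsum {..<d i} v) F"
  obtains l where "l \<in> carrier A" "tconv F x l"
proof -
  have "\<exists>z. \<forall>v. ((\<lambda>e. sf i (x e) v v) \<longlongrightarrow> z v) F" if "i \<in> I" for i
    using conv[OF that] by (intro choice) blast
  then have "\<forall>i\<in>I. \<exists>z. \<forall>v. ((\<lambda>e. sf i (x e) v v) \<longlongrightarrow> z v) F" by blast
  from bchoice[OF this] obtain z where z: "\<And>i v. i \<in> I \<Longrightarrow> ((\<lambda>e. sf i (x e) v v) \<longlongrightarrow> z i v) F"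
    by blast
  \<comment> \<open>Only limits of diagonal values are given; polarization assembles the limit
    entries from four of them.\<close>
  define m where "m = (\<lambda>i a b. let v = unit_fun a; w = unit_fun b in
     (z i (\<lambda>k. v k + w k) - z i (\<lambda>k. v k - w k) - \<i> * z i (\<lambda>k. v k + \<i> * w k)
       + \<i> * z i (\<lambda>k. v k - \<i> * w k)) / 4)"
  have m: "((\<lambda>e. co i (x e) a b) \<longlongrightarrow> m i a b) F" if i: "i \<in> I" "a < d i" "b < d i" for i a b
    unfolding co_eq_sf[OF i] sf_polarization[of i _ "unit_fun a"] m_def Let_def
    by (intro tendsto_intros z i) simp
  have lim: "((\<lambda>e. sf i (x e) v w) \<longlongrightarrow> sesq {..<d i} (m i) v w) F" if "i \<in> I" for i v w
    unfolding sf_def sesq_def using that by (intro tendsto_intros m) auto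
  have "cmod (sesq {..<d i} (m i) v v) \<le> C * sqsum {..<d i} v" if "i \<in> I" for i v
    by (rule tendsto_upperbound[OF tendsto_norm[OF lim] bd F]) (rule that)+
  then obtain l where l: "l \<in> carrier A" "\<And>i a b. i \<in> I \<Longrightarrow> a < d i \<Longrightarrow> b < d i \<Longrightarrow> co i l a b = m i a b"
    using co_surj[of m C] by blast
  have "sf i l v w = sesq {..<d i} (m i) v w" if "i \<in> I" for i v w
    unfolding sf_def by (rule sesq_cong) (use l(2) that in auto)
  then have "tconv F x l" unfolding tconv_def using lim by simp
  with l(1) show ?thesis by (rule that)
qed

section \<open>Order and suprema in the self-adjoint part\<close>

definition lea :: "'a \<Rightarrow> 'a \<Rightarrow> bool" where
  "lea x y \<longleftrightarrow> (\<forall>i\<in>I. \<forall>v. sf i x v v \<le> sf i y v v)"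

lemma positive_minus_iff: "x \<in> carrier A \<Longrightarrow> y \<in> carrier A \<Longrightarrow> positive A (y \<ominus> x) \<longleftrightarrow> lea x y"
  by (simp add: positive_iff lea_def sf_minus)

lemma lea_refl: "lea x x" by (simp add: lea_def)

lemma lea_trans: "lea x y \<Longrightarrow> lea y z \<Longrightarrow> lea x z"
  unfolding lea_def by (meson order_trans)

lemma lea_antisym: "lea x y \<Longrightarrow> lea y x \<Longrightarrow> x \<in> carrier A \<Longrightarrow> y \<in> carrier A \<Longrightarrow> x = y"
  by (rule sf_eqI) (auto simp: lea_def intro: antisym)

lemma tconv_lea:
  assumes "tconv F x l" "tconv F y m" "F \<noteq> bot" "eventually (\<lambda>e. lea (x e) (y e)) F"
  shows "lea l m"
  unfolding lea_def
proof (intro ballI allI)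
  fix i v assume i: "i \<in> I"
  show "sf i l v v \<le> sf i m v v"
    by (rule tendsto_complex_mono[OF tconvD[OF assms(1) i] tconvD[OF assms(2) i] assms(3)])
      (use assms(4) i in \<open>auto simp: lea_def elim!: eventually_mono\<close>)
qed

abbreviation SA :: "'a gorder" where "SA \<equiv> self_adjoint_order A"

text \<open>A complex sesquilinear form is Hermitian as soon as its diagonal values are
  real.\<close>

lemma SA_carrier_iff:
  "x \<in> carrier SA \<longleftrightarrow> x \<in> carrier A \<and> (\<forall>i\<in>I. \<forall>v. Im (sf i x v v) = 0)"
proof
  assume "x \<in> carrier SA"
  then have x: "x \<in> carrier A" "star A x = x" by (auto simp: self_adjoint_order_def)
  have "Im (sf i x v v) = 0" if "i \<in> I" for i v
    using sf_star[OF x(1) that, of v v] x(2) by (simp add: complex_eq_iff)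
  then show "x \<in> carrier A \<and> (\<forall>i\<in>I. \<forall>v. Im (sf i x v v) = 0)" using x by blast
next
  assume x: "x \<in> carrier A \<and> (\<forall>i\<in>I. \<forall>v. Im (sf i x v v) = 0)"
  then have "star A x = x" by (intro sf_eqI) (auto simp: sf_star complex_eq_iff)
  then show "x \<in> carrier SA" using x by (simp add: self_adjoint_order_def)
qed

lemma SA_carrier: "x \<in> carrier SA \<Longrightarrow> x \<in> carrier A"
  by (simp add: SA_carrier_iff)

lemma SA_le: "x \<in> carrier SA \<Longrightarrow> y \<in> carrier SA \<Longrightarrow> x \<sqsubseteq>\<^bsub>SA\<^esub> y \<longleftrightarrow> lea x y"
  using positive_minus_iff[of x y] SA_carrier[of x] SA_carrier[of y] by (simp add: self_adjoint_order_def)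

abbreviation SA_filter :: "'a set \<Rightarrow> 'a filter" where "SA_filter \<equiv> net_filter (le SA)"

lemma SA_directed_dnet: "directed SA D \<Longrightarrow> dnet (le SA) D"
  by (rule directed_dnet) (auto simp: SA_le lea_refl intro: lea_trans)

lemma tconv_SA:
  assumes "tconv F x l" "F \<noteq> bot" "eventually (\<lambda>e. x e \<in> carrier SA) F" "l \<in> carrier A"
  shows "l \<in> carrier SA"
  unfolding SA_carrier_iff
proof (intro conjI ballI allI assms(4))
  fix i v assume i: "i \<in> I"
  have "((\<lambda>e. Im (sf i (x e) v v)) \<longlongrightarrow> 0) F"
    by (rule tendsto_eventually) (use assms(3) i in \<open>auto simp: SA_carrier_iff elim!: eventually_mono\<close>)
  then show "Im (sf i l v v) = 0"
    by (rule tendsto_unique[OF assms(2) tendsto_Im[OF tconvD[OF assms(1) i]]])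
qed

lemma monotone_net_upper:
  assumes D: "dnet R D" and mono: "\<And>x y. x \<in> D \<Longrightarrow> y \<in> D \<Longrightarrow> R x y \<Longrightarrow> lea (\<phi> x) (\<phi> y)"
    and "tconv (net_filter R D) \<phi> s" "x \<in> D"
  shows "lea (\<phi> x) s"
  by (rule tconv_lea[OF tconv_const assms(3) net_filter_neq_bot[OF D]])
    (use eventually_net_filter_ge[OF D assms(4)] mono assms(4) in \<open>auto elim!: eventually_mono\<close>)

text \<open>Inequalities between forms are closed, so every upper bound of the net also bounds its
  limit.\<close>

lemma SA_is_lub_of_tconv:
  assumes D: "dnet R D" and \<phi>: "\<And>x. x \<in> D \<Longrightarrow> \<phi> x \<in> carrier SA"
    and mono: "\<And>x y. x \<in> D \<Longrightarrow> y \<in> D \<Longrightarrow> R x y \<Longrightarrow> lea (\<phi> x) (\<phi> y)"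
    and s: "s \<in> carrier A" and lim: "tconv (net_filter R D) \<phi> s"
  shows "is_lub SA s (\<phi> ` D)"
proof (rule is_lubI)
  note nb = net_filter_neq_bot[OF D]
  show "\<phi> ` D \<subseteq> carrier SA" using \<phi> by blast
  show sS: "s \<in> carrier SA"
    by (rule tconv_SA[OF lim nb _ s]) (use eventually_in_net[OF D] \<phi> in \<open>auto elim!: eventually_mono\<close>)
  show "x \<sqsubseteq>\<^bsub>SA\<^esub> s" if "x \<in> \<phi> ` D" for x
    using that monotone_net_upper[OF D mono lim] \<phi> sS by (auto simp: SA_le)
  fix u assume u: "u \<in> carrier SA" "\<And>x. x \<in> \<phi> ` D \<Longrightarrow> x \<sqsubseteq>\<^bsub>SA\<^esub> u"
  then have "lea (\<phi> x) u" if "x \<in> D" for x using that \<phi> by (simp add: SA_le[symmetric])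
  then have "lea s u"
    using eventually_in_net[OF D] by (intro tconv_lea[OF lim tconv_const nb]) (auto elim!: eventually_mono)
  then show "s \<sqsubseteq>\<^bsub>SA\<^esub> u" using sS u by (simp add: SA_le)
qed

text \<open>Each diagonal value is a bounded monotone real net. For the limit to be an element,
  these nets also need a bound that is uniform over the blocks.\<close>

lemma bounded_monotone_net_tconv:
  assumes D: "dnet R D" and \<phi>: "\<And>x. x \<in> D \<Longrightarrow> \<phi> x \<in> carrier SA"
    and mono: "\<And>x y. x \<in> D \<Longrightarrow> y \<in> D \<Longrightarrow> R x y \<Longrightarrow> lea (\<phi> x) (\<phi> y)"
    and u: "u \<in> carrier SA" "\<And>x. x \<in> D \<Longrightarrow> lea (\<phi> x) u"
  shows "\<exists>l\<in>carrier A. tconv (net_filter R D) \<phi> l"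
proof -
  \<comment> \<open>A bound from some stage on is enough: beyond \<open>d0\<close> the values lie
    between those of \<open>d0\<close> and of \<open>u\<close>, both uniformly bounded.\<close>
  obtain d0 where d0: "d0 \<in> D" using dnet_nonempty[OF D] by blast
  obtain C1 where C1: "\<And>i v. i \<in> I \<Longrightarrow> cmod (sf i (\<phi> d0) v v) \<le> C1 * sqsum {..<d i} v"
    using co_bounded[OF SA_carrier[OF \<phi>[OF d0]]] unfolding sf_def by blast
  obtain C2 where C2: "\<And>i v. i \<in> I \<Longrightarrow> cmod (sf i u v v) \<le> C2 * sqsum {..<d i} v"
    using co_bounded[OF SA_carrier[OF u(1)]] unfolding sf_def by blast
  have Im0: "Im (sf i (\<phi> x) v v) = 0" if "x \<in> D" "i \<in> I" for x i v
    using \<phi>[OF that(1)] that(2) by (simp add: SA_carrier_iff)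
  have Re_mono: "Re (sf i x v v) \<le> Re (sf i y v v)" if "lea x y" "i \<in> I" for x y i v
    using that by (auto simp: lea_def less_eq_complex_def)
  have "\<exists>z. ((\<lambda>e. sf i (\<phi> e) v v) \<longlongrightarrow> z) (net_filter R D)" if i: "i \<in> I" for i v
  proof -
    obtain z where "((\<lambda>x. Re (sf i (\<phi> x) v v)) \<longlongrightarrow> z) (net_filter R D)"
      by (rule bounded_monotone_net_converges[OF D, of "\<lambda>x. Re (sf i (\<phi> x) v v)" "Re (sf i u v v)"])
        (use mono u(2) Re_mono i in auto)
    then have "((\<lambda>x. complex_of_real (Re (sf i (\<phi> x) v v))) \<longlongrightarrow> of_real z) (net_filter R D)"
      by (rule tendsto_of_real)
    moreover have "eventually (\<lambda>x. complex_of_real (Re (sf i (\<phi> x) v v)) = sf i (\<phi> x) v v) (net_filter R D)"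
      using eventually_in_net[OF D] by (rule eventually_mono) (simp add: complex_eq_iff Im0 i)
    ultimately show ?thesis by (blast intro: Lim_transform_eventually)
  qed
  moreover have "eventually (\<lambda>e. cmod (sf i (\<phi> e) v v) \<le> (C1 + C2) * sqsum {..<d i} v) (net_filter R D)"
    if i: "i \<in> I" for i v
    using eventually_net_filter_ge[OF D d0]
  proof (rule eventually_mono)
    fix e assume e: "e \<in> D \<and> R d0 e"
    have "cmod (sf i (\<phi> e) v v) = \<bar>Re (sf i (\<phi> e) v v)\<bar>"
      using Im0 e i by (simp add: cmod_eq_Re)
    also have "\<dots> \<le> \<bar>Re (sf i (\<phi> d0) v v)\<bar> + \<bar>Re (sf i u v v)\<bar>"
      using Re_mono[OF mono[OF d0, of e] i, of v] Re_mono[OF u(2)[of e] i, of v] e by linarith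
    also have "\<dots> \<le> cmod (sf i (\<phi> d0) v v) + cmod (sf i u v v)"
      by (intro add_mono abs_Re_le_cmod)
    also have "\<dots> \<le> (C1 + C2) * sqsum {..<d i} v"
      using C1[OF i, of v] C2[OF i, of v] by (simp add: algebra_simps)
    finally show "cmod (sf i (\<phi> e) v v) \<le> (C1 + C2) * sqsum {..<d i} v" .
  qed
  ultimately show ?thesis
    using tconv_exists[OF net_filter_neq_bot[OF D], of \<phi> "C1 + C2"] by blast
qed

text \<open>The supremum bounds the net, so a limit exists; the limit is a supremum too, and the
  order is antisymmetric.\<close>

lemma tconv_of_SA_is_lub:
  assumes D: "dnet R D" and \<phi>: "\<And>x. x \<in> D \<Longrightarrow> \<phi> x \<in> carrier SA"
    and mono: "\<And>x y. x \<in> D \<Longrightarrow> y \<in> D \<Longrightarrow> R x y \<Longrightarrow> lea (\<phi> x) (\<phi> y)"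
    and lub: "is_lub SA s (\<phi> ` D)"
  shows "tconv (net_filter R D) \<phi> s"
proof -
  have sub: "\<phi> ` D \<subseteq> carrier SA" using \<phi> by blast
  note s = is_lubD[OF lub sub]
  have le_s: "lea (\<phi> x) s" if "x \<in> D" for x using s(1,2) \<phi> that by (simp add: SA_le[symmetric])
  have "\<exists>l\<in>carrier A. tconv (net_filter R D) \<phi> l"
    by (rule bounded_monotone_net_tconv[OF D \<phi> mono s(1) le_s])
  then obtain l where l: "l \<in> carrier A" "tconv (net_filter R D) \<phi> l" by blast
  have "is_lub SA l (\<phi> ` D)" by (rule SA_is_lub_of_tconv[OF D \<phi> mono l])
  note l' = is_lubD[OF this sub]
  have "lea s l" "lea l s"
    using s(3)[OF l'(1,2)] l'(3)[OF s(1,2)] s(1) l'(1) by (auto simp: SA_le)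
  then have "s = l" using l(1) SA_carrier[OF s(1)] by (intro lea_antisym)
  then show ?thesis using l by simp
qed

end

context coords
begin

section \<open>Positive block matrices and the span of the positive elements\<close>

definition blocks :: "nat \<Rightarrow> (nat \<Rightarrow> nat \<Rightarrow> 'a) \<Rightarrow> bool" where
  "blocks n X \<longleftrightarrow> (\<forall>k<n. \<forall>l<n. X k l \<in> carrier A) \<and> (\<forall>i\<in>I. \<forall>v. 0 \<le> bform i n X v)"

lemma bform_cong:
  "(\<And>k l. k < n \<Longrightarrow> l < n \<Longrightarrow> X k l = Y k l) \<Longrightarrow> bform i n X v = bform i n Y v"
  by (simp add: bform_def)

lemma bform_single: "bform i 1 (\<lambda>_ _. x) v = sf i x (v 0) (v 0)"
  by (simp add: bform_def lessThan_Suc)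

lemma bform_tendsto:
  assumes "\<And>k l. k < n \<Longrightarrow> l < n \<Longrightarrow> tconv F (\<lambda>e. X e k l) (Y k l)" "i \<in> I"
  shows "((\<lambda>e. bform i n (X e) v) \<longlongrightarrow> bform i n Y v) F"
  unfolding bform_def by (intro tendsto_sum tconvD assms) auto

lemma bform_add:
  assumes "\<And>k l. k < n \<Longrightarrow> l < n \<Longrightarrow> X k l \<in> carrier A" "\<And>k l. k < n \<Longrightarrow> l < n \<Longrightarrow> Y k l \<in> carrier A" "i \<in> I"
  shows "bform i n (\<lambda>k l. X k l \<oplus> Y k l) v = bform i n X v + bform i n Y v"
  unfolding bform_def sum.distrib[symmetric] using assms by (intro sum.cong refl) (simp add: sf_add)

lemma bform_minus:
  assumes "\<And>k l. k < n \<Longrightarrow> l < n \<Longrightarrow> X k l \<in> carrier A" "\<And>k l. k < n \<Longrightarrow> l < n \<Longrightarrow> Y k l \<in> carrier A" "i \<in> I"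
  shows "bform i n (\<lambda>k l. X k l \<ominus> Y k l) v = bform i n X v - bform i n Y v"
  unfolding bform_def sum_subtractf[symmetric] using assms by (intro sum.cong refl) (simp add: sf_minus)

lemma bform_smult:
  assumes "\<And>k l. k < n \<Longrightarrow> l < n \<Longrightarrow> X k l \<in> carrier A" "i \<in> I"
  shows "bform i n (\<lambda>k l. c \<odot> X k l) v = c * bform i n X v"
  unfolding bform_def sum_distrib_left using assms by (intro sum.cong refl) (simp add: sf_smult)

lemma bform_zero: "i \<in> I \<Longrightarrow> bform i n (\<lambda>_ _. \<zero>) v = 0"
  by (simp add: bform_def sf_zero)

lemma blocks_iff_positive:
  "X \<in> carrier (matrix_algebra A n) \<Longrightarrow> positive (matrix_algebra A n) X \<longleftrightarrow> blocks n (\<lambda>k l. X $$ (k, l))"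
  by (simp add: positive_matrix_iff block_nonneg_def blocks_def in_matrix_algebra_iff)

lemma lea_zero_iff: "lea \<zero> x \<longleftrightarrow> (\<forall>i\<in>I. \<forall>v. 0 \<le> sf i x v v)"
  by (simp add: lea_def sf_zero)

lemma blocks_single: "x \<in> carrier A \<Longrightarrow> lea \<zero> x \<Longrightarrow> blocks 1 (\<lambda>_ _. x)"
  by (simp only: blocks_def bform_single lea_zero_iff) simp

lemma lea_zero_minus: "x \<in> carrier A \<Longrightarrow> y \<in> carrier A \<Longrightarrow> lea \<zero> (y \<ominus> x) \<longleftrightarrow> lea x y"
  unfolding lea_zero_iff by (simp add: lea_def sf_minus)

lemma lea_zero_SA: "x \<in> carrier A \<Longrightarrow> lea \<zero> x \<Longrightarrow> x \<in> carrier SA"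
  by (auto simp: lea_zero_iff SA_carrier_iff complex_nonneg_iff)

lemma one_closed' [simp, intro]: "\<one> \<in> carrier A"
  by (rule monoid.one_closed[OF ring.is_monoid[OF star_algebra.axioms(1)[OF star_algebra_axioms]]])

lemma zero_closed' [simp, intro]: "\<zero> \<in> carrier A"
  by (rule abelian_monoid.zero_closed[OF abelian_group.axioms(1)[OF abelian_group_A]])

lemma add_closed' [simp, intro]: "x \<in> carrier A \<Longrightarrow> y \<in> carrier A \<Longrightarrow> x \<oplus> y \<in> carrier A"
  by (rule abelian_monoid.a_closed[OF abelian_group.axioms(1)[OF abelian_group_A]])

lemma zero_lea_one: "lea \<zero> \<one>"
  by (simp add: lea_zero_iff sf_one complex_nonneg_iff sqsum_nonneg)

text \<open>The numerical bound is uniform over the blocks, so one multiple of the unit works for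
  all; \<open>C\<close> is kept nonnegative to make that multiple positive.\<close>

lemma order_unit:
  assumes "x \<in> carrier SA"
  obtains C where "0 \<le> C" "lea x (complex_of_real C \<odot> \<one>)"
proof -
  obtain C where C: "\<And>i v. i \<in> I \<Longrightarrow> cmod (sf i x v v) \<le> C * sqsum {..<d i} v"
    using co_bounded[OF SA_carrier[OF assms]] unfolding sf_def by blast
  have "lea x (complex_of_real (max C 0) \<odot> \<one>)"
    unfolding lea_def
  proof (intro ballI allI)
    fix i v assume i: "i \<in> I"
    have "Re (sf i x v v) \<le> C * sqsum {..<d i} v"
      by (rule order_trans[OF complex_Re_le_cmod C[OF i]])
    also have "\<dots> \<le> max C 0 * sqsum {..<d i} v" by (intro mult_right_mono sqsum_nonneg) simp
    finally show "sf i x v v \<le> sf i (complex_of_real (max C 0) \<odot> \<one>) v v"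
      using assms i by (simp add: sf_smult sf_one SA_carrier_iff less_eq_complex_def)
  qed
  then show ?thesis by (intro that[of "max C 0"]) simp_all
qed

text \<open>A self-adjoint \<open>h\<close> below a multiple \<open>u\<close> of the unit is the
  difference of the positive elements \<open>u\<close> and \<open>u - h\<close>, and every element
  is \<open>h + \<i> k\<close> with \<open>h\<close> and \<open>k\<close> self-adjoint. Monotonicity
  arguments are available for positive elements only; this carries their linear consequences to all
  elements.\<close>

lemma positive_span_induct [consumes 1, case_names positive add smult]:
  assumes x: "x \<in> carrier A"
    and pos: "\<And>p. p \<in> carrier A \<Longrightarrow> lea \<zero> p \<Longrightarrow> P p"
    and add: "\<And>x y. x \<in> carrier A \<Longrightarrow> y \<in> carrier A \<Longrightarrow> P x \<Longrightarrow> P y \<Longrightarrow> P (x \<oplus> y)"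
    and smult: "\<And>c x. x \<in> carrier A \<Longrightarrow> P x \<Longrightarrow> P (c \<odot> x)"
  shows "P x"
proof -
  have sa: "P h" if h: "h \<in> carrier SA" for h
  proof -
    obtain C where C: "0 \<le> C" "lea h (complex_of_real C \<odot> \<one>)" using order_unit[OF h] .
    let ?u = "complex_of_real C \<odot> \<one>"
    have hc: "h \<in> carrier A" using SA_carrier[OF h] .
    have "lea \<zero> ?u" using C(1) by (simp add: lea_zero_iff sf_smult sf_one complex_nonneg_iff sqsum_nonneg)
    then have "P ?u" by (intro pos) simp_all
    moreover have "P (?u \<ominus> h)" using hc C(2) by (intro pos) (simp_all add: lea_zero_minus)
    ultimately have "P (?u \<oplus> (-1) \<odot> (?u \<ominus> h))" using hc by (intro add smult[of "?u \<ominus> h"]) simp_all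
    moreover have "?u \<oplus> (-1) \<odot> (?u \<ominus> h) = h"
      using hc by (intro sf_eqI) (simp_all add: sf_add sf_smult sf_minus)
    ultimately show ?thesis by simp
  qed
  let ?h = "(1/2) \<odot> (x \<oplus> star A x)" and ?k = "(- \<i> / 2) \<odot> (x \<ominus> star A x)"
  have "?h \<in> carrier SA" "?k \<in> carrier SA"
    using x by (simp_all add: SA_carrier_iff sf_add sf_smult sf_minus sf_star)
  then have "P (?h \<oplus> \<i> \<odot> ?k)" using x by (intro add smult sa) (simp_all add: SA_carrier)
  moreover have "?h \<oplus> \<i> \<odot> ?k = x"
    using x by (intro sf_eqI) (simp_all add: sf_add sf_smult sf_minus sf_star field_simps)
  ultimately show ?thesis by simp
qed

end


section \<open>Normal completely positive maps in coordinates\<close>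

text \<open>\<open>S\<close> is the source and \<open>T\<close> the target of the maps, so the
  homset of the opposite category is \<open>Q_hom T S\<close>.\<close>

locale coords2 = S: coords S J e cs + T: coords T I d ct
  for S :: "'s star_algebra" and J :: "'j set" and e cs
    and T :: "'t star_algebra" and I :: "'i set" and d ct
begin

abbreviation lin :: "('s \<Rightarrow> 't) \<Rightarrow> bool" where
  "lin f \<equiv> f \<in> LinearCombinations.module_hom class_ring S T"

lemma lin_closed: "lin f \<Longrightarrow> x \<in> carrier S \<Longrightarrow> f x \<in> carrier T"
  by (auto simp: LinearCombinations.module_hom_def)

lemma lin_add: "lin f \<Longrightarrow> x \<in> carrier S \<Longrightarrow> y \<in> carrier S \<Longrightarrow> f (x \<oplus>\<^bsub>S\<^esub> y) = f x \<oplus>\<^bsub>T\<^esub> f y"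
  by (auto simp: LinearCombinations.module_hom_def)

lemma lin_smult: "lin f \<Longrightarrow> x \<in> carrier S \<Longrightarrow> f (c \<odot>\<^bsub>S\<^esub> x) = c \<odot>\<^bsub>T\<^esub> f x"
  by (auto simp: LinearCombinations.module_hom_def)

lemma linI:
  assumes "\<And>x. x \<in> carrier S \<Longrightarrow> f x \<in> carrier T"
    and "\<And>x y. x \<in> carrier S \<Longrightarrow> y \<in> carrier S \<Longrightarrow> f (x \<oplus>\<^bsub>S\<^esub> y) = f x \<oplus>\<^bsub>T\<^esub> f y"
    and "\<And>c x. x \<in> carrier S \<Longrightarrow> f (c \<odot>\<^bsub>S\<^esub> x) = c \<odot>\<^bsub>T\<^esub> f x"
  shows "lin f"
  using assms by (auto simp: LinearCombinations.module_hom_def)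

lemma lin_minus:
  assumes f: "lin f" and x: "x \<in> carrier S" and y: "y \<in> carrier S"
  shows "f (x \<ominus>\<^bsub>S\<^esub> y) = f x \<ominus>\<^bsub>T\<^esub> f y"
proof -
  have "x \<ominus>\<^bsub>S\<^esub> y = x \<oplus>\<^bsub>S\<^esub> (-1) \<odot>\<^bsub>S\<^esub> y"
    using x y by (intro S.sf_eqI) (simp_all add: S.sf_add S.sf_smult S.sf_minus)
  then have "f (x \<ominus>\<^bsub>S\<^esub> y) = f x \<oplus>\<^bsub>T\<^esub> (-1) \<odot>\<^bsub>T\<^esub> f y"
    using f x y by (simp add: lin_add lin_smult)
  also have "\<dots> = f x \<ominus>\<^bsub>T\<^esub> f y"
    using lin_closed[OF f x] lin_closed[OF f y]
    by (intro T.sf_eqI) (simp_all add: T.sf_add T.sf_smult T.sf_minus)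
  finally show ?thesis .
qed

lemma lin_zero: "lin f \<Longrightarrow> f \<zero>\<^bsub>S\<^esub> = \<zero>\<^bsub>T\<^esub>"
proof -
  assume f: "lin f"
  have "\<zero>\<^bsub>S\<^esub> = 0 \<odot>\<^bsub>S\<^esub> \<one>\<^bsub>S\<^esub>" by (intro S.sf_eqI) (simp_all add: S.sf_zero S.sf_smult)
  then have "f \<zero>\<^bsub>S\<^esub> = 0 \<odot>\<^bsub>T\<^esub> f \<one>\<^bsub>S\<^esub>" using f by (simp add: lin_smult)
  also have "\<dots> = \<zero>\<^bsub>T\<^esub>"
    using lin_closed[OF f, of "\<one>\<^bsub>S\<^esub>"] by (intro T.sf_eqI) (simp_all add: T.sf_zero T.sf_smult)
  finally show ?thesis .
qed

text \<open>Replaces matrices and their factorisations by index functions and the sign of block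
  forms.\<close>

lemma cp_iff_blocks:
  assumes f: "\<And>x. x \<in> carrier S \<Longrightarrow> f x \<in> carrier T"
  shows "completely_positive S T f \<longleftrightarrow>
    (\<forall>n X. S.blocks n X \<longrightarrow> (\<forall>i\<in>I. \<forall>v. 0 \<le> T.bform i n (\<lambda>k l. f (X k l)) v))"
    (is "_ \<longleftrightarrow> ?rhs")
proof
  assume cp: "completely_positive S T f"
  show ?rhs
  proof (intro allI impI ballI)
    fix n X i v assume X: "S.blocks n X" and i: "i \<in> I"
    let ?X = "mat n n (\<lambda>(k, l). X k l)"
    have X1: "?X \<in> carrier (matrix_algebra S n)"
      using X by (simp add: S.in_matrix_algebra_iff S.blocks_def)
    have "S.blocks n (\<lambda>k l. ?X $$ (k, l))"
      using X S.bform_cong[of n X "\<lambda>k l. ?X $$ (k, l)"] by (simp add: S.blocks_def)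
    then have "positive (matrix_algebra T n) (map_mat f ?X)"
      using cp X1 by (auto simp: completely_positive_def S.blocks_iff_positive)
    moreover have "map_mat f ?X \<in> carrier (matrix_algebra T n)"
      using X f by (simp add: T.in_matrix_algebra_iff S.blocks_def)
    ultimately have "0 \<le> T.bform i n (\<lambda>k l. map_mat f ?X $$ (k, l)) v"
      using i by (auto simp: T.blocks_iff_positive T.blocks_def)
    also have "\<dots> = T.bform i n (\<lambda>k l. f (X k l)) v" by (rule T.bform_cong) simp
    finally show "0 \<le> T.bform i n (\<lambda>k l. f (X k l)) v" .
  qed
next
  assume rhs: ?rhs
  show "completely_positive S T f"
    unfolding completely_positive_def
  proof (intro allI ballI impI)
    fix n X assume X: "X \<in> carrier (matrix_algebra S n)" "positive (matrix_algebra S n) X"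
    then have "S.blocks n (\<lambda>k l. X $$ (k, l))" by (simp add: S.blocks_iff_positive)
    with rhs have *: "\<forall>i\<in>I. \<forall>v. 0 \<le> T.bform i n (\<lambda>k l. f (X $$ (k, l))) v" by blast
    have X': "X \<in> carrier_mat n n" "\<forall>k<n. \<forall>l<n. X $$ (k, l) \<in> carrier S"
      using X(1) by (auto simp: S.in_matrix_algebra_iff)
    then have "map_mat f X \<in> carrier (matrix_algebra T n)"
      using f by (auto simp: T.in_matrix_algebra_iff)
    moreover have "T.bform i n (\<lambda>k l. map_mat f X $$ (k, l)) v = T.bform i n (\<lambda>k l. f (X $$ (k, l))) v" for i v
      using X'(1) by (intro T.bform_cong) simp
    ultimately show "positive (matrix_algebra T n) (map_mat f X)"
      using * by (simp add: T.blocks_iff_positive T.blocks_def T.in_matrix_algebra_iff)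
  qed
qed

section \<open>The order on maps and normality along nets\<close>

definition dle :: "('s \<Rightarrow> 't) \<Rightarrow> ('s \<Rightarrow> 't) \<Rightarrow> bool" where
  "dle f g \<longleftrightarrow> (\<forall>n X. S.blocks n X \<longrightarrow>
     (\<forall>i\<in>I. \<forall>v. T.bform i n (\<lambda>k l. f (X k l)) v \<le> T.bform i n (\<lambda>k l. g (X k l)) v))"

text \<open>Complete positivity is the relation of lying above the zero map, so one set of order
  lemmas serves both notions.\<close>

abbreviation cpos :: "('s \<Rightarrow> 't) \<Rightarrow> bool" where "cpos \<equiv> dle (\<lambda>_. \<zero>\<^bsub>T\<^esub>)"

lemma dleD: "dle f g \<Longrightarrow> S.blocks n X \<Longrightarrow> i \<in> I \<Longrightarrow>
    T.bform i n (\<lambda>k l. f (X k l)) v \<le> T.bform i n (\<lambda>k l. g (X k l)) v"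
  by (simp add: dle_def)

lemma cp_minus_iff:
  assumes f: "\<And>x. x \<in> carrier S \<Longrightarrow> f x \<in> carrier T" and g: "\<And>x. x \<in> carrier S \<Longrightarrow> g x \<in> carrier T"
  shows "completely_positive S T (\<lambda>x. g x \<ominus>\<^bsub>T\<^esub> f x) \<longleftrightarrow> dle f g"
proof -
  have "T.bform i n (\<lambda>k l. g (X k l) \<ominus>\<^bsub>T\<^esub> f (X k l)) v =
      T.bform i n (\<lambda>k l. g (X k l)) v - T.bform i n (\<lambda>k l. f (X k l)) v"
    if "S.blocks n X" "i \<in> I" for i n X v
    using that f g by (intro T.bform_minus) (auto simp: S.blocks_def)
  then show ?thesis
    by (subst cp_iff_blocks) (use f g in \<open>auto simp: dle_def\<close>)
qed

lemma cp_iff_dle: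
  assumes "\<And>x. x \<in> carrier S \<Longrightarrow> f x \<in> carrier T"
  shows "completely_positive S T f \<longleftrightarrow> cpos f"
  by (subst cp_iff_blocks) (use assms in \<open>auto simp: dle_def T.bform_zero\<close>)

lemma dle_refl: "dle f f" by (simp add: dle_def)

lemma dle_trans: "dle f g \<Longrightarrow> dle g h \<Longrightarrow> dle f h"
  unfolding dle_def by (meson order_trans)

lemma dle_cong:
  assumes "dle f g" "\<And>x. x \<in> carrier S \<Longrightarrow> f x = f' x" "\<And>x. x \<in> carrier S \<Longrightarrow> g x = g' x"
  shows "dle f' g'"
  unfolding dle_def
proof (intro allI impI ballI)
  fix n X i v assume X: "S.blocks n X" "i \<in> I"
  have "T.bform i n (\<lambda>k l. f' (X k l)) v = T.bform i n (\<lambda>k l. f (X k l)) v"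
    "T.bform i n (\<lambda>k l. g' (X k l)) v = T.bform i n (\<lambda>k l. g (X k l)) v"
    using X assms(2,3) by (auto simp: S.blocks_def intro!: T.bform_cong)
  then show "T.bform i n (\<lambda>k l. f' (X k l)) v \<le> T.bform i n (\<lambda>k l. g' (X k l)) v"
    using dleD[OF assms(1) X] by simp
qed

lemma dle_positive:
  assumes "dle f g" "p \<in> carrier S" "S.lea \<zero>\<^bsub>S\<^esub> p"
  shows "T.lea (f p) (g p)"
  unfolding T.lea_def
proof (intro ballI allI)
  fix i v assume "i \<in> I"
  then show "T.sf i (f p) v v \<le> T.sf i (g p) v v"
    using dleD[OF assms(1) S.blocks_single[OF assms(2,3)], of i "\<lambda>_. v"] unfolding T.bform_single by simp
qed

lemma dle_zero_mono:
  assumes "cpos f" "lin f" "x \<in> carrier S" "y \<in> carrier S" "S.lea x y"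
  shows "T.lea (f x) (f y)"
proof -
  have "T.lea \<zero>\<^bsub>T\<^esub> (f (y \<ominus>\<^bsub>S\<^esub> x))"
    using assms by (intro dle_positive[OF assms(1)]) (simp_all add: S.lea_zero_minus)
  then show ?thesis using assms by (simp add: lin_minus T.lea_zero_minus lin_closed)
qed

text \<open>\<open>f x\<close> lies below a real multiple of the positive element
  \<open>f \<one>\<close>, and a complex number below a real one is real.\<close>

lemma dle_zero_SA:
  assumes f: "cpos f" "lin f" and x: "x \<in> carrier S.SA"
  shows "f x \<in> carrier T.SA"
proof -
  obtain C where C: "0 \<le> C" "S.lea x (complex_of_real C \<odot>\<^bsub>S\<^esub> \<one>\<^bsub>S\<^esub>)" using S.order_unit[OF x] .
  let ?u = "complex_of_real C \<odot>\<^bsub>S\<^esub> \<one>\<^bsub>S\<^esub>"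
  have xc: "x \<in> carrier S" using S.SA_carrier[OF x] .
  have 1: "T.lea (f x) (f ?u)" by (rule dle_zero_mono[OF f xc _ C(2)]) simp
  have "T.lea \<zero>\<^bsub>T\<^esub> (f \<one>\<^bsub>S\<^esub>)" by (rule dle_positive[OF f(1) _ S.zero_lea_one]) simp
  then have "f \<one>\<^bsub>S\<^esub> \<in> carrier T.SA" by (rule T.lea_zero_SA[OF lin_closed[OF f(2)], rotated]) simp
  then have "Im (T.sf i (f ?u) v v) = 0" if "i \<in> I" for i v
    using that f(2) by (simp add: lin_smult lin_closed T.sf_smult T.SA_carrier_iff)
  then show ?thesis
    using 1 lin_closed[OF f(2) xc] by (auto simp: T.SA_carrier_iff T.lea_def less_eq_complex_def)
qed

lemma subunital_iff: "f \<one>\<^bsub>S\<^esub> \<in> carrier T \<Longrightarrow> subunital S T f \<longleftrightarrow> T.lea (f \<one>\<^bsub>S\<^esub>) \<one>\<^bsub>T\<^esub>"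
  unfolding subunital_def by (rule T.positive_minus_iff) simp_all

lemma ncpsuD:
  assumes "f \<in> ncpsu S T"
  shows "lin f" "normal_map S T f" "cpos f" "T.lea (f \<one>\<^bsub>S\<^esub>) \<one>\<^bsub>T\<^esub>"
    "f \<in> carrier S \<rightarrow>\<^sub>E carrier T"
proof -
  show l: "lin f" and "normal_map S T f" and "f \<in> carrier S \<rightarrow>\<^sub>E carrier T"
    using assms by (auto simp: ncpsu_def)
  show "cpos f" "T.lea (f \<one>\<^bsub>S\<^esub>) \<one>\<^bsub>T\<^esub>"
    using assms lin_closed[OF l] by (auto simp: ncpsu_def cp_iff_dle subunital_iff)
qed

lemma ncpsuI:
  assumes "f \<in> extensional (carrier S)" "lin f" "cpos f" "normal_map S T f"
    "T.lea (f \<one>\<^bsub>S\<^esub>) \<one>\<^bsub>T\<^esub>"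
  shows "f \<in> ncpsu S T"
  using assms lin_closed[OF assms(2)] unfolding ncpsu_def
  by (auto simp: cp_iff_dle subunital_iff PiE_def)

lemma ncpsu_eqI:
  assumes "f \<in> ncpsu S T" "g \<in> ncpsu S T" "\<And>x. x \<in> carrier S \<Longrightarrow> f x = g x"
  shows "f = g"
  using ncpsuD(5)[OF assms(1)] ncpsuD(5)[OF assms(2)] assms(3) by (intro PiE_ext)

text \<open>Normality speaks of directed sets. The image of a monotone net is such a set, with the
  limit as supremum, whatever order indexes the net.\<close>

lemma normal_net:
  assumes f: "lin f" "cpos f" "normal_map S T f"
    and D: "dnet R D" and \<phi>: "\<And>x. x \<in> D \<Longrightarrow> \<phi> x \<in> carrier S.SA"
    and mono: "\<And>x y. x \<in> D \<Longrightarrow> y \<in> D \<Longrightarrow> R x y \<Longrightarrow> S.lea (\<phi> x) (\<phi> y)"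
    and s: "s \<in> carrier S" and lim: "S.tconv (net_filter R D) \<phi> s"
  shows "T.tconv (net_filter R D) (\<lambda>x. f (\<phi> x)) (f s)"
proof (rule T.tconv_of_SA_is_lub[OF D])
  show "f (\<phi> x) \<in> carrier T.SA" if "x \<in> D" for x by (rule dle_zero_SA[OF f(2,1) \<phi>[OF that]])
  show "T.lea (f (\<phi> x)) (f (\<phi> y))" if "x \<in> D" "y \<in> D" "R x y" for x y
    by (rule dle_zero_mono[OF f(2,1)]) (use that \<phi> mono S.SA_carrier in auto)
  have "is_lub S.SA s (\<phi> ` D)" by (rule S.SA_is_lub_of_tconv[OF D \<phi> mono s lim])
  moreover have "directed S.SA (\<phi> ` D)"
    unfolding directed_def
  proof (intro conjI ballI)
    show "\<phi> ` D \<noteq> {}" using dnet_nonempty[OF D] by simp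
    show "\<phi> ` D \<subseteq> carrier S.SA" using \<phi> by blast
    fix x y assume "x \<in> \<phi> ` D" "y \<in> \<phi> ` D"
    then obtain a b where ab: "a \<in> D" "b \<in> D" "x = \<phi> a" "y = \<phi> b" by blast
    obtain c where "c \<in> D" "R a c" "R b c" using dnet_directed[OF D ab(1,2)] .
    then show "\<exists>z\<in>\<phi> ` D. x \<sqsubseteq>\<^bsub>S.SA\<^esub> z \<and> y \<sqsubseteq>\<^bsub>S.SA\<^esub> z"
      using ab \<phi> mono by (intro bexI[of _ "\<phi> c"]) (auto simp: S.SA_le)
  qed
  ultimately have "is_lub T.SA (f s) (f ` \<phi> ` D)"
    using f(3) unfolding normal_map_def scott_continuous_def by blast
  then show "is_lub T.SA (f s) ((\<lambda>x. f (\<phi> x)) ` D)" by (simp add: image_image)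
qed

text \<open>Conversely a directed set is a net indexed by itself, so it is enough to test
  these.\<close>

lemma normal_mapI:
  assumes f: "lin f" "cpos f"
    and lim: "\<And>D s. dnet (le S.SA) D \<Longrightarrow> D \<subseteq> carrier S.SA \<Longrightarrow> s \<in> carrier S.SA \<Longrightarrow>
      S.tconv (S.SA_filter D) (\<lambda>x. x) s \<Longrightarrow> T.tconv (S.SA_filter D) f (f s)"
  shows "normal_map S T f"
  unfolding normal_map_def scott_continuous_def
proof (intro conjI allI impI)
  show "f \<in> carrier S.SA \<rightarrow> carrier T.SA" using dle_zero_SA[OF f(2,1)] by blast
  fix D s assume "directed S.SA D \<and> is_lub S.SA s D"
  then have D: "dnet (le S.SA) D" and sub: "D \<subseteq> carrier S.SA" and lub: "is_lub S.SA s D"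
    by (auto simp: directed_def S.SA_directed_dnet)
  have s: "s \<in> carrier S.SA" by (rule is_lubD(1)[OF lub sub])
  have mono: "S.lea x y" if "x \<in> D" "y \<in> D" "x \<sqsubseteq>\<^bsub>S.SA\<^esub> y" for x y
    using that sub S.SA_le[of x y] by blast
  have "S.tconv (S.SA_filter D) (\<lambda>x. x) s"
    by (rule S.tconv_of_SA_is_lub[OF D]) (use sub mono lub in auto)
  from lim[OF D sub s this] have "T.tconv (S.SA_filter D) f (f s)" .
  then show "is_lub T.SA (f s) (f ` D)"
    by (intro T.SA_is_lub_of_tconv[OF D])
      (use sub mono dle_zero_SA[OF f(2,1)] dle_zero_mono[OF f(2,1)] S.SA_carrier lin_closed[OF f(1)] s
        in \<open>auto simp: subset_iff\<close>)
qed

abbreviation QH :: "('s \<Rightarrow> 't) ordered_barycentric" where "QH \<equiv> Q_hom T S"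

lemma QH_carrier: "carrier QH = ncpsu S T" by (simp add: Q_hom_def)

lemma QH_le: "f \<in> ncpsu S T \<Longrightarrow> g \<in> ncpsu S T \<Longrightarrow> f \<sqsubseteq>\<^bsub>QH\<^esub> g \<longleftrightarrow> dle f g"
  using cp_minus_iff[of f g] lin_closed[OF ncpsuD(1)] by (simp add: Q_hom_def)

text \<open>Matrices of size one give equality on positive elements, and these span.\<close>

lemma dle_antisym:
  assumes "dle f g" "dle g f" "f \<in> ncpsu S T" "g \<in> ncpsu S T"
  shows "f = g"
proof (rule ncpsu_eqI[OF assms(3,4)])
  note fl = ncpsuD(1)[OF assms(3)] and gl = ncpsuD(1)[OF assms(4)]
  fix x assume "x \<in> carrier S"
  then show "f x = g x"
  proof (induction rule: S.positive_span_induct)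
    case (positive p)
    then show ?case
      using dle_positive[OF assms(1)] dle_positive[OF assms(2)] lin_closed[OF fl] lin_closed[OF gl]
      by (intro T.lea_antisym) auto
  next
    case (add x y)
    then show ?case using fl gl by (simp add: lin_add)
  next
    case (smult c x)
    then show ?case using fl gl by (simp add: lin_smult)
  qed
qed

lemma QH_partial_order: "partial_order QH"
proof -
  have eq: "eq QH = (=)" by (simp add: Q_hom_def)
  show ?thesis
    by unfold_locales
      (auto simp: eq QH_carrier QH_le dle_refl intro: dle_antisym dle_trans)
qed

lemma QH_directed_dnet: "directed QH D \<Longrightarrow> dnet (le QH) D"
  by (rule directed_dnet) (auto simp: QH_carrier QH_le dle_refl intro: dle_trans)

section \<open>Pointwise limits of monotone nets of maps\<close>

definition pconv :: "'x filter \<Rightarrow> ('x \<Rightarrow> 's \<Rightarrow> 't) \<Rightarrow> ('s \<Rightarrow> 't) \<Rightarrow> bool" where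
  "pconv F \<Phi> g \<longleftrightarrow> (\<forall>x\<in>carrier S. T.tconv F (\<lambda>a. \<Phi> a x) (g x))"

lemma pconv_dle:
  assumes "pconv F \<Phi> f" "pconv F \<Psi> g" "F \<noteq> bot" "eventually (\<lambda>a. dle (\<Phi> a) (\<Psi> a)) F"
  shows "dle f g"
  unfolding dle_def
proof (intro allI impI ballI)
  fix n X i v assume X: "S.blocks n X" and i: "i \<in> I"
  have X': "X k l \<in> carrier S" if "k < n" "l < n" for k l using X that by (simp add: S.blocks_def)
  show "T.bform i n (\<lambda>k l. f (X k l)) v \<le> T.bform i n (\<lambda>k l. g (X k l)) v"
  proof (rule tendsto_complex_mono)
    show "((\<lambda>a. T.bform i n (\<lambda>k l. \<Phi> a (X k l)) v) \<longlongrightarrow> T.bform i n (\<lambda>k l. f (X k l)) v) F"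
      using assms(1) X' i by (intro T.bform_tendsto) (auto simp: pconv_def)
    show "((\<lambda>a. T.bform i n (\<lambda>k l. \<Psi> a (X k l)) v) \<longlongrightarrow> T.bform i n (\<lambda>k l. g (X k l)) v) F"
      using assms(2) X' i by (intro T.bform_tendsto) (auto simp: pconv_def)
    show "eventually (\<lambda>a. T.bform i n (\<lambda>k l. \<Phi> a (X k l)) v \<le> T.bform i n (\<lambda>k l. \<Psi> a (X k l)) v) F"
      using assms(4) by (rule eventually_mono) (use X i in \<open>auto intro: dleD\<close>)
  qed fact
qed

lemma pconv_const: "pconv F (\<lambda>_. f) f"
  by (simp add: pconv_def T.tconv_const)

lemma monotone_maps_upper:
  assumes D: "dnet R D" and mono: "\<And>a b. a \<in> D \<Longrightarrow> b \<in> D \<Longrightarrow> R a b \<Longrightarrow> dle (\<Phi> a) (\<Phi> b)"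
    and "pconv (net_filter R D) \<Phi> g" "a \<in> D"
  shows "dle (\<Phi> a) g"
  by (rule pconv_dle[OF pconv_const assms(3) net_filter_neq_bot[OF D]])
    (use eventually_net_filter_ge[OF D assms(4)] mono assms(4) in \<open>auto elim!: eventually_mono\<close>)

lemma QH_is_lub_of_pconv:
  assumes D: "dnet R D" and \<Phi>: "\<And>a. a \<in> D \<Longrightarrow> \<Phi> a \<in> ncpsu S T"
    and mono: "\<And>a b. a \<in> D \<Longrightarrow> b \<in> D \<Longrightarrow> R a b \<Longrightarrow> dle (\<Phi> a) (\<Phi> b)"
    and g: "g \<in> ncpsu S T" and lim: "pconv (net_filter R D) \<Phi> g"
  shows "is_lub QH g (\<Phi> ` D)"
proof (rule is_lubI)
  show "\<Phi> ` D \<subseteq> carrier QH" using \<Phi> by (auto simp: QH_carrier)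
  show "g \<in> carrier QH" using g by (simp add: QH_carrier)
  show "f \<sqsubseteq>\<^bsub>QH\<^esub> g" if "f \<in> \<Phi> ` D" for f
    using that monotone_maps_upper[OF D mono lim] \<Phi> g by (auto simp: QH_le)
  fix u assume u: "u \<in> carrier QH" "\<And>f. f \<in> \<Phi> ` D \<Longrightarrow> f \<sqsubseteq>\<^bsub>QH\<^esub> u"
  then have "dle (\<Phi> a) u" if "a \<in> D" for a using that \<Phi> by (simp add: QH_le[symmetric] QH_carrier)
  then have "dle g u"
    using eventually_in_net[OF D]
    by (intro pconv_dle[OF lim pconv_const net_filter_neq_bot[OF D]]) (auto elim!: eventually_mono)
  then show "g \<sqsubseteq>\<^bsub>QH\<^esub> u" using g u by (simp add: QH_le QH_carrier)
qed

text \<open>The order on maps compares values at positive elements, but the members of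
  \<open>E\<close> need not be positive. The interchange of limits is therefore carried out on
  increments from a fixed member \<open>y0\<close>.\<close>

lemma normal_map_of_monotone_limit:
  assumes D: "dnet R D" and \<Phi>: "\<And>a. a \<in> D \<Longrightarrow> \<Phi> a \<in> ncpsu S T"
    and mono: "\<And>a b. a \<in> D \<Longrightarrow> b \<in> D \<Longrightarrow> R a b \<Longrightarrow> dle (\<Phi> a) (\<Phi> b)"
    and g: "lin g" "cpos g" and lim: "pconv (net_filter R D) \<Phi> g"
  shows "normal_map S T g"
proof (rule normal_mapI[OF g])
  fix E s
  assume E: "dnet (le S.SA) E" and sub: "E \<subseteq> carrier S.SA" and s: "s \<in> carrier S.SA"
    and Elim: "S.tconv (S.SA_filter E) (\<lambda>x. x) s"
  have sc: "s \<in> carrier S" using S.SA_carrier[OF s] .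
  have Ec: "y \<in> carrier S" if "y \<in> E" for y using sub that S.SA_carrier by blast
  have Emono: "S.lea x y" if "x \<in> E" "y \<in> E" "x \<sqsubseteq>\<^bsub>S.SA\<^esub> y" for x y
    using that sub S.SA_le[of x y] by blast
  have Es: "S.lea y s" if "y \<in> E" for y by (rule S.monotone_net_upper[OF E Emono Elim that])
  have gSA: "g x \<in> carrier T.SA" if "x \<in> carrier S.SA" for x using dle_zero_SA[OF g(2,1) that] .
  show "T.tconv (S.SA_filter E) g (g s)"
  proof (rule T.tconv_diagI)
    fix i v assume i: "i \<in> I"
    define a where "a = (\<lambda>y. Re (T.sf i (g y) v v))"
    define b where "b = (\<lambda>c y. Re (T.sf i (\<Phi> c y) v v))"
    have bc: "((\<lambda>c. b c y) \<longlongrightarrow> a y) (net_filter R D)" if "y \<in> carrier S" for y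
      unfolding a_def b_def using lim that i by (intro tendsto_Re T.tconvD) (auto simp: pconv_def)
    have bs: "((\<lambda>y. b c y) \<longlongrightarrow> b c s) (S.SA_filter E)" if c: "c \<in> D" for c
    proof -
      note f = ncpsuD[OF \<Phi>[OF c]]
      have "T.tconv (S.SA_filter E) (\<lambda>y. \<Phi> c y) (\<Phi> c s)"
        by (rule normal_net[OF f(1,3,2) E _ Emono sc Elim]) (use sub in auto)
      then show ?thesis unfolding b_def using i by (intro tendsto_Re T.tconvD)
    qed
    have aup: "a y \<le> a s" if "y \<in> E" for y
      using dle_zero_mono[OF g(2,1) Ec[OF that] sc Es[OF that]] i
      by (auto simp: a_def T.lea_def less_eq_complex_def)
    \<comment> \<open>The map \<open>g - \<Phi> c\<close> is positive, so it does not decrease from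
      \<open>y0\<close> to \<open>y\<close>.\<close>
    have ab: "b c y - b c y0 \<le> a y - a y0" if "c \<in> D" "y \<in> E" "y0 \<in> E" "y0 \<sqsubseteq>\<^bsub>S.SA\<^esub> y" for c y y0
    proof -
      have "T.lea (\<Phi> c (y \<ominus>\<^bsub>S\<^esub> y0)) (g (y \<ominus>\<^bsub>S\<^esub> y0))"
        using that Emono Ec
        by (intro dle_positive[OF monotone_maps_upper[OF D mono lim that(1)]]) (auto simp: S.lea_zero_minus)
      then show ?thesis
        using that Ec i ncpsuD(1)[OF \<Phi>[OF that(1)]] g(1) lin_closed
        by (auto simp: T.lea_def lin_minus T.sf_minus lin_closed a_def b_def less_eq_complex_def)
    qed
    have "(a \<longlongrightarrow> a s) (S.SA_filter E)"
    proof (rule order_tendstoI)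
      fix \<alpha> assume "a s < \<alpha>"
      then show "eventually (\<lambda>y. a y < \<alpha>) (S.SA_filter E)"
        using eventually_in_net[OF E] aup by (auto elim!: eventually_mono intro: le_less_trans)
    next
      fix \<alpha> assume \<alpha>: "\<alpha> < a s"
      \<comment> \<open>One third each for replacing \<open>g\<close> by \<open>\<Phi> c\<close> at
        \<open>s\<close>, for doing so at \<open>y0\<close>, and for replacing \<open>s\<close> by a
        late \<open>y\<close> under \<open>\<Phi> c\<close>.\<close>
      define \<epsilon> where "\<epsilon> = (a s - \<alpha>) / 3"
      have \<epsilon>: "\<epsilon> > 0" using \<alpha> by (simp add: \<epsilon>_def)
      obtain y0 where y0: "y0 \<in> E" using dnet_nonempty[OF E] by blast
      have "eventually (\<lambda>c. a s - \<epsilon> < b c s) (net_filter R D)"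
        by (rule order_tendstoD(1)[OF bc[OF sc]]) (use \<epsilon> in simp)
      moreover have "eventually (\<lambda>c. b c y0 < a y0 + \<epsilon>) (net_filter R D)"
        by (rule order_tendstoD(2)[OF bc[OF Ec[OF y0]]]) (use \<epsilon> in simp)
      ultimately have "eventually (\<lambda>c. c \<in> D \<and> a s - \<epsilon> < b c s \<and> b c y0 < a y0 + \<epsilon>) (net_filter R D)"
        using eventually_in_net[OF D] by eventually_elim simp
      from eventually_happens'[OF net_filter_neq_bot[OF D] this]
      obtain c where c: "c \<in> D" "a s - \<epsilon> < b c s" "b c y0 < a y0 + \<epsilon>" by blast
      have "eventually (\<lambda>y. b c s - \<epsilon> < b c y) (S.SA_filter E)"
        by (rule order_tendstoD(1)[OF bs[OF c(1)]]) (use \<epsilon> in simp)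
      then show "eventually (\<lambda>y. \<alpha> < a y) (S.SA_filter E)"
        using eventually_net_filter_ge[OF E y0]
      proof eventually_elim
        case (elim y)
        have "3 * \<epsilon> = a s - \<alpha>" by (simp add: \<epsilon>_def)
        then show ?case using ab[OF c(1) _ y0, of y] elim c by linarith
      qed
    qed
    then have "((\<lambda>y. complex_of_real (a y)) \<longlongrightarrow> of_real (a s)) (S.SA_filter E)"
      by (rule tendsto_of_real)
    moreover have im: "complex_of_real (a y) = T.sf i (g y) v v" if "y \<in> carrier S.SA" for y
      using gSA[OF that] i by (simp add: a_def T.SA_carrier_iff complex_eq_iff)
    moreover have "eventually (\<lambda>y. complex_of_real (a y) = T.sf i (g y) v v) (S.SA_filter E)"
      using eventually_in_net[OF E] by (rule eventually_mono) (use im sub in auto)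
    ultimately show "((\<lambda>y. T.sf i (g y) v v) \<longlongrightarrow> T.sf i (g s) v v) (S.SA_filter E)"
      unfolding im[OF s, symmetric] by (blast intro: Lim_transform_eventually)
  qed
qed

text \<open>Subunitality bounds the values at a positive element by a multiple of the unit that does
  not depend on the map. Linearity, complete positivity and subunitality are closed under pointwise
  limits; normality needs the monotone interchange.\<close>

lemma monotone_maps_converge:
  assumes D: "dnet R D" and \<Phi>: "\<And>a. a \<in> D \<Longrightarrow> \<Phi> a \<in> ncpsu S T"
    and mono: "\<And>a b. a \<in> D \<Longrightarrow> b \<in> D \<Longrightarrow> R a b \<Longrightarrow> dle (\<Phi> a) (\<Phi> b)"
  shows "\<exists>g\<in>ncpsu S T. pconv (net_filter R D) \<Phi> g"
proof -
  let ?F = "net_filter R D"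
  note nb = net_filter_neq_bot[OF D] and inD = eventually_in_net[OF D]
  note f = ncpsuD[OF \<Phi>]
  have evc: "eventually (\<lambda>a. \<Phi> a x \<in> carrier T) ?F" if "x \<in> carrier S" for x
    using inD by (rule eventually_mono) (use f(1) lin_closed that in auto)
  have ex: "\<exists>l\<in>carrier T. T.tconv ?F (\<lambda>a. \<Phi> a x) l" if "x \<in> carrier S" for x
    using that
  proof (induction rule: S.positive_span_induct)
    case (positive p)
    have pSA: "p \<in> carrier S.SA" using S.lea_zero_SA positive .
    obtain C where C: "0 \<le> C" "S.lea p (complex_of_real C \<odot>\<^bsub>S\<^esub> \<one>\<^bsub>S\<^esub>)" using S.order_unit[OF pSA] .
    show ?case
    proof (rule T.bounded_monotone_net_tconv[OF D])
      show "\<Phi> a p \<in> carrier T.SA" if "a \<in> D" for a using dle_zero_SA[OF f(3,1)[OF that] pSA] .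
      show "T.lea (\<Phi> a p) (\<Phi> b p)" if "a \<in> D" "b \<in> D" "R a b" for a b
        using dle_positive[OF mono[OF that] positive] .
      show "complex_of_real C \<odot>\<^bsub>T\<^esub> \<one>\<^bsub>T\<^esub> \<in> carrier T.SA"
        by (simp add: T.SA_carrier_iff T.sf_smult T.sf_one)
      show "T.lea (\<Phi> a p) (complex_of_real C \<odot>\<^bsub>T\<^esub> \<one>\<^bsub>T\<^esub>)" if a: "a \<in> D" for a
      proof (rule T.lea_trans)
        show "T.lea (\<Phi> a p) (\<Phi> a (complex_of_real C \<odot>\<^bsub>S\<^esub> \<one>\<^bsub>S\<^esub>))"
          by (rule dle_zero_mono[OF f(3,1)[OF a] positive(1) _ C(2)]) simp
        show "T.lea (\<Phi> a (complex_of_real C \<odot>\<^bsub>S\<^esub> \<one>\<^bsub>S\<^esub>)) (complex_of_real C \<odot>\<^bsub>T\<^esub> \<one>\<^bsub>T\<^esub>)"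
          using f(4)[OF a] f(1)[OF a] C(1)
          by (auto simp: T.lea_def lin_smult lin_closed T.sf_smult less_eq_complex_def intro: mult_left_mono)
      qed
    qed
  next
    case (add x y)
    then obtain l m where "l \<in> carrier T" "m \<in> carrier T"
      "T.tconv ?F (\<lambda>a. \<Phi> a x) l" "T.tconv ?F (\<lambda>a. \<Phi> a y) m" by blast
    then have "T.tconv ?F (\<lambda>a. \<Phi> a x \<oplus>\<^bsub>T\<^esub> \<Phi> a y) (l \<oplus>\<^bsub>T\<^esub> m)"
      using evc add by (intro T.tconv_add)
    then have "T.tconv ?F (\<lambda>a. \<Phi> a (x \<oplus>\<^bsub>S\<^esub> y)) (l \<oplus>\<^bsub>T\<^esub> m)"
      by (rule T.tconv_cong) (use inD f(1) add in \<open>auto simp: lin_add elim!: eventually_mono\<close>)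
    then show ?case using \<open>l \<in> carrier T\<close> \<open>m \<in> carrier T\<close> by blast
  next
    case (smult c x)
    then obtain l where "l \<in> carrier T" "T.tconv ?F (\<lambda>a. \<Phi> a x) l" by blast
    then have "T.tconv ?F (\<lambda>a. c \<odot>\<^bsub>T\<^esub> \<Phi> a x) (c \<odot>\<^bsub>T\<^esub> l)"
      using evc smult by (intro T.tconv_smult tendsto_const)
    then have "T.tconv ?F (\<lambda>a. \<Phi> a (c \<odot>\<^bsub>S\<^esub> x)) (c \<odot>\<^bsub>T\<^esub> l)"
      by (rule T.tconv_cong) (use inD f(1) smult in \<open>auto simp: lin_smult elim!: eventually_mono\<close>)
    then show ?case using \<open>l \<in> carrier T\<close> by blast
  qed
  then obtain g0 where g0: "\<And>x. x \<in> carrier S \<Longrightarrow> g0 x \<in> carrier T"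
    "\<And>x. x \<in> carrier S \<Longrightarrow> T.tconv ?F (\<lambda>a. \<Phi> a x) (g0 x)"
    by metis
  define g where "g = restrict g0 (carrier S)"
  have gc: "g x \<in> carrier T" and gl: "T.tconv ?F (\<lambda>a. \<Phi> a x) (g x)" if "x \<in> carrier S" for x
    using that g0 by (simp_all add: g_def)
  have lim: "pconv ?F \<Phi> g" using gl by (simp add: pconv_def)
  have lin: "lin g"
  proof (rule linI[OF gc])
    fix x y assume xy: "x \<in> carrier S" "y \<in> carrier S"
    have "T.tconv ?F (\<lambda>a. \<Phi> a x \<oplus>\<^bsub>T\<^esub> \<Phi> a y) (g x \<oplus>\<^bsub>T\<^esub> g y)"
      using evc gc gl xy by (intro T.tconv_add)
    then have "T.tconv ?F (\<lambda>a. \<Phi> a (x \<oplus>\<^bsub>S\<^esub> y)) (g x \<oplus>\<^bsub>T\<^esub> g y)"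
      by (rule T.tconv_cong) (use inD f(1) xy in \<open>auto simp: lin_add elim!: eventually_mono\<close>)
    then show "g (x \<oplus>\<^bsub>S\<^esub> y) = g x \<oplus>\<^bsub>T\<^esub> g y"
      by (rule T.tconv_unique[OF nb gl[OF S.add_closed'[OF xy]]]) (use xy gc in auto)
  next
    fix c x assume x: "x \<in> carrier S"
    have "T.tconv ?F (\<lambda>a. c \<odot>\<^bsub>T\<^esub> \<Phi> a x) (c \<odot>\<^bsub>T\<^esub> g x)"
      using evc gc gl x by (intro T.tconv_smult tendsto_const)
    then have "T.tconv ?F (\<lambda>a. \<Phi> a (c \<odot>\<^bsub>S\<^esub> x)) (c \<odot>\<^bsub>T\<^esub> g x)"
      by (rule T.tconv_cong) (use inD f(1) x in \<open>auto simp: lin_smult elim!: eventually_mono\<close>)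
    then show "g (c \<odot>\<^bsub>S\<^esub> x) = c \<odot>\<^bsub>T\<^esub> g x"
      by (rule T.tconv_unique[OF nb gl[OF S.smult_closed'[OF x]]]) (use x gc in auto)
  qed
  have pos: "cpos g"
    by (rule pconv_dle[OF pconv_const lim nb]) (use inD f(3) in \<open>auto elim!: eventually_mono\<close>)
  have "g \<in> ncpsu S T"
  proof (rule ncpsuI[OF _ lin pos])
    show "g \<in> extensional (carrier S)" by (simp add: g_def)
    show "normal_map S T g" by (rule normal_map_of_monotone_limit[OF D \<Phi> mono lin pos lim])
    show "T.lea (g \<one>\<^bsub>S\<^esub>) \<one>\<^bsub>T\<^esub>"
      by (rule T.tconv_lea[OF gl T.tconv_const nb]) (use inD f(4) in \<open>auto elim!: eventually_mono\<close>)
  qed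
  with lim show ?thesis by blast
qed

text \<open>Turns Scott continuity of an operation on homsets into a computation with pointwise
  limits.\<close>

lemma pconv_of_QH_is_lub:
  assumes D: "dnet R D" and \<Phi>: "\<And>a. a \<in> D \<Longrightarrow> \<Phi> a \<in> ncpsu S T"
    and mono: "\<And>a b. a \<in> D \<Longrightarrow> b \<in> D \<Longrightarrow> R a b \<Longrightarrow> dle (\<Phi> a) (\<Phi> b)"
    and lub: "is_lub QH g (\<Phi> ` D)"
  shows "pconv (net_filter R D) \<Phi> g"
proof -
  have sub: "\<Phi> ` D \<subseteq> carrier QH" using \<Phi> by (auto simp: QH_carrier)
  have "\<exists>g\<in>ncpsu S T. pconv (net_filter R D) \<Phi> g"
    by (rule monotone_maps_converge[OF D \<Phi> mono])
  then obtain h where h: "h \<in> ncpsu S T" "pconv (net_filter R D) \<Phi> h" by blast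
  have "is_lub QH h (\<Phi> ` D)" by (rule QH_is_lub_of_pconv[OF D \<Phi> mono h])
  note l' = is_lubD[OF this sub]
  note s = is_lubD[OF lub sub]
  have g: "g \<in> ncpsu S T" using s(1) by (simp add: QH_carrier)
  have "dle g h" "dle h g"
    using s(3)[OF l'(1,2)] l'(3)[OF s(1,2)] g h(1) by (auto simp: QH_le)
  then have "g = h" using g h(1) by (intro dle_antisym)
  then show ?thesis using h by simp
qed

lemma QH_dcpo: "dcpo QH"
proof -
  interpret partial_order QH by (rule QH_partial_order)
  show ?thesis
  proof
    fix D assume D: "directed QH D"
    then have sub: "D \<subseteq> ncpsu S T" by (simp add: directed_def QH_carrier)
    note net = QH_directed_dnet[OF D]
    have mono: "dle f g" if "f \<in> D" "g \<in> D" "f \<sqsubseteq>\<^bsub>QH\<^esub> g" for f g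
      using that sub QH_le[of f g] by blast
    have "\<exists>g\<in>ncpsu S T. pconv (net_filter (le QH) D) (\<lambda>f. f) g"
      by (rule monotone_maps_converge[OF net]) (use sub mono in auto)
    then obtain g where "g \<in> ncpsu S T" "pconv (net_filter (le QH) D) (\<lambda>f. f) g" by blast
    then have "is_lub QH g ((\<lambda>f. f) ` D)"
      by (intro QH_is_lub_of_pconv[OF net]) (use sub mono in auto)
    then show "\<exists>s. is_lub QH s D" by auto
  qed
qed

end


section \<open>The Kegelspitze structure\<close>

lemma prod_gorder_simps:
  "carrier (prod_gorder L M) = carrier L \<times> carrier M"
  "x \<sqsubseteq>\<^bsub>prod_gorder L M\<^esub> y \<longleftrightarrow> fst x \<sqsubseteq>\<^bsub>L\<^esub> fst y \<and> snd x \<sqsubseteq>\<^bsub>M\<^esub> snd y"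
  by (simp_all add: prod_gorder_def)

text \<open>An upper bound of one projection, paired with the other coordinate of \<open>s\<close>,
  is an upper bound of \<open>D\<close>.\<close>

lemma is_lub_prod_gorder:
  assumes "D \<subseteq> carrier (prod_gorder L M)" and lub: "is_lub (prod_gorder L M) s D"
    and L: "\<And>x. x \<in> carrier L \<Longrightarrow> x \<sqsubseteq>\<^bsub>L\<^esub> x" and M: "\<And>x. x \<in> carrier M \<Longrightarrow> x \<sqsubseteq>\<^bsub>M\<^esub> x"
  shows "is_lub L (fst s) (fst ` D)" "is_lub M (snd s) (snd ` D)"
proof -
  note s = is_lubD[OF lub assms(1)]
  have sc: "fst s \<in> carrier L" "snd s \<in> carrier M" using s(1) by (auto simp: prod_gorder_simps)
  show "is_lub L (fst s) (fst ` D)"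
  proof (rule is_lubI)
    fix u assume u: "u \<in> carrier L" "\<And>x. x \<in> fst ` D \<Longrightarrow> x \<sqsubseteq>\<^bsub>L\<^esub> u"
    have "s \<sqsubseteq>\<^bsub>prod_gorder L M\<^esub> (u, snd s)"
      by (rule s(3)) (use u sc s(2) in \<open>auto simp: prod_gorder_simps\<close>)
    then show "fst s \<sqsubseteq>\<^bsub>L\<^esub> u" by (simp add: prod_gorder_simps)
  qed (use assms(1) sc s(2) in \<open>auto simp: prod_gorder_simps\<close>)
  show "is_lub M (snd s) (snd ` D)"
  proof (rule is_lubI)
    fix u assume u: "u \<in> carrier M" "\<And>x. x \<in> snd ` D \<Longrightarrow> x \<sqsubseteq>\<^bsub>M\<^esub> u"
    have "s \<sqsubseteq>\<^bsub>prod_gorder L M\<^esub> (fst s, u)"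
      by (rule s(3)) (use u sc s(2) in \<open>auto simp: prod_gorder_simps\<close>)
    then show "snd s \<sqsubseteq>\<^bsub>M\<^esub> u" by (simp add: prod_gorder_simps)
  qed (use assms(1) sc s(2) in \<open>auto simp: prod_gorder_simps\<close>)
qed

lemma directed_prod_dnet:
  assumes "directed (prod_gorder L M) D"
    and "\<And>x. x \<in> carrier L \<Longrightarrow> x \<sqsubseteq>\<^bsub>L\<^esub> x" "\<And>x. x \<in> carrier M \<Longrightarrow> x \<sqsubseteq>\<^bsub>M\<^esub> x"
    and "\<And>x y z. x \<in> carrier L \<Longrightarrow> y \<in> carrier L \<Longrightarrow> z \<in> carrier L \<Longrightarrow> x \<sqsubseteq>\<^bsub>L\<^esub> y \<Longrightarrow> y \<sqsubseteq>\<^bsub>L\<^esub> z \<Longrightarrow> x \<sqsubseteq>\<^bsub>L\<^esub> z"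
    and "\<And>x y z. x \<in> carrier M \<Longrightarrow> y \<in> carrier M \<Longrightarrow> z \<in> carrier M \<Longrightarrow> x \<sqsubseteq>\<^bsub>M\<^esub> y \<Longrightarrow> y \<sqsubseteq>\<^bsub>M\<^esub> z \<Longrightarrow> x \<sqsubseteq>\<^bsub>M\<^esub> z"
  shows "dnet (le (prod_gorder L M)) D"
proof (rule directed_dnet[OF assms(1)])
  show "x \<sqsubseteq>\<^bsub>prod_gorder L M\<^esub> x" if "x \<in> carrier (prod_gorder L M)" for x
    using that assms(2,3) by (auto simp: prod_gorder_simps)
  fix x y z
  assume "x \<in> carrier (prod_gorder L M)" "y \<in> carrier (prod_gorder L M)" "z \<in> carrier (prod_gorder L M)"
    and xy: "x \<sqsubseteq>\<^bsub>prod_gorder L M\<^esub> y" and yz: "y \<sqsubseteq>\<^bsub>prod_gorder L M\<^esub> z"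
  then have c: "fst x \<in> carrier L" "fst y \<in> carrier L" "fst z \<in> carrier L"
    "snd x \<in> carrier M" "snd y \<in> carrier M" "snd z \<in> carrier M" by (auto simp: prod_gorder_simps)
  show "x \<sqsubseteq>\<^bsub>prod_gorder L M\<^esub> z"
    using xy yz assms(4)[OF c(1-3)] assms(5)[OF c(4-6)] by (simp add: prod_gorder_simps)
qed

lemma unit_interval_simps: "carrier unit_interval = {0..1}" "x \<sqsubseteq>\<^bsub>unit_interval\<^esub> y \<longleftrightarrow> x \<le> y"
  by (simp_all add: unit_interval_def)

text \<open>The supremum competes only with bounds inside the interval, so the real limit is first
  placed below \<open>r\<close> and thereby inside.\<close>

lemma unit_interval_lub_tendsto:
  assumes D: "dnet R D" and u: "\<And>x. x \<in> D \<Longrightarrow> u x \<in> {0..1}"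
    and mono: "\<And>x y. x \<in> D \<Longrightarrow> y \<in> D \<Longrightarrow> R x y \<Longrightarrow> u x \<le> u y"
    and lub: "is_lub unit_interval r (u ` D)"
  shows "(u \<longlongrightarrow> r) (net_filter R D)"
proof -
  have u1: "u x \<le> 1" if "x \<in> D" for x using u[OF that] by simp
  obtain l where l: "(u \<longlongrightarrow> l) (net_filter R D)" "\<And>x. x \<in> D \<Longrightarrow> u x \<le> l"
    using bounded_monotone_net_converges[OF D, of u 1] mono u1 by blast
  have sub: "u ` D \<subseteq> carrier unit_interval" using u by (auto simp: unit_interval_simps)
  note r = is_lubD[OF lub sub, unfolded unit_interval_simps]
  have "l \<le> r"
    by (rule tendsto_upperbound[OF l(1) _ net_filter_neq_bot[OF D]])
      (use eventually_in_net[OF D] r(2) in \<open>auto elim!: eventually_mono\<close>)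
  moreover have "r \<le> l"
  proof (rule r(3))
    obtain x where "x \<in> D" using dnet_nonempty[OF D] by blast
    then show "l \<in> {0..1}" using l(2)[of x] u[of x] \<open>l \<le> r\<close> r(1) by auto
  qed (use l(2) in auto)
  ultimately show ?thesis using l(1) by simp
qed

context coords2
begin

section \<open>Convex combinations of maps\<close>

lemma QH_base: "base QH = (\<lambda>x\<in>carrier S. \<zero>\<^bsub>T\<^esub>)"
  by (simp add: Q_hom_def)

lemma QH_cc: "cc QH r f g = (\<lambda>x\<in>carrier S.
    complex_of_real r \<odot>\<^bsub>T\<^esub> f x \<oplus>\<^bsub>T\<^esub> complex_of_real (1 - r) \<odot>\<^bsub>T\<^esub> g x)"
  by (simp add: Q_hom_def)

lemma cc_closed_carrier:
  "f \<in> ncpsu S T \<Longrightarrow> g \<in> ncpsu S T \<Longrightarrow> x \<in> carrier S \<Longrightarrow> cc QH r f g x \<in> carrier T"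
  using ncpsuD(1)[of f] ncpsuD(1)[of g] by (simp add: QH_cc lin_closed)

lemma sf_cc:
  assumes "f \<in> ncpsu S T" "g \<in> ncpsu S T" "x \<in> carrier S" "i \<in> I"
  shows "T.sf i (cc QH r f g x) v w =
    complex_of_real r * T.sf i (f x) v w + complex_of_real (1 - r) * T.sf i (g x) v w"
  using assms ncpsuD(1)[OF assms(1)] ncpsuD(1)[OF assms(2)]
  by (simp add: QH_cc T.sf_add T.sf_smult lin_closed)

lemma bform_cc:
  assumes "f \<in> ncpsu S T" "g \<in> ncpsu S T" "S.blocks n X" "i \<in> I"
  shows "T.bform i n (\<lambda>k l. cc QH r f g (X k l)) v =
    complex_of_real r * T.bform i n (\<lambda>k l. f (X k l)) v + complex_of_real (1 - r) * T.bform i n (\<lambda>k l. g (X k l)) v"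
  unfolding T.bform_def sum_distrib_left sum.distrib[symmetric]
  using assms by (intro sum.cong refl sf_cc) (auto simp: S.blocks_def)

lemma convex_le:
  fixes z z' w w' :: complex
  assumes "0 \<le> r" "r \<le> 1" "z \<le> z'" "w \<le> w'"
  shows "complex_of_real r * z + complex_of_real (1 - r) * w \<le> complex_of_real r * z' + complex_of_real (1 - r) * w'"
  using assms by (intro add_mono mult_left_mono) (simp_all add: complex_nonneg_iff)

lemma lin_cc:
  assumes "f \<in> ncpsu S T" "g \<in> ncpsu S T"
  shows "lin (cc QH r f g)"
proof (rule linI)
  note fl = ncpsuD(1)[OF assms(1)] and gl = ncpsuD(1)[OF assms(2)]
  show c: "cc QH r f g x \<in> carrier T" if "x \<in> carrier S" for x using cc_closed_carrier[OF assms that] .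
  show "cc QH r f g (x \<oplus>\<^bsub>S\<^esub> y) = cc QH r f g x \<oplus>\<^bsub>T\<^esub> cc QH r f g y"
    if "x \<in> carrier S" "y \<in> carrier S" for x y
    using c that fl gl
    by (intro T.sf_eqI) (simp_all add: sf_cc[OF assms] T.sf_add lin_add lin_closed algebra_simps)
  show "cc QH r f g (a \<odot>\<^bsub>S\<^esub> x) = a \<odot>\<^bsub>T\<^esub> cc QH r f g x" if "x \<in> carrier S" for a x
    using c that fl gl
    by (intro T.sf_eqI) (simp_all add: sf_cc[OF assms] T.sf_smult lin_smult lin_closed algebra_simps)
qed

text \<open>The weight moves along the net together with the maps, as joint continuity of scalar
  multiplication requires.\<close>

lemma tconv_cc:
  assumes r: "(r \<longlongrightarrow> r0) F"
    and f: "T.tconv F (\<lambda>a. \<Phi> a x) (f x)" "f \<in> ncpsu S T" "eventually (\<lambda>a. \<Phi> a \<in> ncpsu S T) F"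
    and g: "T.tconv F (\<lambda>a. \<Psi> a x) (g x)" "g \<in> ncpsu S T" "eventually (\<lambda>a. \<Psi> a \<in> ncpsu S T) F"
    and x: "x \<in> carrier S"
  shows "T.tconv F (\<lambda>a. cc QH (r a) (\<Phi> a) (\<Psi> a) x) (cc QH r0 f g x)"
  unfolding T.tconv_def
proof (intro ballI allI)
  fix i v w assume i: "i \<in> I"
  have "((\<lambda>a. complex_of_real (r a) * T.sf i (\<Phi> a x) v w + complex_of_real (1 - r a) * T.sf i (\<Psi> a x) v w)
      \<longlongrightarrow> T.sf i (cc QH r0 f g x) v w) F"
    unfolding sf_cc[OF f(2) g(2) x i]
    by (intro tendsto_add tendsto_mult tendsto_of_real tendsto_diff tendsto_const r T.tconvD[OF f(1) i] T.tconvD[OF g(1) i])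
  moreover have "eventually (\<lambda>a. complex_of_real (r a) * T.sf i (\<Phi> a x) v w
      + complex_of_real (1 - r a) * T.sf i (\<Psi> a x) v w = T.sf i (cc QH (r a) (\<Phi> a) (\<Psi> a) x) v w) F"
    using f(3) g(3) by eventually_elim (simp only: sf_cc x i)
  ultimately show "((\<lambda>a. T.sf i (cc QH (r a) (\<Phi> a) (\<Psi> a) x) v w) \<longlongrightarrow> T.sf i (cc QH r0 f g x) v w) F"
    by (rule Lim_transform_eventually)
qed

lemma pconv_cc:
  assumes "(r \<longlongrightarrow> r0) F"
    and "pconv F \<Phi> f" "f \<in> ncpsu S T" "eventually (\<lambda>a. \<Phi> a \<in> ncpsu S T) F"
    and "pconv F \<Psi> g" "g \<in> ncpsu S T" "eventually (\<lambda>a. \<Psi> a \<in> ncpsu S T) F"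
  shows "pconv F (\<lambda>a. cc QH (r a) (\<Phi> a) (\<Psi> a)) (cc QH r0 f g)"
  unfolding pconv_def using assms by (auto simp: pconv_def intro!: tconv_cc)

lemma dle_cc:
  assumes r: "0 \<le> r" "r \<le> 1" and m: "f \<in> ncpsu S T" "g \<in> ncpsu S T" "f' \<in> ncpsu S T" "g' \<in> ncpsu S T"
    and "dle f f'" "dle g g'"
  shows "dle (cc QH r f g) (cc QH r f' g')"
  unfolding dle_def
  by (intro allI impI ballI, simp only: bform_cc m) (intro convex_le r dleD assms)

lemma ncpsu_cc:
  assumes r: "0 \<le> r" "r \<le> 1" and m: "f \<in> ncpsu S T" "g \<in> ncpsu S T"
  shows "cc QH r f g \<in> ncpsu S T"
proof (rule ncpsuI)
  note f = ncpsuD[OF m(1)] and g = ncpsuD[OF m(2)]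
  show "cc QH r f g \<in> extensional (carrier S)" by (simp add: QH_cc)
  show l: "lin (cc QH r f g)" by (rule lin_cc) fact+
  show pos: "cpos (cc QH r f g)"
    unfolding dle_def
  proof (intro allI impI ballI)
    fix n X i v assume X: "S.blocks n X" "i \<in> I"
    have "complex_of_real r * 0 + complex_of_real (1 - r) * 0
        \<le> complex_of_real r * T.bform i n (\<lambda>k l. f (X k l)) v + complex_of_real (1 - r) * T.bform i n (\<lambda>k l. g (X k l)) v"
      using dleD[OF f(3) X, of v] dleD[OF g(3) X, of v] X(2) by (intro convex_le r) (simp_all add: T.bform_zero)
    then show "T.bform i n (\<lambda>k l. \<zero>\<^bsub>T\<^esub>) v \<le> T.bform i n (\<lambda>k l. cc QH r f g (X k l)) v"
      using X by (simp add: bform_cc m T.bform_zero)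
  qed
  show "normal_map S T (cc QH r f g)"
  proof (rule normal_mapI[OF l pos])
    fix D s assume D: "dnet (le S.SA) D" "D \<subseteq> carrier S.SA" "s \<in> carrier S.SA"
      "S.tconv (S.SA_filter D) (\<lambda>x. x) s"
    have sc: "s \<in> carrier S" using S.SA_carrier D(3) .
    have mono: "S.lea x y" if "x \<in> D" "y \<in> D" "x \<sqsubseteq>\<^bsub>S.SA\<^esub> y" for x y
      using that D(2) S.SA_le[of x y] by blast
    have n: "T.tconv (S.SA_filter D) h (h s)" if "h \<in> ncpsu S T" for h
      by (rule normal_net[OF ncpsuD(1,3,2)[OF that] D(1) _ mono sc D(4)]) (use D(2) in auto)
    show "T.tconv (S.SA_filter D) (cc QH r f g) (cc QH r f g s)"
      unfolding T.tconv_def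
    proof (intro ballI allI)
      fix i v w assume i: "i \<in> I"
      have "((\<lambda>x. complex_of_real r * T.sf i (f x) v w + complex_of_real (1 - r) * T.sf i (g x) v w)
          \<longlongrightarrow> T.sf i (cc QH r f g s) v w) (S.SA_filter D)"
        unfolding sf_cc[OF m sc i]
        by (intro tendsto_add tendsto_mult tendsto_const T.tconvD[OF n[OF m(1)] i] T.tconvD[OF n[OF m(2)] i])
      moreover have "eventually (\<lambda>x. complex_of_real r * T.sf i (f x) v w + complex_of_real (1 - r) * T.sf i (g x) v w
          = T.sf i (cc QH r f g x) v w) (S.SA_filter D)"
        using eventually_in_net[OF D(1)]
        by (rule eventually_mono) (use D(2) S.SA_carrier i in \<open>auto simp: sf_cc[OF m] subset_iff\<close>)
      ultimately show "((\<lambda>x. T.sf i (cc QH r f g x) v w) \<longlongrightarrow> T.sf i (cc QH r f g s) v w) (S.SA_filter D)"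
        by (rule Lim_transform_eventually)
    qed
  qed
  show "T.lea (cc QH r f g \<one>\<^bsub>S\<^esub>) \<one>\<^bsub>T\<^esub>"
    unfolding T.lea_def
  proof (intro ballI allI)
    fix i v assume i: "i \<in> I"
    have "complex_of_real r * T.sf i (f \<one>\<^bsub>S\<^esub>) v v + complex_of_real (1 - r) * T.sf i (g \<one>\<^bsub>S\<^esub>) v v
        \<le> complex_of_real r * T.sf i \<one>\<^bsub>T\<^esub> v v + complex_of_real (1 - r) * T.sf i \<one>\<^bsub>T\<^esub> v v"
      using f(4) g(4) i by (intro convex_le r) (auto simp: T.lea_def)
    then show "T.sf i (cc QH r f g \<one>\<^bsub>S\<^esub>) v v \<le> T.sf i \<one>\<^bsub>T\<^esub> v v"
      using i by (simp add: sf_cc m algebra_simps)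
  qed
qed

lemma ncpsu_zero: "base QH \<in> ncpsu S T"
proof (rule ncpsuI)
  let ?z = "\<lambda>x\<in>carrier S. \<zero>\<^bsub>T\<^esub>"
  show "base QH \<in> extensional (carrier S)" by (simp add: QH_base)
  show l: "lin (base QH)"
  proof (rule linI)
    show "base QH (x \<oplus>\<^bsub>S\<^esub> y) = base QH x \<oplus>\<^bsub>T\<^esub> base QH y" if "x \<in> carrier S" "y \<in> carrier S" for x y
      using that by (intro T.sf_eqI) (simp_all add: QH_base T.sf_zero T.sf_add)
    show "base QH (c \<odot>\<^bsub>S\<^esub> x) = c \<odot>\<^bsub>T\<^esub> base QH x" if "x \<in> carrier S" for c x
      using that by (intro T.sf_eqI) (simp_all add: QH_base T.sf_zero T.sf_smult)
  qed (simp add: QH_base)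
  show pos: "cpos (base QH)"
    by (rule dle_cong[OF dle_refl]) (simp_all add: QH_base)
  show "normal_map S T (base QH)"
  proof (rule normal_mapI[OF l pos])
    fix D s assume D: "dnet (le S.SA) D" "D \<subseteq> carrier S.SA" "s \<in> carrier S.SA"
    show "T.tconv (S.SA_filter D) (base QH) (base QH s)"
    proof (rule T.tconv_cong[OF T.tconv_const])
      show "eventually (\<lambda>x. base QH s = base QH x) (S.SA_filter D)"
        using eventually_in_net[OF D(1)]
        by (rule eventually_mono) (use D(2,3) S.SA_carrier in \<open>auto simp: QH_base subset_iff\<close>)
    qed
  qed
  show "T.lea (base QH \<one>\<^bsub>S\<^esub>) \<one>\<^bsub>T\<^esub>" by (simp add: QH_base T.zero_lea_one)
qed

text \<open>Raising the weight adds a nonnegative multiple of the completely positive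
  \<open>f\<close>.\<close>

lemma dle_scale:
  assumes r: "0 \<le> r" "r \<le> r'" "r' \<le> 1" and f: "f \<in> ncpsu S T"
  shows "dle (cc QH r f (base QH)) (cc QH r' f (base QH))"
  unfolding dle_def
proof (intro allI impI ballI)
  fix n X i v assume X: "S.blocks n X" "i \<in> I"
  have z: "T.bform i n (\<lambda>k l. base QH (X k l)) v = 0"
    using X T.bform_cong[of n "\<lambda>k l. base QH (X k l)" "\<lambda>_ _. \<zero>\<^bsub>T\<^esub>" i v]
    by (simp add: QH_base S.blocks_def T.bform_zero)
  have "0 \<le> T.bform i n (\<lambda>k l. f (X k l)) v"
    using dleD[OF ncpsuD(3)[OF f] X, of v] X(2) by (simp add: T.bform_zero)
  then have "complex_of_real r * T.bform i n (\<lambda>k l. f (X k l)) v \<le> complex_of_real r' * T.bform i n (\<lambda>k l. f (X k l)) v"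
    using r by (intro mult_right_mono) (simp_all add: less_eq_complex_def)
  then show "T.bform i n (\<lambda>k l. cc QH r f (base QH) (X k l)) v \<le> T.bform i n (\<lambda>k l. cc QH r' f (base QH) (X k l)) v"
    using X by (simp add: bform_cc f ncpsu_zero z)
qed

text \<open>Reduces the barycentric laws to identities between complex numbers.\<close>

lemma cc_eqI:
  assumes "h \<in> ncpsu S T" "h' \<in> ncpsu S T"
    and "\<And>x i v. x \<in> carrier S \<Longrightarrow> i \<in> I \<Longrightarrow> T.sf i (h x) v v = T.sf i (h' x) v v"
  shows "h = h'"
proof (rule ncpsu_eqI[OF assms(1,2)])
  fix x assume "x \<in> carrier S"
  then show "h x = h' x"
    using assms(3) lin_closed[OF ncpsuD(1)[OF assms(1)]] lin_closed[OF ncpsuD(1)[OF assms(2)]]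
    by (intro T.sf_eqI) auto
qed

lemma QH_refl: "f \<in> carrier QH \<Longrightarrow> f \<sqsubseteq>\<^bsub>QH\<^esub> f"
  by (simp add: QH_carrier QH_le dle_refl)

lemma QH_trans: "f \<in> carrier QH \<Longrightarrow> g \<in> carrier QH \<Longrightarrow> h \<in> carrier QH \<Longrightarrow>
    f \<sqsubseteq>\<^bsub>QH\<^esub> g \<Longrightarrow> g \<sqsubseteq>\<^bsub>QH\<^esub> h \<Longrightarrow> f \<sqsubseteq>\<^bsub>QH\<^esub> h"
  by (auto simp: QH_carrier QH_le intro: dle_trans)

lemma QH_kegelspitze: "kegelspitze QH"
proof -
  interpret dcpo QH by (rule QH_dcpo)
  show ?thesis
  proof
    show "base QH \<in> carrier QH" by (simp add: QH_carrier ncpsu_zero)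
    show "cc QH r a b \<in> carrier QH" if "0 \<le> r" "r \<le> 1" "a \<in> carrier QH" "b \<in> carrier QH" for r a b
      using that by (simp add: QH_carrier ncpsu_cc)
    show "cc QH 1 a b = a" if "a \<in> carrier QH" "b \<in> carrier QH" for a b
      using that unfolding QH_carrier by (intro cc_eqI) (simp_all add: ncpsu_cc sf_cc)
    show "cc QH r a b = cc QH (1 - r) b a"
      if "0 \<le> r" "r \<le> 1" "a \<in> carrier QH" "b \<in> carrier QH" for r a b
      using that unfolding QH_carrier by (intro cc_eqI) (simp_all add: ncpsu_cc sf_cc)
    show "cc QH r a a = a" if "0 \<le> r" "r \<le> 1" "a \<in> carrier QH" for r a
      using that unfolding QH_carrier by (intro cc_eqI) (simp_all add: ncpsu_cc sf_cc algebra_simps)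
    show "cc QH r (cc QH p a b) c = cc QH (p * r) a (cc QH ((r - p * r) / (1 - p * r)) b c)"
      if r: "0 \<le> r" "r < 1" and p: "0 \<le> p" "p < 1"
        and m: "a \<in> carrier QH" "b \<in> carrier QH" "c \<in> carrier QH" for r p a b c
    proof -
      define q where "q = (r - p * r) / (1 - p * r)"
      have "p * r \<le> r" using r p by (intro mult_left_le_one_le) auto
      then have pr: "0 \<le> p * r" "p * r \<le> r" "p * r < 1"
        using r p by (simp_all add: le_less_trans)
      then have q: "0 \<le> q" "q \<le> 1" using r p by (auto simp: q_def divide_simps)
      \<comment> \<open>The quotient is cleared here: \<open>r - p r\<close> and
        \<open>1 - r\<close> are the weights of \<open>b\<close> and \<open>c\<close> on both
        sides.\<close>
      have e1: "(1 - p * r) * q = r - p * r" using pr(3) by (simp add: q_def)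
      have "(1 - p * r) * (1 - q) = (1 - p * r) - (1 - p * r) * q" by (simp add: right_diff_distrib)
      then have e: "(1 - p * r) * q = r - p * r" "(1 - p * r) * (1 - q) = 1 - r"
        using e1 by simp_all
      have abc: "a \<in> ncpsu S T" "b \<in> ncpsu S T" "c \<in> ncpsu S T" using m by (simp_all add: QH_carrier)
      have m1: "cc QH p a b \<in> ncpsu S T" using p abc by (simp add: ncpsu_cc)
      have m2: "cc QH q b c \<in> ncpsu S T" using q abc by (simp add: ncpsu_cc)
      have "cc QH r (cc QH p a b) c = cc QH (p * r) a (cc QH q b c)"
      proof (rule cc_eqI)
        show "cc QH r (cc QH p a b) c \<in> ncpsu S T" using r abc m1 by (simp add: ncpsu_cc)
        show "cc QH (p * r) a (cc QH q b c) \<in> ncpsu S T" using pr abc m2 by (simp add: ncpsu_cc)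
        fix x i v assume x: "x \<in> carrier S" "i \<in> I"
        let ?s = "\<lambda>f. T.sf i (f x) v v"
        have "?s (cc QH (p * r) a (cc QH q b c)) = complex_of_real (p * r) * ?s a
            + (complex_of_real ((1 - p * r) * q) * ?s b + complex_of_real ((1 - p * r) * (1 - q)) * ?s c)"
          using x abc m2 by (simp only: sf_cc of_real_mult) (simp only: distrib_left mult.assoc)
        also have "\<dots> = ?s (cc QH r (cc QH p a b) c)"
          unfolding e using x abc m1 by (simp only: sf_cc) (simp add: algebra_simps)
        finally show "?s (cc QH r (cc QH p a b) c) = ?s (cc QH (p * r) a (cc QH q b c))" ..
      qed
      then show ?thesis by (simp add: q_def)
    qed
    show "scott_continuous (prod_gorder QH QH) QH (\<lambda>(a, b). cc QH r a b)"
      if r: "0 \<le> r" "r \<le> 1" for r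
      unfolding scott_continuous_def
    proof (intro conjI allI impI)
      show "(\<lambda>(a, b). cc QH r a b) \<in> carrier (prod_gorder QH QH) \<rightarrow> carrier QH"
        using r by (auto simp: prod_gorder_simps QH_carrier ncpsu_cc)
      fix D s assume "directed (prod_gorder QH QH) D \<and> is_lub (prod_gorder QH QH) s D"
      then have dir: "directed (prod_gorder QH QH) D" and lub: "is_lub (prod_gorder QH QH) s D" by auto
      have sub: "D \<subseteq> carrier (prod_gorder QH QH)" using dir by (simp add: directed_def)
      let ?R = "le (prod_gorder QH QH)"
      have D: "dnet ?R D"
        by (rule directed_prod_dnet[OF dir]) (blast intro: QH_refl QH_trans)+
      have c: "fst x \<in> ncpsu S T" "snd x \<in> ncpsu S T" if "x \<in> D" for x
        using that sub by (auto simp: prod_gorder_simps QH_carrier)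
      have mono: "dle (fst x) (fst y)" "dle (snd x) (snd y)" if "x \<in> D" "y \<in> D" "?R x y" for x y
        using that c by (auto simp: prod_gorder_simps QH_le)
      note l = is_lub_prod_gorder[OF sub lub QH_refl QH_refl]
      have "s \<in> carrier (prod_gorder QH QH)" using is_lubD(1)[OF lub sub] .
      then have sc: "fst s \<in> ncpsu S T" "snd s \<in> ncpsu S T" by (auto simp: prod_gorder_simps QH_carrier)
      have p1: "pconv (net_filter ?R D) fst (fst s)" by (rule pconv_of_QH_is_lub[OF D c(1) mono(1) l(1)])
      have p2: "pconv (net_filter ?R D) snd (snd s)" by (rule pconv_of_QH_is_lub[OF D c(2) mono(2) l(2)])
      have ev: "eventually (\<lambda>x. fst x \<in> ncpsu S T) (net_filter ?R D)"
        "eventually (\<lambda>x. snd x \<in> ncpsu S T) (net_filter ?R D)"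
        using eventually_in_net[OF D] c by (auto elim!: eventually_mono)
      have "is_lub QH (cc QH r (fst s) (snd s)) ((\<lambda>x. cc QH r (fst x) (snd x)) ` D)"
      proof (rule QH_is_lub_of_pconv[OF D])
        show "pconv (net_filter ?R D) (\<lambda>x. cc QH r (fst x) (snd x)) (cc QH r (fst s) (snd s))"
          by (rule pconv_cc[OF tendsto_const p1 sc(1) ev(1) p2 sc(2) ev(2)])
      qed (use r c mono sc in \<open>auto intro!: ncpsu_cc dle_cc\<close>)
      then show "is_lub QH (case s of (a, b) \<Rightarrow> cc QH r a b) ((\<lambda>(a, b). cc QH r a b) ` D)"
        by (simp add: case_prod_unfold)
    qed
    show "scott_continuous (prod_gorder unit_interval QH) QH (\<lambda>(r, a). cc QH r a (base QH))"
      unfolding scott_continuous_def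
    proof (intro conjI allI impI)
      let ?P = "prod_gorder unit_interval QH"
      let ?R = "le (prod_gorder unit_interval QH)"
      show "(\<lambda>(r, a). cc QH r a (base QH)) \<in> carrier ?P \<rightarrow> carrier QH"
        by (auto simp: prod_gorder_simps unit_interval_simps QH_carrier ncpsu_cc ncpsu_zero)
      fix D s assume "directed ?P D \<and> is_lub ?P s D"
      then have dir: "directed ?P D" and lub: "is_lub ?P s D" by auto
      have sub: "D \<subseteq> carrier ?P" using dir by (simp add: directed_def)
      have urefl: "x \<sqsubseteq>\<^bsub>unit_interval\<^esub> x" for x by (simp add: unit_interval_simps)
      have D: "dnet ?R D"
        by (rule directed_prod_dnet[OF dir urefl]) (auto simp: unit_interval_simps intro: QH_refl QH_trans)
      have c: "fst x \<in> {0..1}" "snd x \<in> ncpsu S T" if "x \<in> D" for x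
        using that sub by (auto simp: prod_gorder_simps unit_interval_simps QH_carrier)
      have mono: "fst x \<le> fst y" "dle (snd x) (snd y)" if "x \<in> D" "y \<in> D" "?R x y" for x y
        using that c by (auto simp: prod_gorder_simps unit_interval_simps QH_le)
      note l = is_lub_prod_gorder[OF sub lub urefl QH_refl]
      have "s \<in> carrier ?P" using is_lubD(1)[OF lub sub] .
      then have sc: "fst s \<in> {0..1}" "snd s \<in> ncpsu S T"
        by (auto simp: prod_gorder_simps unit_interval_simps QH_carrier)
      have p1: "(fst \<longlongrightarrow> fst s) (net_filter ?R D)" by (rule unit_interval_lub_tendsto[OF D c(1) mono(1) l(1)])
      have p2: "pconv (net_filter ?R D) snd (snd s)" by (rule pconv_of_QH_is_lub[OF D c(2) mono(2) l(2)])
      have ev: "eventually (\<lambda>x. snd x \<in> ncpsu S T) (net_filter ?R D)"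
        using eventually_in_net[OF D] c by (auto elim!: eventually_mono)
      have "is_lub QH (cc QH (fst s) (snd s) (base QH)) ((\<lambda>x. cc QH (fst x) (snd x) (base QH)) ` D)"
      proof (rule QH_is_lub_of_pconv[OF D])
        show "pconv (net_filter ?R D) (\<lambda>x. cc QH (fst x) (snd x) (base QH)) (cc QH (fst s) (snd s) (base QH))"
          by (rule pconv_cc[OF p1 p2 sc(2) ev pconv_const ncpsu_zero]) (simp add: ncpsu_zero)
        show "cc QH (fst x) (snd x) (base QH) \<in> ncpsu S T" if "x \<in> D" for x
          using c[OF that] by (simp add: ncpsu_cc ncpsu_zero)
        show "cc QH (fst s) (snd s) (base QH) \<in> ncpsu S T"
          using sc by (simp add: ncpsu_cc ncpsu_zero)
        fix x y assume xy: "x \<in> D" "y \<in> D" "?R x y"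
        \<comment> \<open>The map is raised at fixed weight, and after that the weight at fixed
          map.\<close>
        have "dle (cc QH (fst x) (snd x) (base QH)) (cc QH (fst x) (snd y) (base QH))"
          using c[OF xy(1)] c[OF xy(2)] mono[OF xy] by (intro dle_cc ncpsu_zero dle_refl) auto
        moreover have "dle (cc QH (fst x) (snd y) (base QH)) (cc QH (fst y) (snd y) (base QH))"
          using c[OF xy(1)] c[OF xy(2)] mono[OF xy] by (intro dle_scale) auto
        ultimately show "dle (cc QH (fst x) (snd x) (base QH)) (cc QH (fst y) (snd y) (base QH))"
          by (rule dle_trans)
      qed
      then show "is_lub QH (case s of (r, a) \<Rightarrow> cc QH r a (base QH)) ((\<lambda>(r, a). cc QH r a (base QH)) ` D)"
        by (simp add: case_prod_unfold)
    qed
  qed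
qed

lemma cp_blocks:
  assumes "lin f" "cpos f" "S.blocks n X"
  shows "T.blocks n (\<lambda>k l. f (X k l))"
  using assms lin_closed[OF assms(1)] dleD[OF assms(2,3)]
  by (auto simp: S.blocks_def T.blocks_def T.bform_zero)

lemma diff_blocks:
  assumes "lin f" "lin g" "dle f g" "S.blocks n X"
  shows "T.blocks n (\<lambda>k l. g (X k l) \<ominus>\<^bsub>T\<^esub> f (X k l))"
  using assms lin_closed[OF assms(1)] lin_closed[OF assms(2)] dleD[OF assms(3,4)]
  by (auto simp: S.blocks_def T.blocks_def T.bform_minus)

end


section \<open>Composition\<close>

locale coords3 = ST: coords2 S J e cs T I d ct + TU: coords2 T I d ct U K m cu
  for S :: "'s star_algebra" and J :: "'j set" and e cs
    and T :: "'t star_algebra" and I :: "'i set" and d ct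
    and U :: "'u star_algebra" and K :: "'k set" and m cu
begin

sublocale SU: coords2 S J e cs U K m cu
  by (intro coords2.intro ST.S.coords_axioms TU.T.coords_axioms)

lemma compose_lin:
  assumes "ST.lin f" "TU.lin g"
  shows "SU.lin (compose (carrier S) g f)"
  using assms
  by (intro SU.linI) (simp_all add: compose_def ST.lin_closed TU.lin_closed ST.lin_add TU.lin_add ST.lin_smult TU.lin_smult)

lemma compose_dle_right:
  assumes "ST.lin f" "ST.cpos f" "TU.dle g g'"
  shows "SU.dle (compose (carrier S) g f) (compose (carrier S) g' f)"
proof -
  have "SU.dle (\<lambda>x. g (f x)) (\<lambda>x. g' (f x))"
    unfolding SU.dle_def using TU.dleD[OF assms(3) ST.cp_blocks[OF assms(1,2)]] by blast
  then show ?thesis by (rule SU.dle_cong) (simp_all add: compose_def)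
qed

text \<open>The difference \<open>f' - f\<close> keeps block matrices positive and \<open>g\<close>
  preserves this; linearity of \<open>g\<close> then splits the result.\<close>

lemma compose_dle_left:
  assumes "ST.lin f" "ST.lin f'" "ST.dle f f'" "TU.lin g" "TU.cpos g"
  shows "SU.dle (compose (carrier S) g f) (compose (carrier S) g f')"
proof -
  have "SU.dle (\<lambda>x. g (f x)) (\<lambda>x. g (f' x))"
    unfolding SU.dle_def
  proof (intro allI impI ballI)
    fix n X k v assume X: "ST.S.blocks n X" and k: "k \<in> K"
    have c: "f (X a b) \<in> carrier T" "f' (X a b) \<in> carrier T" if "a < n" "b < n" for a b
      using X that assms(1,2) by (auto simp: ST.S.blocks_def ST.lin_closed)
    have "0 \<le> TU.T.bform k n (\<lambda>a b. g (f' (X a b) \<ominus>\<^bsub>T\<^esub> f (X a b))) v"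
      using TU.dleD[OF assms(5) ST.diff_blocks[OF assms(1-3) X] k, of v] k by (simp add: TU.T.bform_zero)
    also have "\<dots> = TU.T.bform k n (\<lambda>a b. g (f' (X a b)) \<ominus>\<^bsub>U\<^esub> g (f (X a b))) v"
      using c assms(4) by (intro TU.T.bform_cong) (simp add: TU.lin_minus)
    also have "\<dots> = TU.T.bform k n (\<lambda>a b. g (f' (X a b))) v - TU.T.bform k n (\<lambda>a b. g (f (X a b))) v"
      using c assms(4) k by (intro TU.T.bform_minus) (auto simp: TU.lin_closed)
    finally show "TU.T.bform k n (\<lambda>a b. g (f (X a b))) v \<le> TU.T.bform k n (\<lambda>a b. g (f' (X a b))) v" by simp
  qed
  then show ?thesis by (rule SU.dle_cong) (simp_all add: compose_def)
qed

lemma compose_ncpsu: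
  assumes "f \<in> ncpsu S T" "g \<in> ncpsu T U"
  shows "compose (carrier S) g f \<in> ncpsu S U"
proof -
  note f = ST.ncpsuD[OF assms(1)] and g = TU.ncpsuD[OF assms(2)]
  let ?h = "compose (carrier S) g f"
  have l: "SU.lin ?h" by (rule compose_lin[OF f(1) g(1)])
  have "SU.dle (compose (carrier S) (\<lambda>_. \<zero>\<^bsub>U\<^esub>) f) ?h" by (rule compose_dle_right[OF f(1,3) g(3)])
  then have pos: "SU.cpos ?h" by (rule SU.dle_cong) (simp_all add: compose_def)
  show ?thesis
  proof (rule SU.ncpsuI[OF _ l pos])
    show "?h \<in> extensional (carrier S)" by (simp add: compose_def)
    show "normal_map S U ?h"
    proof (rule SU.normal_mapI[OF l pos])
      fix D s
      let ?F = "ST.S.SA_filter D"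
      assume D: "dnet (le ST.S.SA) D" "D \<subseteq> carrier ST.S.SA" "s \<in> carrier ST.S.SA"
        and lim: "ST.S.tconv ?F (\<lambda>x. x) s"
      have sc: "s \<in> carrier S" using ST.S.SA_carrier D(3) .
      have Dc: "x \<in> carrier S" if "x \<in> D" for x using that D(2) ST.S.SA_carrier by blast
      have mono: "ST.S.lea x y" if "x \<in> D" "y \<in> D" "x \<sqsubseteq>\<^bsub>ST.S.SA\<^esub> y" for x y
        using that D(2) ST.S.SA_le[of x y] by blast
      have 1: "ST.T.tconv ?F (\<lambda>x. f x) (f s)"
        by (rule ST.normal_net[OF f(1,3,2) D(1) _ mono sc lim]) (use D(2) in auto)
      have "TU.T.tconv ?F (\<lambda>x. g (f x)) (g (f s))"
      proof (rule TU.normal_net[OF g(1,3,2) D(1) _ _ _ 1])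
        show "f x \<in> carrier ST.T.SA" if "x \<in> D" for x using ST.dle_zero_SA[OF f(3,1)] that D(2) by blast
        show "ST.T.lea (f x) (f y)" if "x \<in> D" "y \<in> D" "x \<sqsubseteq>\<^bsub>ST.S.SA\<^esub> y" for x y
          using ST.dle_zero_mono[OF f(3,1) Dc Dc mono] that by blast
        show "f s \<in> carrier T" using ST.lin_closed[OF f(1) sc] .
      qed
      then have "TU.T.tconv ?F ?h (g (f s))"
        by (rule TU.T.tconv_cong)
          (use eventually_in_net[OF D(1)] Dc in \<open>auto simp: compose_def elim!: eventually_mono\<close>)
      then show "TU.T.tconv ?F ?h (?h s)" using sc by (simp add: compose_def)
    qed
    have "TU.T.lea (g (f \<one>\<^bsub>S\<^esub>)) (g \<one>\<^bsub>T\<^esub>)"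
      by (rule TU.dle_zero_mono[OF g(3,1) _ _ f(4)]) (simp_all add: ST.lin_closed[OF f(1)])
    then show "TU.T.lea (?h \<one>\<^bsub>S\<^esub>) \<one>\<^bsub>U\<^esub>" using g(4) by (auto simp: compose_def intro: TU.T.lea_trans)
  qed
qed

text \<open>Pointwise convergence of the outer maps contains convergence at the points
  \<open>f x\<close>.\<close>

lemma compose_right_scott:
  assumes "f \<in> ncpsu S T"
  shows "scott_continuous (Q_hom U T) (Q_hom U S) (\<lambda>g. compose (carrier S) g f)"
  unfolding scott_continuous_def
proof (intro conjI allI impI)
  note f = ST.ncpsuD[OF assms]
  show "(\<lambda>g. compose (carrier S) g f) \<in> carrier (Q_hom U T) \<rightarrow> carrier (Q_hom U S)"
    using compose_ncpsu[OF assms] by (auto simp: TU.QH_carrier SU.QH_carrier)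
  fix D s assume "directed (Q_hom U T) D \<and> is_lub (Q_hom U T) s D"
  then have dir: "directed (Q_hom U T) D" and lub: "is_lub (Q_hom U T) s D" by auto
  have sub: "D \<subseteq> ncpsu T U" using dir by (simp add: directed_def TU.QH_carrier)
  note D = TU.QH_directed_dnet[OF dir]
  have s: "s \<in> ncpsu T U" using is_lubD(1)[OF lub] sub by (simp add: TU.QH_carrier)
  have mono: "TU.dle g g'" if "g \<in> D" "g' \<in> D" "g \<sqsubseteq>\<^bsub>Q_hom U T\<^esub> g'" for g g'
    using that sub TU.QH_le[of g g'] by blast
  have p: "TU.pconv (net_filter (le (Q_hom U T)) D) (\<lambda>g. g) s"
    by (rule TU.pconv_of_QH_is_lub[OF D]) (use sub mono lub in auto)
  show "is_lub (Q_hom U S) (compose (carrier S) s f) ((\<lambda>g. compose (carrier S) g f) ` D)"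
  proof (rule SU.QH_is_lub_of_pconv[OF D])
    show "SU.pconv (net_filter (le (Q_hom U T)) D) (\<lambda>g. compose (carrier S) g f) (compose (carrier S) s f)"
      using p ST.lin_closed[OF f(1)] by (simp add: SU.pconv_def TU.pconv_def compose_def)
  qed (use compose_ncpsu[OF assms] compose_dle_right[OF f(1,3)] sub s mono in auto)
qed

lemma compose_right_linear:
  assumes "f \<in> ncpsu S T"
  shows "kegelspitze_linear (Q_hom U T) (Q_hom U S) (\<lambda>g. compose (carrier S) g f)"
  unfolding kegelspitze_linear_def
proof (intro conjI ballI)
  note f = ST.ncpsuD[OF assms]
  show "(\<lambda>g. compose (carrier S) g f) \<in> carrier (Q_hom U T) \<rightarrow> carrier (Q_hom U S)"
    using compose_ncpsu[OF assms] by (auto simp: TU.QH_carrier SU.QH_carrier)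
  show "compose (carrier S) (base (Q_hom U T)) f = base (Q_hom U S)"
    using ST.lin_closed[OF f(1)] by (auto simp: TU.QH_base SU.QH_base compose_def)
  fix r a b
  show "compose (carrier S) (cc (Q_hom U T) r a b) f =
      cc (Q_hom U S) r (compose (carrier S) a f) (compose (carrier S) b f)"
    using ST.lin_closed[OF f(1)] by (auto simp: TU.QH_cc SU.QH_cc compose_def)
qed

text \<open>The outer map has to carry limits to limits. For positive \<open>p\<close> the net
  \<open>\<Phi> a p\<close> is monotone and normality of \<open>g\<close> applies; linearity does
  the rest.\<close>

lemma pconv_compose_left:
  assumes g: "g \<in> ncpsu T U" and D: "dnet R D" and \<Phi>: "\<And>a. a \<in> D \<Longrightarrow> \<Phi> a \<in> ncpsu S T"
    and mono: "\<And>a b. a \<in> D \<Longrightarrow> b \<in> D \<Longrightarrow> R a b \<Longrightarrow> ST.dle (\<Phi> a) (\<Phi> b)"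
    and f: "f \<in> ncpsu S T" and lim: "ST.pconv (net_filter R D) \<Phi> f"
  shows "SU.pconv (net_filter R D) (\<lambda>a. compose (carrier S) g (\<Phi> a)) (compose (carrier S) g f)"
proof -
  let ?F = "net_filter R D"
  note g' = TU.ncpsuD[OF g] and f' = ST.ncpsuD[OF f]
  have \<Phi>l: "ST.lin (\<Phi> a)" "ST.cpos (\<Phi> a)" if "a \<in> D" for a using ST.ncpsuD[OF \<Phi>[OF that]] by auto
  have evc: "eventually (\<lambda>a. g (\<Phi> a x) \<in> carrier U) ?F" if "x \<in> carrier S" for x
    using eventually_in_net[OF D]
    by (rule eventually_mono) (use that \<Phi>l ST.lin_closed TU.lin_closed[OF g'(1)] in auto)
  have "TU.T.tconv ?F (\<lambda>a. g (\<Phi> a x)) (g (f x))" if "x \<in> carrier S" for x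
    using that
  proof (induction rule: ST.S.positive_span_induct)
    case (positive p)
    have pSA: "p \<in> carrier ST.S.SA" using ST.S.lea_zero_SA positive .
    show ?case
    proof (rule TU.normal_net[OF g'(1,3,2) D])
      show "\<Phi> a p \<in> carrier ST.T.SA" if "a \<in> D" for a using ST.dle_zero_SA[OF \<Phi>l(2,1)[OF that] pSA] .
      show "ST.T.lea (\<Phi> a p) (\<Phi> b p)" if "a \<in> D" "b \<in> D" "R a b" for a b
        using ST.dle_positive[OF mono[OF that] positive] .
      show "f p \<in> carrier T" using ST.lin_closed[OF f'(1) positive(1)] .
      show "ST.T.tconv ?F (\<lambda>a. \<Phi> a p) (f p)" using lim positive(1) by (simp add: ST.pconv_def)
    qed
  next
    case (add x y)
    have "TU.T.tconv ?F (\<lambda>a. g (\<Phi> a x) \<oplus>\<^bsub>U\<^esub> g (\<Phi> a y)) (g (f x) \<oplus>\<^bsub>U\<^esub> g (f y))"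
      using evc add f'(1) g'(1) by (intro TU.T.tconv_add) (auto simp: ST.lin_closed TU.lin_closed)
    then have "TU.T.tconv ?F (\<lambda>a. g (\<Phi> a (x \<oplus>\<^bsub>S\<^esub> y))) (g (f x) \<oplus>\<^bsub>U\<^esub> g (f y))"
      by (rule TU.T.tconv_cong) (use eventually_in_net[OF D] add \<Phi>l g'(1) in
          \<open>auto simp: ST.lin_add TU.lin_add ST.lin_closed elim!: eventually_mono\<close>)
    then show ?case using add f'(1) g'(1) by (simp add: ST.lin_add TU.lin_add ST.lin_closed)
  next
    case (smult c x)
    have "TU.T.tconv ?F (\<lambda>a. c \<odot>\<^bsub>U\<^esub> g (\<Phi> a x)) (c \<odot>\<^bsub>U\<^esub> g (f x))"
      using evc smult f'(1) g'(1) by (intro TU.T.tconv_smult tendsto_const) (auto simp: ST.lin_closed TU.lin_closed)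
    then have "TU.T.tconv ?F (\<lambda>a. g (\<Phi> a (c \<odot>\<^bsub>S\<^esub> x))) (c \<odot>\<^bsub>U\<^esub> g (f x))"
      by (rule TU.T.tconv_cong) (use eventually_in_net[OF D] smult \<Phi>l g'(1) in
          \<open>auto simp: ST.lin_smult TU.lin_smult ST.lin_closed elim!: eventually_mono\<close>)
    then show ?case using smult f'(1) g'(1) by (simp add: ST.lin_smult TU.lin_smult ST.lin_closed)
  qed
  then show ?thesis by (simp add: SU.pconv_def compose_def)
qed

lemma compose_left_scott:
  assumes "g \<in> ncpsu T U"
  shows "scott_continuous (Q_hom T S) (Q_hom U S) (\<lambda>f. compose (carrier S) g f)"
  unfolding scott_continuous_def
proof (intro conjI allI impI)
  note g = TU.ncpsuD[OF assms]
  show "(\<lambda>f. compose (carrier S) g f) \<in> carrier (Q_hom T S) \<rightarrow> carrier (Q_hom U S)"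
    using compose_ncpsu[OF _ assms] by (auto simp: ST.QH_carrier SU.QH_carrier)
  fix D s assume "directed (Q_hom T S) D \<and> is_lub (Q_hom T S) s D"
  then have dir: "directed (Q_hom T S) D" and lub: "is_lub (Q_hom T S) s D" by auto
  have sub: "D \<subseteq> ncpsu S T" using dir by (simp add: directed_def ST.QH_carrier)
  note D = ST.QH_directed_dnet[OF dir]
  have s: "s \<in> ncpsu S T" using is_lubD(1)[OF lub] sub by (simp add: ST.QH_carrier)
  have mono: "ST.dle f f'" if "f \<in> D" "f' \<in> D" "f \<sqsubseteq>\<^bsub>Q_hom T S\<^esub> f'" for f f'
    using that sub ST.QH_le[of f f'] by blast
  have p: "ST.pconv (net_filter (le (Q_hom T S)) D) (\<lambda>f. f) s"
    by (rule ST.pconv_of_QH_is_lub[OF D]) (use sub mono lub in auto)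
  show "is_lub (Q_hom U S) (compose (carrier S) g s) ((\<lambda>f. compose (carrier S) g f) ` D)"
  proof (rule SU.QH_is_lub_of_pconv[OF D])
    show "SU.pconv (net_filter (le (Q_hom T S)) D) (\<lambda>f. compose (carrier S) g f) (compose (carrier S) g s)"
      by (rule pconv_compose_left[OF assms D _ mono s p]) (use sub in auto)
    show "SU.dle (compose (carrier S) g f) (compose (carrier S) g f')"
      if "f \<in> D" "f' \<in> D" "f \<sqsubseteq>\<^bsub>Q_hom T S\<^esub> f'" for f f'
      using compose_dle_left[OF _ _ mono[OF that] g(1,3)] that sub ST.ncpsuD(1) by blast
  qed (use compose_ncpsu[OF _ assms] sub s in auto)
qed

lemma compose_left_linear:
  assumes "g \<in> ncpsu T U"
  shows "kegelspitze_linear (Q_hom T S) (Q_hom U S) (\<lambda>f. compose (carrier S) g f)"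
  unfolding kegelspitze_linear_def
proof (intro conjI ballI)
  note g = TU.ncpsuD[OF assms]
  show "(\<lambda>f. compose (carrier S) g f) \<in> carrier (Q_hom T S) \<rightarrow> carrier (Q_hom U S)"
    using compose_ncpsu[OF _ assms] by (auto simp: ST.QH_carrier SU.QH_carrier)
  show "compose (carrier S) g (base (Q_hom T S)) = base (Q_hom U S)"
    using TU.lin_zero[OF g(1)] by (auto simp: ST.QH_base SU.QH_base compose_def)
  fix r a b assume ab: "a \<in> carrier (Q_hom T S)" "b \<in> carrier (Q_hom T S)"
  then have "ST.lin a" "ST.lin b" using ST.ncpsuD(1) by (auto simp: ST.QH_carrier)
  then show "compose (carrier S) g (cc (Q_hom T S) r a b) =
      cc (Q_hom U S) r (compose (carrier S) g a) (compose (carrier S) g b)"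
    using g(1) by (auto simp: ST.QH_cc SU.QH_cc compose_def TU.lin_add TU.lin_smult ST.lin_closed)
qed

end


section \<open>Compression to finitely many matrix blocks\<close>

text \<open>The form of this kernel at \<open>z\<close> is the form of \<open>q\<close> at the
  combination of the vectors \<open>y p\<close> with coefficients \<open>z\<close>.\<close>

lemma psd_pullback:
  assumes "psd K q"
  shows "psd M (\<lambda>p r. sesq K q (y p) (y r))"
  unfolding psd_def
proof
  fix z
  have "sesq M (\<lambda>p r. sesq K q (y p) (y r)) z z
      = sesq K q (\<lambda>k. \<Sum>p\<in>M. z p * y p k) (\<lambda>k. \<Sum>p\<in>M. z p * y p k)"
    unfolding sesq_sum_left sesq_sum_right sesq_scale_left sesq_scale_right
    by (simp add: sesq_def[of M] sum_distrib_left mult_ac)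
  then show "0 \<le> sesq M (\<lambda>p r. sesq K q (y p) (y r)) z z" using psdD[OF assms] by simp
qed

context coords
begin

text \<open>Multiplication by the central projection onto the blocks in \<open>F\<close>. Indices
  outside \<open>I\<close> are allowed in \<open>F\<close>, so that \<open>UNIV\<close> gives the
  identity.\<close>

definition cut :: "'i set \<Rightarrow> 'a \<Rightarrow> 'a" where
  "cut F x = (SOME y. y \<in> carrier A \<and> (\<forall>i\<in>I. \<forall>a<d i. \<forall>b<d i. co i y a b = (if i \<in> F then co i x a b else 0)))"

lemma cut:
  assumes "x \<in> carrier A"
  shows cut_closed: "cut F x \<in> carrier A"
    and sf_cut: "i \<in> I \<Longrightarrow> sf i (cut F x) v w = (if i \<in> F then sf i x v w else 0)"
proof -
  obtain C where C: "\<And>i v. i \<in> I \<Longrightarrow> cmod (sesq {..<d i} (co i x) v v) \<le> C * sqsum {..<d i} v"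
    using co_bounded[OF assms] by blast
  have "cmod (sesq {..<d i} (\<lambda>a b. if i \<in> F then co i x a b else 0) v v) \<le> max C 0 * sqsum {..<d i} v"
    if i: "i \<in> I" for i v
  proof -
    have "C * sqsum {..<d i} v \<le> max C 0 * sqsum {..<d i} v"
      by (intro mult_right_mono sqsum_nonneg) simp
    moreover have "0 \<le> max C 0 * sqsum {..<d i} v" by (simp add: sqsum_nonneg)
    moreover have "sesq {..<d i} (\<lambda>a b. if i \<in> F then co i x a b else 0) v v
        = (if i \<in> F then sesq {..<d i} (co i x) v v else 0)"
      by (simp add: sesq_def)
    ultimately show ?thesis using C[OF i, of v] by (auto intro: order_trans)
  qed
  then have "\<exists>y\<in>carrier A. \<forall>i\<in>I. \<forall>a<d i. \<forall>b<d i. co i y a b = (if i \<in> F then co i x a b else 0)"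
    by (intro co_surj[where C = "max C 0"]) blast
  then have "\<exists>y. y \<in> carrier A \<and> (\<forall>i\<in>I. \<forall>a<d i. \<forall>b<d i. co i y a b = (if i \<in> F then co i x a b else 0))"
    by blast
  from someI_ex[OF this]
  have *: "cut F x \<in> carrier A"
    "\<forall>i\<in>I. \<forall>a<d i. \<forall>b<d i. co i (cut F x) a b = (if i \<in> F then co i x a b else 0)"
    unfolding cut_def by simp_all
  show "cut F x \<in> carrier A" by fact
  show "sf i (cut F x) v w = (if i \<in> F then sf i x v w else 0)" if "i \<in> I"
    unfolding sf_def sesq_def using *(2) that by simp
qed

lemma cut_add: "x \<in> carrier A \<Longrightarrow> y \<in> carrier A \<Longrightarrow> cut F (x \<oplus> y) = cut F x \<oplus> cut F y"
  by (intro sf_eqI) (simp_all add: cut_closed sf_cut sf_add)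

lemma cut_smult: "x \<in> carrier A \<Longrightarrow> cut F (c \<odot> x) = c \<odot> cut F x"
  by (intro sf_eqI) (simp_all add: cut_closed sf_cut sf_smult)

lemma cut_UNIV: "x \<in> carrier A \<Longrightarrow> cut UNIV x = x"
  by (intro sf_eqI) (simp_all add: cut_closed sf_cut)

lemma cut_empty: "x \<in> carrier A \<Longrightarrow> cut {} x = \<zero>"
  by (intro sf_eqI) (simp_all add: cut_closed sf_cut sf_zero)

lemma cut_disjoint_Un:
  "x \<in> carrier A \<Longrightarrow> F \<inter> G = {} \<Longrightarrow> cut (F \<union> G) x = cut F x \<oplus> cut G x"
  by (intro sf_eqI) (auto simp: cut_closed sf_cut sf_add)

lemma cut_eq: "x \<in> carrier A \<Longrightarrow> F \<inter> I = G \<inter> I \<Longrightarrow> cut F x = cut G x"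
  by (intro sf_eqI) (auto simp: cut_closed sf_cut)

lemma bform_cut:
  assumes "\<And>k l. k < n \<Longrightarrow> l < n \<Longrightarrow> X k l \<in> carrier A" "i \<in> I"
  shows "bform i n (\<lambda>k l. cut F (X k l)) v = (if i \<in> F then bform i n X v else 0)"
  using assms by (simp add: bform_def sf_cut)

lemma blocks_cut: "blocks n X \<Longrightarrow> blocks n (\<lambda>k l. cut F (X k l))"
  by (simp add: blocks_def cut_closed bform_cut)

text \<open>Makes the compressions of a morphism composites of morphisms. Normality holds because
  each entry is either kept or replaced by zero.\<close>

lemma cut_ncpsu: "restrict (cut F) (carrier A) \<in> ncpsu A A"
proof -
  interpret AA: coords2 A I d co A I d co by (intro coords2.intro coords_axioms)
  let ?h = "restrict (cut F) (carrier A)"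
  have l: "AA.lin ?h" by (rule AA.linI) (simp_all add: cut_closed cut_add cut_smult)
  have "AA.cpos (cut F)"
    unfolding AA.dle_def
    using blocks_cut by (auto simp: bform_zero blocks_def)
  then have pos: "AA.cpos ?h" by (rule AA.dle_cong) simp_all
  show ?thesis
  proof (rule AA.ncpsuI[OF _ l pos])
    show "normal_map A A ?h"
    proof (rule AA.normal_mapI[OF l pos])
      fix D s assume D: "dnet (le SA) D" "D \<subseteq> carrier SA" "s \<in> carrier SA" "tconv (SA_filter D) (\<lambda>x. x) s"
      have sc: "s \<in> carrier A" using SA_carrier D(3) .
      have "tconv (SA_filter D) (cut F) (cut F s)"
        unfolding tconv_def
      proof (intro ballI allI)
        fix i v w assume i: "i \<in> I"
        have "((\<lambda>x. if i \<in> F then sf i x v w else 0) \<longlongrightarrow> sf i (cut F s) v w) (SA_filter D)"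
          using tconvD[OF D(4) i] i sc by (simp add: sf_cut)
        moreover have "eventually (\<lambda>x. (if i \<in> F then sf i x v w else 0) = sf i (cut F x) v w) (SA_filter D)"
          using eventually_in_net[OF D(1)]
          by (rule eventually_mono) (use D(2) SA_carrier i in \<open>auto simp: sf_cut subset_iff\<close>)
        ultimately show "((\<lambda>x. sf i (cut F x) v w) \<longlongrightarrow> sf i (cut F s) v w) (SA_filter D)"
          by (rule Lim_transform_eventually)
      qed
      then have "tconv (SA_filter D) ?h (cut F s)"
      proof (rule tconv_cong)
        show "eventually (\<lambda>x. cut F x = ?h x) (SA_filter D)"
          using eventually_in_net[OF D(1)]
          by (rule eventually_mono) (use D(2) SA_carrier in \<open>auto simp: subset_iff\<close>)
      qed
      then show "tconv (SA_filter D) ?h (?h s)" using sc by simp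
    qed
    show "lea (?h \<one>) \<one>"
      by (auto simp: lea_def sf_cut sf_one complex_nonneg_iff sqsum_nonneg)
  qed simp
qed

definition matrix_unit :: "'i \<Rightarrow> nat \<Rightarrow> nat \<Rightarrow> 'a" where
  "matrix_unit j a b = (SOME y. y \<in> carrier A \<and>
     (\<forall>i\<in>I. \<forall>a'<d i. \<forall>b'<d i. co i y a' b' = (if i = j \<and> a' = a \<and> b' = b then 1 else 0)))"

lemma matrix_unit:
  assumes j: "j \<in> I" "a < d j" "b < d j"
  shows matrix_unit_closed: "matrix_unit j a b \<in> carrier A"
    and sf_matrix_unit: "i \<in> I \<Longrightarrow> sf i (matrix_unit j a b) v w = (if i = j then cnj (v a) * w b else 0)"
proof -
  let ?m = "\<lambda>i a' b'. if i = j \<and> a' = a \<and> b' = b then 1 else (0::complex)"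
  have ev: "sesq {..<d i} (?m i) v w = (if i = j then cnj (v a) * w b else 0)" for i v w
  proof (cases "i = j")
    case True
    have "sesq {..<d i} (?m i) v w = (\<Sum>k<d i. \<Sum>l<d i. if l = b then (if k = a then cnj (v a) * w b else 0) else 0)"
      unfolding sesq_def using True by (intro sum.cong refl) auto
    then show ?thesis using True j by simp
  qed (simp add: sesq_def)
  have "cmod (sesq {..<d i} (?m i) v v) \<le> 1 * sqsum {..<d i} v" for i v
  proof (cases "i = j")
    case True
    have "(cmod (v c))\<^sup>2 \<le> sqsum {..<d i} v" if "c < d j" for c
      unfolding sqsum_def using that True by (intro member_le_sum) auto
    from this[OF j(2)] this[OF j(3)]
    have "2 * cmod (v a) * cmod (v b) \<le> 2 * sqsum {..<d i} v"
      using sum_squares_bound[of "cmod (v a)" "cmod (v b)"] by linarith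
    then show ?thesis unfolding ev using True by (simp add: norm_mult)
  next
    case False
    then show ?thesis unfolding ev by (simp add: sqsum_nonneg)
  qed
  then have "\<exists>y\<in>carrier A. \<forall>i\<in>I. \<forall>a'<d i. \<forall>b'<d i. co i y a' b' = ?m i a' b'"
    by (intro co_surj[where C = 1]) blast
  then have "\<exists>y. y \<in> carrier A \<and> (\<forall>i\<in>I. \<forall>a'<d i. \<forall>b'<d i. co i y a' b' = ?m i a' b')" by blast
  from someI_ex[OF this]
  have *: "matrix_unit j a b \<in> carrier A"
    "\<forall>i\<in>I. \<forall>a'<d i. \<forall>b'<d i. co i (matrix_unit j a b) a' b' = ?m i a' b'"
    unfolding matrix_unit_def by simp_all
  show "matrix_unit j a b \<in> carrier A" by fact
  show "sf i (matrix_unit j a b) v w = (if i = j then cnj (v a) * w b else 0)" if "i \<in> I"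
    unfolding sf_def ev[symmetric] by (rule sesq_cong) (use * that in auto)
qed

text \<open>The form is the squared modulus of the sum of the numbers \<open>v k k\<close>. This
  positive matrix is the one on which Choi's theorem tests a map.\<close>

lemma blocks_matrix_unit:
  assumes j: "j \<in> I"
  shows "blocks (d j) (matrix_unit j)"
  unfolding blocks_def
proof (intro conjI allI impI ballI)
  show "matrix_unit j k l \<in> carrier A" if "k < d j" "l < d j" for k l
    using matrix_unit_closed j that by blast
  fix i v assume i: "i \<in> I"
  show "0 \<le> bform i (d j) (matrix_unit j) v"
  proof (cases "i = j")
    case True
    have "bform i (d j) (matrix_unit j) v = (\<Sum>k<d j. \<Sum>l<d j. cnj (v k k) * v l l)"
      unfolding bform_def using True i by (intro sum.cong refl) (simp add: sf_matrix_unit)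
    also have "\<dots> = cnj (\<Sum>k<d j. v k k) * (\<Sum>l<d j. v l l)" by (simp add: sum_product)
    also have "\<dots> = of_real ((cmod (\<Sum>k<d j. v k k))\<^sup>2)" by (metis complex_norm_square mult.commute)
    finally show ?thesis by (simp add: complex_nonneg_iff)
  next
    case False
    then have "bform i (d j) (matrix_unit j) v = 0"
      unfolding bform_def using i j by (simp add: sf_matrix_unit)
    then show ?thesis by simp
  qed
qed

text \<open>A finite expansion: on one block a linear map is determined by its values at finitely
  many matrix units.\<close>

lemma cut_single:
  assumes j: "j \<in> I" and x: "x \<in> carrier A"
  shows "cut {j} x = (\<Oplus>p\<in>{..<d j} \<times> {..<d j}. co j x (fst p) (snd p) \<odot> matrix_unit j (fst p) (snd p))"
    (is "_ = ?rhs")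
proof (rule sf_eqI)
  have c: "(\<lambda>p. co j x (fst p) (snd p) \<odot> matrix_unit j (fst p) (snd p)) \<in> {..<d j} \<times> {..<d j} \<rightarrow> carrier A"
    using matrix_unit_closed j by auto
  show "cut {j} x \<in> carrier A" using x by (rule cut_closed)
  show "?rhs \<in> carrier A"
    using c by (rule finsum_closed')
  fix i v assume i: "i \<in> I"
  have "sf i ?rhs v v
      = (\<Sum>p\<in>{..<d j} \<times> {..<d j}. sf i (co j x (fst p) (snd p) \<odot> matrix_unit j (fst p) (snd p)) v v)"
    by (rule sf_finsum[OF _ c i]) simp
  also have "\<dots> = (\<Sum>a<d j. \<Sum>b<d j. co j x a b * (if i = j then cnj (v a) * v b else 0))"
    unfolding sum.cartesian_product
    using i j by (intro sum.cong refl) (auto simp: sf_smult matrix_unit_closed sf_matrix_unit)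
  also have "\<dots> = sf i (cut {j} x) v v"
    using i x by (auto simp: sf_cut) (simp add: sf_def sesq_def mult_ac)
  finally show "sf i (cut {j} x) v v = sf i ?rhs v v" ..
qed

end

context coords2
begin

lemma lin_finsum:
  assumes h: "lin h" and "finite M" "f \<in> M \<rightarrow> carrier S"
  shows "h (\<Oplus>\<^bsub>S\<^esub>m\<in>M. f m) = (\<Oplus>\<^bsub>T\<^esub>m\<in>M. h (f m))"
  using assms(2,3)
proof (induction M rule: finite_induct)
  case empty
  then show ?case using lin_zero[OF h] by simp
next
  case (insert m M)
  then have f: "f \<in> M \<rightarrow> carrier S" "f m \<in> carrier S" by auto
  then have "(\<lambda>m. h (f m)) \<in> M \<rightarrow> carrier T" "h (f m) \<in> carrier T" using lin_closed[OF h] by auto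
  then show ?case using insert f by (simp add: lin_add[OF h] S.finsum_closed')
qed

section \<open>Choi matrices of a map between two blocks\<close>

definition choi :: "'i \<Rightarrow> 'j \<Rightarrow> ('s \<Rightarrow> 't) \<Rightarrow> nat \<times> nat \<Rightarrow> nat \<times> nat \<Rightarrow> complex" where
  "choi i j h = (\<lambda>(a, \<alpha>) (b, \<beta>). ct i (h (S.matrix_unit j a b)) \<alpha> \<beta>)"

abbreviation choi_dom :: "'i \<Rightarrow> 'j \<Rightarrow> (nat \<times> nat) set" where
  "choi_dom i j \<equiv> {..<e j} \<times> {..<d i}"

lemma sesq_choi:
  "sesq (choi_dom i j) (choi i j h) v v = T.bform i (e j) (\<lambda>a b. h (S.matrix_unit j a b)) (\<lambda>a \<alpha>. v (a, \<alpha>))"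
  unfolding sesq_Times T.bform_def T.sf_def choi_def by simp

text \<open>The matrix units of a block form one positive matrix, on which the order on maps can be
  evaluated.\<close>

lemma choi_diff_psd:
  assumes "dle f g" "i \<in> I" "j \<in> J"
  shows "psd (choi_dom i j) (\<lambda>p q. choi i j g p q - choi i j f p q)"
  unfolding psd_def sesq_kernel_diff sesq_choi
  using dleD[OF assms(1) S.blocks_matrix_unit[OF assms(3)] assms(2)] by simp

lemma choi_psd:
  assumes "cpos f" "i \<in> I" "j \<in> J"
  shows "psd (choi_dom i j) (choi i j f)"
  unfolding psd_def sesq_choi
  using dleD[OF assms(1) S.blocks_matrix_unit[OF assms(3)] assms(2)] by (simp add: T.bform_zero assms(2))

text \<open>Choi's theorem for a single pair of blocks: the form of \<open>h\<close> on a positive matrix is the sum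
  of the entrywise product of two positive semidefinite kernels.\<close>

lemma bform_cut_single_nonneg:
  assumes h: "lin h" and i: "i \<in> I" and j: "j \<in> J"
    and psd: "psd (choi_dom i j) (choi i j h)" and X: "S.blocks n X"
  shows "0 \<le> T.bform i n (\<lambda>k l. h (S.cut {j} (X k l))) v"
proof -
  let ?E = "S.matrix_unit j"
  have Ec: "?E a b \<in> carrier S" if "a < e j" "b < e j" for a b using S.matrix_unit_closed[OF j that] .
  have Xc: "X k l \<in> carrier S" if "k < n" "l < n" for k l using X that by (simp add: S.blocks_def)
  define P where "P = (\<lambda>(k, a) (l, b). cs j (X k l) a b)"
  \<comment> \<open>The vector \<open>y (k, a)\<close> carries \<open>v k\<close> in slot
    \<open>a\<close>, so \<open>H\<close> evaluates \<open>h\<close> at a matrix unit between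
    \<open>v k\<close> and \<open>v l\<close>.\<close>
  define y :: "nat \<times> nat \<Rightarrow> nat \<times> nat \<Rightarrow> complex"
    where "y = (\<lambda>(k, a) (a', \<alpha>). if a' = a then v k \<alpha> else 0)"
  define H where "H = (\<lambda>p q. sesq (choi_dom i j) (choi i j h) (y p) (y q))"
  have P: "psd ({..<n} \<times> {..<e j}) P"
  proof -
    have "S.block_nonneg n X" using X by (simp add: S.blocks_def S.block_nonneg_def)
    then show ?thesis using j unfolding P_def S.block_nonneg_iff_psd by blast
  qed
  have H: "psd ({..<n} \<times> {..<e j}) H" unfolding H_def using psd by (rule psd_pullback)
  have Hv: "H (k, a) (l, b) = T.sf i (h (?E a b)) (v k) (v l)" if "a < e j" "b < e j" for k l a b
  proof -
    have "H (k, a) (l, b) = (\<Sum>a'<e j. \<Sum>b'<e j. if b' = b then if a' = a then T.sf i (h (?E a b)) (v k) (v l) else 0 else 0)"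
      unfolding H_def sesq_Times
      by (intro sum.cong refl) (auto simp: y_def choi_def T.sf_def sesq_def)
    then show ?thesis using that by simp
  qed
  have "T.bform i n (\<lambda>k l. h (S.cut {j} (X k l))) v =
      (\<Sum>k<n. \<Sum>l<n. \<Sum>a<e j. \<Sum>b<e j. P (k, a) (l, b) * H (k, a) (l, b))"
    unfolding T.bform_def
  proof (intro sum.cong refl)
    fix k l assume "k \<in> {..<n}" "l \<in> {..<n}"
    then have x: "X k l \<in> carrier S" using Xc by simp
    let ?f = "\<lambda>p. cs j (X k l) (fst p) (snd p) \<odot>\<^bsub>S\<^esub> ?E (fst p) (snd p)"
    have c: "?f \<in> {..<e j} \<times> {..<e j} \<rightarrow> carrier S" using Ec by auto
    have "h (S.cut {j} (X k l)) = (\<Oplus>\<^bsub>T\<^esub>p\<in>{..<e j} \<times> {..<e j}. h (?f p))"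
      unfolding S.cut_single[OF j x] by (rule lin_finsum[OF h _ c]) simp
    then have "T.sf i (h (S.cut {j} (X k l))) (v k) (v l)
        = (\<Sum>p\<in>{..<e j} \<times> {..<e j}. T.sf i (h (?f p)) (v k) (v l))"
      using c lin_closed[OF h] by (simp only:) (rule T.sf_finsum, auto simp: i)
    also have "\<dots> = (\<Sum>a<e j. \<Sum>b<e j. P (k, a) (l, b) * H (k, a) (l, b))"
      unfolding sum.cartesian_product
      using Ec i by (intro sum.cong refl) (auto simp: lin_smult[OF h] lin_closed[OF h] T.sf_smult Hv P_def)
    finally show "T.sf i (h (S.cut {j} (X k l))) (v k) (v l) =
        (\<Sum>a<e j. \<Sum>b<e j. P (k, a) (l, b) * H (k, a) (l, b))" .
  qed
  \<comment> \<open>Regroups the indices into the pairs \<open>(k, a)\<close> and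
    \<open>(l, b)\<close> on which \<open>P\<close> and \<open>H\<close> are kernels.\<close>
  also have "\<dots> = (\<Sum>k<n. \<Sum>a<e j. \<Sum>l<n. \<Sum>b<e j. P (k, a) (l, b) * H (k, a) (l, b))"
    by (rule sum.cong[OF refl], rule sum.swap)
  also have "\<dots> = (\<Sum>p\<in>{..<n} \<times> {..<e j}. \<Sum>q\<in>{..<n} \<times> {..<e j}. P p q * H p q)"
    by (simp add: sum.cartesian_product')
  also have "\<dots> \<ge> 0" by (rule psd_Schur_product_nonneg[OF _ P H]) simp
  finally show ?thesis .
qed

text \<open>A cut to disjoint blocks is a sum of cuts, so \<open>h\<close> splits into contributions
  of single blocks.\<close>

lemma bform_cut_finite_nonneg:
  assumes h: "lin h" and i: "i \<in> I" and F: "finite F" "F \<subseteq> J"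
    and psd: "\<And>j. j \<in> F \<Longrightarrow> psd (choi_dom i j) (choi i j h)" and X: "S.blocks n X"
  shows "0 \<le> T.bform i n (\<lambda>k l. h (S.cut F (X k l))) v"
  using F psd
proof (induction F rule: finite_induct)
  case empty
  have "T.bform i n (\<lambda>k l. h (S.cut {} (X k l))) v = T.bform i n (\<lambda>_ _. \<zero>\<^bsub>T\<^esub>) v"
    using X by (intro T.bform_cong) (simp add: S.cut_empty S.blocks_def lin_zero[OF h])
  then show ?case using i by (simp add: T.bform_zero)
next
  case (insert j F)
  have Xc: "X k l \<in> carrier S" if "k < n" "l < n" for k l using X that by (simp add: S.blocks_def)
  have "T.bform i n (\<lambda>k l. h (S.cut (insert j F) (X k l))) v
      = T.bform i n (\<lambda>k l. h (S.cut {j} (X k l)) \<oplus>\<^bsub>T\<^esub> h (S.cut F (X k l))) v"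
  proof (rule T.bform_cong)
    fix k l assume kl: "k < n" "l < n"
    show "h (S.cut (insert j F) (X k l)) = h (S.cut {j} (X k l)) \<oplus>\<^bsub>T\<^esub> h (S.cut F (X k l))"
      using S.cut_disjoint_Un[OF Xc[OF kl], of "{j}" F] insert.hyps Xc[OF kl]
      by (simp add: lin_add[OF h] S.cut_closed)
  qed
  also have "\<dots> = T.bform i n (\<lambda>k l. h (S.cut {j} (X k l))) v + T.bform i n (\<lambda>k l. h (S.cut F (X k l))) v"
    using Xc i by (intro T.bform_add) (simp_all add: lin_closed[OF h] S.cut_closed)
  also have "\<dots> \<ge> 0"
    using insert by (intro add_nonneg_nonneg bform_cut_single_nonneg[OF h i _ _ X]) auto
  finally show ?case .
qed

section \<open>Compressions of maps and the approximants from way below\<close>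

definition compress :: "'j set \<Rightarrow> 'i set \<Rightarrow> ('s \<Rightarrow> 't) \<Rightarrow> 's \<Rightarrow> 't" where
  "compress F G f = (\<lambda>x\<in>carrier S. T.cut G (f (S.cut F x)))"

lemma compress_ncpsu:
  assumes "f \<in> ncpsu S T"
  shows "compress F G f \<in> ncpsu S T"
proof -
  interpret SST: coords3 S J e cs S J e cs T I d ct
    by (intro coords3.intro coords2.intro S.coords_axioms T.coords_axioms)
  interpret STT: coords3 S J e cs T I d ct T I d ct
    by (intro coords3.intro coords2.intro S.coords_axioms T.coords_axioms)
  have "compose (carrier S) (restrict (T.cut G) (carrier T))
      (compose (carrier S) f (restrict (S.cut F) (carrier S))) \<in> ncpsu S T"
    by (intro STT.compose_ncpsu SST.compose_ncpsu S.cut_ncpsu T.cut_ncpsu assms)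
  also have "compose (carrier S) (restrict (T.cut G) (carrier T))
      (compose (carrier S) f (restrict (S.cut F) (carrier S))) = compress F G f"
    using lin_closed[OF ncpsuD(1)[OF assms]] by (auto simp: compose_def compress_def S.cut_closed)
  finally show ?thesis .
qed

lemma bform_compress:
  assumes "lin f" "S.blocks n X" "i \<in> I"
  shows "T.bform i n (\<lambda>k l. compress F G f (X k l)) v =
    (if i \<in> G then T.bform i n (\<lambda>k l. f (S.cut F (X k l))) v else 0)"
proof -
  have Xc: "X k l \<in> carrier S" if "k < n" "l < n" for k l using assms(2) that by (simp add: S.blocks_def)
  have "T.bform i n (\<lambda>k l. compress F G f (X k l)) v = T.bform i n (\<lambda>k l. T.cut G (f (S.cut F (X k l)))) v"
    using Xc by (intro T.bform_cong) (simp add: compress_def)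
  also have "\<dots> = (if i \<in> G then T.bform i n (\<lambda>k l. f (S.cut F (X k l))) v else 0)"
    using Xc assms by (intro T.bform_cut) (simp_all add: lin_closed S.cut_closed)
  finally show ?thesis .
qed

text \<open>Enlarging \<open>F\<close> adds the form of \<open>f\<close> on the new blocks;
  enlarging \<open>G\<close> replaces a zero form by that of \<open>f\<close>. Both are
  nonnegative.\<close>

lemma compress_mono:
  assumes f: "lin f" "cpos f" and "F \<subseteq> F'" "G \<subseteq> G'"
  shows "dle (compress F G f) (compress F' G' f)"
  unfolding dle_def
proof (intro allI impI ballI)
  fix n X i v assume X: "S.blocks n X" and i: "i \<in> I"
  have Xc: "X k l \<in> carrier S" if "k < n" "l < n" for k l using X that by (simp add: S.blocks_def)
  have nn: "0 \<le> T.bform i n (\<lambda>k l. f (S.cut E (X k l))) v" for E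
    using dleD[OF f(2) S.blocks_cut[OF X] i] i by (simp add: T.bform_zero)
  have "T.bform i n (\<lambda>k l. f (S.cut F' (X k l))) v
      = T.bform i n (\<lambda>k l. f (S.cut F (X k l)) \<oplus>\<^bsub>T\<^esub> f (S.cut (F' - F) (X k l))) v"
  proof (rule T.bform_cong)
    fix k l assume kl: "k < n" "l < n"
    have "F \<union> (F' - F) = F'" using assms(3) by blast
    then show "f (S.cut F' (X k l)) = f (S.cut F (X k l)) \<oplus>\<^bsub>T\<^esub> f (S.cut (F' - F) (X k l))"
      using S.cut_disjoint_Un[OF Xc[OF kl], of F "F' - F"] Xc[OF kl]
      by (simp add: lin_add[OF f(1)] S.cut_closed)
  qed
  also have "\<dots> = T.bform i n (\<lambda>k l. f (S.cut F (X k l))) v + T.bform i n (\<lambda>k l. f (S.cut (F' - F) (X k l))) v"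
    using Xc i by (intro T.bform_add) (simp_all add: lin_closed[OF f(1)] S.cut_closed)
  finally show "T.bform i n (\<lambda>k l. compress F G f (X k l)) v \<le> T.bform i n (\<lambda>k l. compress F' G' f (X k l)) v"
    unfolding bform_compress[OF f(1) X i] using nn[of F] nn[of F'] nn[of "F' - F"] assms(4) by auto
qed

lemma compress_le:
  assumes f: "lin f" "cpos f"
  shows "dle (compress F G f) f"
proof -
  have "dle (compress F G f) (compress UNIV UNIV f)" by (rule compress_mono[OF f]) auto
  then show ?thesis
    by (rule dle_cong) (simp_all add: compress_def S.cut_UNIV T.cut_UNIV lin_closed[OF f(1)])
qed

lemma compress_dle:
  assumes "dle f g" "lin f" "lin g"
  shows "dle (compress F G f) (compress F G g)"
  unfolding dle_def using bform_compress assms dleD[OF assms(1) S.blocks_cut] by simp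

text \<open>The weights \<open>1 - 1/(m + 1)\<close> stay below 1 and tend to 1;
  \<open>m = 0\<close> gives the zero map.\<close>

definition approx :: "nat \<times> 'j set \<times> 'i set \<Rightarrow> ('s \<Rightarrow> 't) \<Rightarrow> 's \<Rightarrow> 't" where
  "approx a f = (case a of (m, F, G) \<Rightarrow> cc QH (1 - 1 / real (Suc m)) (compress F G f) (base QH))"

definition approx_index :: "(nat \<times> 'j set \<times> 'i set) set" where
  "approx_index = UNIV \<times> {F. finite F} \<times> {G. finite G}"

definition approx_le :: "nat \<times> 'j set \<times> 'i set \<Rightarrow> nat \<times> 'j set \<times> 'i set \<Rightarrow> bool" where
  "approx_le a b \<longleftrightarrow> fst a \<le> fst b \<and> fst (snd a) \<subseteq> fst (snd b) \<and> snd (snd a) \<subseteq> snd (snd b)"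

lemma approx_dnet: "dnet approx_le approx_index"
  unfolding dnet_def
proof (intro conjI ballI impI)
  show "approx_index \<noteq> {}" by (auto simp: approx_index_def)
  show "approx_le a a" for a by (simp add: approx_le_def)
  show "approx_le a c" if "approx_le a b" "approx_le b c" for a b c
    using that unfolding approx_le_def by (meson order_trans)
  fix a b assume "a \<in> approx_index" "b \<in> approx_index"
  then show "\<exists>c\<in>approx_index. approx_le a c \<and> approx_le b c"
    by (intro bexI[of _ "(max (fst a) (fst b), fst (snd a) \<union> fst (snd b), snd (snd a) \<union> snd (snd b))"])
      (auto simp: approx_index_def approx_le_def)
qed

lemma approx_ncpsu: "f \<in> ncpsu S T \<Longrightarrow> approx a f \<in> ncpsu S T"
  by (auto simp: approx_def split: prod.split intro!: ncpsu_cc compress_ncpsu ncpsu_zero)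

lemma approx_mono:
  assumes f: "f \<in> ncpsu S T" and ab: "approx_le a b"
  shows "dle (approx a f) (approx b f)"
proof -
  obtain m F G m' F' G' where a: "a = (m, F, G)" and b: "b = (m', F', G')" by (metis prod.exhaust)
  have le: "m \<le> m'" "F \<subseteq> F'" "G \<subseteq> G'" using ab by (simp_all add: a b approx_le_def)
  have "dle (cc QH (1 - 1 / real (Suc m)) (compress F G f) (base QH))
      (cc QH (1 - 1 / real (Suc m)) (compress F' G' f) (base QH))"
    using le ncpsuD[OF f] by (intro dle_cc compress_ncpsu f ncpsu_zero compress_mono dle_refl) auto
  moreover have "dle (cc QH (1 - 1 / real (Suc m)) (compress F' G' f) (base QH))
      (cc QH (1 - 1 / real (Suc m')) (compress F' G' f) (base QH))"
    using le by (intro dle_scale compress_ncpsu f) (auto simp: frac_le)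
  ultimately show ?thesis unfolding approx_def a b by (auto intro: dle_trans)
qed

text \<open>On a positive element the cuts increase and each entry is eventually constant, so they
  converge to it even over infinitely many blocks; normality of \<open>f\<close> transports the
  limit.\<close>

lemma tendsto_cut:
  assumes f: "f \<in> ncpsu S T" and x: "x \<in> carrier S"
  shows "T.tconv (net_filter approx_le approx_index) (\<lambda>a. f (S.cut (fst (snd a)) x)) (f x)"
  using x
proof (induction rule: S.positive_span_induct)
  case (positive p)
  note f' = ncpsuD[OF f]
  show ?case
  proof (rule normal_net[OF f'(1,3,2) approx_dnet])
    show "S.cut (fst (snd a)) p \<in> carrier S.SA" for a
      using positive by (intro S.lea_zero_SA) (auto simp: S.cut_closed S.lea_zero_iff S.sf_cut)
    show "S.lea (S.cut (fst (snd a)) p) (S.cut (fst (snd b)) p)" if "approx_le a b" for a b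
      using positive that by (auto simp: S.lea_def S.sf_cut S.sf_zero approx_le_def)
    show "S.tconv (net_filter approx_le approx_index) (\<lambda>a. S.cut (fst (snd a)) p) p"
      unfolding S.tconv_def
    proof (intro ballI allI)
      fix j v w assume j: "j \<in> J"
      have "(0, {j}, {}) \<in> approx_index" by (simp add: approx_index_def)
      from eventually_net_filter_ge[OF approx_dnet this]
      have "eventually (\<lambda>a. S.sf j (S.cut (fst (snd a)) p) v w = S.sf j p v w) (net_filter approx_le approx_index)"
        by (rule eventually_mono) (use j positive in \<open>auto simp: S.sf_cut approx_le_def\<close>)
      then show "((\<lambda>a. S.sf j (S.cut (fst (snd a)) p) v w) \<longlongrightarrow> S.sf j p v w) (net_filter approx_le approx_index)"
        by (rule tendsto_eventually)
    qed
  qed fact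
next
  case (add x y)
  note l = ncpsuD(1)[OF f]
  have "T.tconv (net_filter approx_le approx_index)
      (\<lambda>a. f (S.cut (fst (snd a)) x) \<oplus>\<^bsub>T\<^esub> f (S.cut (fst (snd a)) y)) (f x \<oplus>\<^bsub>T\<^esub> f y)"
    using add by (intro T.tconv_add) (simp_all add: lin_closed[OF l] S.cut_closed)
  then show ?case using add by (simp add: S.cut_add lin_add[OF l] S.cut_closed)
next
  case (smult c x)
  note l = ncpsuD(1)[OF f]
  have "T.tconv (net_filter approx_le approx_index) (\<lambda>a. c \<odot>\<^bsub>T\<^esub> f (S.cut (fst (snd a)) x)) (c \<odot>\<^bsub>T\<^esub> f x)"
    using smult by (intro T.tconv_smult tendsto_const) (simp_all add: lin_closed[OF l] S.cut_closed)
  then show ?case using smult by (simp add: S.cut_smult lin_smult[OF l] S.cut_closed)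
qed

lemma approx_pconv:
  assumes f: "f \<in> ncpsu S T"
  shows "pconv (net_filter approx_le approx_index) (\<lambda>a. approx a f) f"
proof -
  let ?F = "net_filter approx_le approx_index"
  note l = ncpsuD(1)[OF f]
  have "pconv ?F (\<lambda>a. compress (fst (snd a)) (snd (snd a)) f) f"
    unfolding pconv_def T.tconv_def
  proof (intro ballI allI)
    fix x i v w assume x: "x \<in> carrier S" and i: "i \<in> I"
    \<comment> \<open>As soon as \<open>i\<close> belongs to \<open>G\<close>, the cut in the target
      leaves the form on block \<open>i\<close> unchanged.\<close>
    have "(0, {}, {i}) \<in> approx_index" by (simp add: approx_index_def)
    from eventually_net_filter_ge[OF approx_dnet this]
    have "eventually (\<lambda>a. T.sf i (f (S.cut (fst (snd a)) x)) v w =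
        T.sf i (compress (fst (snd a)) (snd (snd a)) f x) v w) ?F"
      by (rule eventually_mono)
        (use i x in \<open>auto simp: compress_def T.sf_cut lin_closed[OF l] S.cut_closed approx_le_def\<close>)
    then show "((\<lambda>a. T.sf i (compress (fst (snd a)) (snd (snd a)) f x) v w) \<longlongrightarrow> T.sf i (f x) v w) ?F"
      by (rule Lim_transform_eventually[OF T.tconvD[OF tendsto_cut[OF f x] i]])
  qed
  moreover have "((\<lambda>a. 1 - 1 / real (Suc (fst a))) \<longlongrightarrow> 1) ?F"
  proof -
    have "filterlim fst sequentially ?F"
      unfolding filterlim_at_top
    proof
      fix m
      have "(m, {}, {}) \<in> approx_index" by (simp add: approx_index_def)
      from eventually_net_filter_ge[OF approx_dnet this]
      show "eventually (\<lambda>a. m \<le> fst a) ?F" by (rule eventually_mono) (simp add: approx_le_def)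
    qed
    moreover have "(\<lambda>m. 1 - 1 / real (Suc m)) \<longlonglongrightarrow> 1 - 0"
      using LIMSEQ_inverse_real_of_nat by (intro tendsto_diff tendsto_const) (simp add: inverse_eq_divide)
    ultimately show ?thesis using filterlim_compose[of "\<lambda>m. 1 - 1 / real (Suc m)" "nhds 1" sequentially fst ?F] by simp
  qed
  ultimately have "pconv ?F (\<lambda>a. cc QH (1 - 1 / real (Suc (fst a))) (compress (fst (snd a)) (snd (snd a)) f) (base QH))
      (cc QH 1 f (base QH))"
    using f by (intro pconv_cc pconv_const) (simp_all add: compress_ncpsu ncpsu_zero)
  moreover have "cc QH 1 f (base QH) = f"
    using f by (intro cc_eqI) (simp_all add: ncpsu_cc ncpsu_zero sf_cc)
  ultimately show ?thesis by (simp add: approx_def case_prod_unfold)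
qed

text \<open>The Choi matrices of the members of \<open>D\<close> converge to those of
  \<open>s\<close>, so a single member \<open>g\<close> dominates \<open>t s\<close> on all selected
  pairs of blocks. This gives the chain from the approximant of \<open>f\<close> to the scaled
  compression of \<open>s\<close>, to the compression of \<open>g\<close>, to
  \<open>g\<close>.\<close>

lemma approx_way_below:
  assumes f: "f \<in> ncpsu S T" and a: "a \<in> approx_index"
  shows "way_below QH (approx a f) f"
  unfolding way_below_def
proof (intro conjI allI impI)
  show "approx a f \<in> carrier QH" "f \<in> carrier QH" using f by (simp_all add: QH_carrier approx_ncpsu)
  fix D s assume "directed QH D \<and> is_lub QH s D \<and> f \<sqsubseteq>\<^bsub>QH\<^esub> s"
  then have dir: "directed QH D" and lub: "is_lub QH s D" and fs: "f \<sqsubseteq>\<^bsub>QH\<^esub> s" by auto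
  have sub: "D \<subseteq> ncpsu S T" using dir by (simp add: directed_def QH_carrier)
  note D = QH_directed_dnet[OF dir]
  have s: "s \<in> ncpsu S T" using is_lubD(1)[OF lub] sub by (simp add: QH_carrier)
  have mono: "dle g g'" if "g \<in> D" "g' \<in> D" "g \<sqsubseteq>\<^bsub>QH\<^esub> g'" for g g'
    using that sub QH_le[of g g'] by blast
  have p: "pconv (net_filter (le QH) D) (\<lambda>g. g) s"
    by (rule pconv_of_QH_is_lub[OF D]) (use sub mono lub in auto)
  have upper: "dle g s" if "g \<in> D" for g
    using is_lubD(2)[OF lub] that sub s by (auto simp: QH_carrier QH_le subset_iff)
  obtain m F G where a': "a = (m, F, G)" by (metis prod.exhaust)
  have fin: "finite (F \<inter> J)" "finite (G \<inter> I)" using a by (simp_all add: a' approx_index_def)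
  define t where "t = 1 - 1 / real (Suc m)"
  have t: "0 \<le> t" "t < 1" by (simp_all add: t_def)
  have "eventually (\<lambda>g. psd (choi_dom i j) (\<lambda>p q. choi i j g p q - of_real t * choi i j s p q)) (net_filter (le QH) D)"
    if i: "i \<in> I" and j: "j \<in> J" for i j
  proof (rule psd_limit_absorbs[OF _ _ _ _ _ t(2)])
    show "psd (choi_dom i j) (choi i j s)" by (rule choi_psd[OF ncpsuD(3)[OF s] i j])
    show "eventually (\<lambda>g. psd (choi_dom i j) (\<lambda>p q. choi i j s p q - choi i j g p q)) (net_filter (le QH) D)"
      using eventually_in_net[OF D] by (rule eventually_mono) (rule choi_diff_psd[OF upper i j])
    show "eventually (\<lambda>g. psd (choi_dom i j) (choi i j g)) (net_filter (le QH) D)"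
      using eventually_in_net[OF D] by (rule eventually_mono) (use sub ncpsuD(3) choi_psd i j in blast)
    fix k l assume kl: "k \<in> choi_dom i j" "l \<in> choi_dom i j"
    obtain b \<beta> c \<gamma> where kl': "k = (b, \<beta>)" "l = (c, \<gamma>)" by (metis prod.exhaust)
    then have *: "b < e j" "c < e j" "\<beta> < d i" "\<gamma> < d i" using kl by auto
    have "T.tconv (net_filter (le QH) D) (\<lambda>g. g (S.matrix_unit j b c)) (s (S.matrix_unit j b c))"
      using p S.matrix_unit_closed[OF j *(1,2)] by (simp add: pconv_def)
    then show "((\<lambda>g. choi i j g k l) \<longlongrightarrow> choi i j s k l) (net_filter (le QH) D)"
      unfolding kl' choi_def split T.co_eq_sf[OF i *(3,4)] using i by (rule T.tconvD)
  qed simp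
  \<comment> \<open>The selected pairs of blocks are finitely many, so one tail of the net serves
    them all.\<close>
  then have "eventually (\<lambda>g. \<forall>i\<in>G \<inter> I. \<forall>j\<in>F \<inter> J.
      psd (choi_dom i j) (\<lambda>p q. choi i j g p q - of_real t * choi i j s p q)) (net_filter (le QH) D)"
    using fin by (simp add: eventually_ball_finite_distrib)
  with eventually_in_net[OF D] have "eventually (\<lambda>g. g \<in> D \<and> (\<forall>i\<in>G \<inter> I. \<forall>j\<in>F \<inter> J.
      psd (choi_dom i j) (\<lambda>p q. choi i j g p q - of_real t * choi i j s p q))) (net_filter (le QH) D)"
    by eventually_elim simp
  from eventually_happens'[OF net_filter_neq_bot[OF D] this]
  obtain g where g: "g \<in> D" and psd: "\<And>i j. i \<in> G \<inter> I \<Longrightarrow> j \<in> F \<inter> J \<Longrightarrow>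
      psd (choi_dom i j) (\<lambda>p q. choi i j g p q - of_real t * choi i j s p q)" by blast
  have gm: "g \<in> ncpsu S T" using g sub by blast
  note gl = ncpsuD(1)[OF gm] and sl = ncpsuD(1)[OF s] and fl = ncpsuD(1)[OF f]
  \<comment> \<open>Nonnegativity of this difference on the selected blocks is what the Choi
    matrices decide.\<close>
  define h where "h = (\<lambda>x. g x \<ominus>\<^bsub>T\<^esub> complex_of_real t \<odot>\<^bsub>T\<^esub> s x)"
  have hc: "h x \<in> carrier T" if "x \<in> carrier S" for x using that gl sl by (simp add: h_def lin_closed)
  have h: "lin h"
  proof (rule linI[OF hc])
    show "h (x \<oplus>\<^bsub>S\<^esub> y) = h x \<oplus>\<^bsub>T\<^esub> h y" if "x \<in> carrier S" "y \<in> carrier S" for x y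
      using that gl sl hc
      by (intro T.sf_eqI)
        (simp_all add: h_def lin_closed lin_add T.sf_add T.sf_minus T.sf_smult algebra_simps)
    show "h (c \<odot>\<^bsub>S\<^esub> x) = c \<odot>\<^bsub>T\<^esub> h x" if "x \<in> carrier S" for c x
      using that gl sl hc
      by (intro T.sf_eqI)
        (simp_all add: h_def lin_closed lin_smult T.sf_minus T.sf_smult algebra_simps)
  qed
  have "dle (cc QH t (compress F G s) (base QH)) (compress F G g)"
    unfolding dle_def
  proof (intro allI impI ballI)
    fix n X i v assume X: "S.blocks n X" and i: "i \<in> I"
    have Xc: "X k l \<in> carrier S" if "k < n" "l < n" for k l using X that by (simp add: S.blocks_def)
    let ?b = "\<lambda>f. T.bform i n (\<lambda>k l. f (S.cut F (X k l))) v"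
    have "T.bform i n (\<lambda>k l. base QH (X k l)) v = T.bform i n (\<lambda>_ _. \<zero>\<^bsub>T\<^esub>) v"
      using Xc by (intro T.bform_cong) (simp add: QH_base)
    then have l: "T.bform i n (\<lambda>k l. cc QH t (compress F G s) (base QH) (X k l)) v = of_real t * (if i \<in> G then ?b s else 0)"
      using X i s by (simp add: bform_cc compress_ncpsu ncpsu_zero T.bform_zero bform_compress[OF sl])
    have "of_real t * ?b s \<le> ?b g" if iG: "i \<in> G"
    proof -
      have ch: "psd (choi_dom i j) (choi i j h)" if j: "j \<in> F \<inter> J" for j
      proof -
        have "choi i j h p q = choi i j g p q - of_real t * choi i j s p q"
          if "p \<in> choi_dom i j" "q \<in> choi_dom i j" for p q
          using that j i gl sl S.matrix_unit_closed[of j]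
          by (auto simp: choi_def h_def T.co_minus T.co_smult lin_closed)
        then show ?thesis using psd[of i j] iG i j by (simp cong: psd_cong)
      qed
      \<comment> \<open>Choi matrices are available for indices in \<open>J\<close>; passing from
        \<open>F\<close> to \<open>F \<inter> J\<close> does not change the cut.\<close>
      have "0 \<le> T.bform i n (\<lambda>k l. h (S.cut (F \<inter> J) (X k l))) v"
        by (rule bform_cut_finite_nonneg[OF h i fin(1) _ ch X]) auto
      also have "\<dots> = ?b h"
        using Xc S.cut_eq[of _ "F \<inter> J" F] by (intro T.bform_cong) auto
      also have "\<dots> = ?b g - T.bform i n (\<lambda>k l. complex_of_real t \<odot>\<^bsub>T\<^esub> s (S.cut F (X k l))) v"
        unfolding h_def using Xc i gl sl by (intro T.bform_minus) (simp_all add: lin_closed S.cut_closed)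
      also have "T.bform i n (\<lambda>k l. complex_of_real t \<odot>\<^bsub>T\<^esub> s (S.cut F (X k l))) v = of_real t * ?b s"
        using Xc i sl by (intro T.bform_smult) (simp_all add: lin_closed S.cut_closed)
      finally show ?thesis by simp
    qed
    then show "T.bform i n (\<lambda>k l. cc QH t (compress F G s) (base QH) (X k l)) v \<le> T.bform i n (\<lambda>k l. compress F G g (X k l)) v"
      unfolding l bform_compress[OF gl X i] by simp
  qed
  moreover have "dle (approx a f) (cc QH t (compress F G s) (base QH))"
    unfolding a' approx_def split t_def[symmetric]
    using t f s fs fl sl by (intro dle_cc compress_ncpsu ncpsu_zero compress_dle dle_refl) (simp_all add: QH_le)
  moreover have "dle (compress F G g) g" by (rule compress_le[OF gl ncpsuD(3)[OF gm]])
  ultimately have "dle (approx a f) g" by (blast intro: dle_trans)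
  then have "approx a f \<sqsubseteq>\<^bsub>QH\<^esub> g" using f gm by (simp add: QH_le approx_ncpsu)
  then show "\<exists>z\<in>D. approx a f \<sqsubseteq>\<^bsub>QH\<^esub> z" using g by blast
qed

lemma QH_continuous_kegelspitze: "continuous_kegelspitze QH"
proof -
  interpret kegelspitze QH by (rule QH_kegelspitze)
  show ?thesis
  proof
    fix f assume "f \<in> carrier QH"
    then have f: "f \<in> ncpsu S T" by (simp add: QH_carrier)
    let ?D = "(\<lambda>a. approx a f) ` approx_index"
    have "directed QH ?D"
      unfolding directed_def
    proof (intro conjI ballI)
      show "?D \<noteq> {}" using dnet_nonempty[OF approx_dnet] by simp
      show "?D \<subseteq> carrier QH" using f by (auto simp: QH_carrier approx_ncpsu)
      fix g h assume "g \<in> ?D" "h \<in> ?D"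
      then obtain a b where ab: "a \<in> approx_index" "b \<in> approx_index" "g = approx a f" "h = approx b f" by blast
      obtain c where c: "c \<in> approx_index" "approx_le a c" "approx_le b c"
        using dnet_directed[OF approx_dnet ab(1,2)] .
      then show "\<exists>z\<in>?D. g \<sqsubseteq>\<^bsub>QH\<^esub> z \<and> h \<sqsubseteq>\<^bsub>QH\<^esub> z"
        using ab approx_mono[OF f] f by (intro bexI[of _ "approx c f"]) (auto simp: QH_le approx_ncpsu)
    qed
    moreover have "is_lub QH f ?D"
      by (rule QH_is_lub_of_pconv[OF approx_dnet])
        (use f approx_ncpsu approx_mono approx_pconv in auto)
    ultimately show "\<exists>D. directed QH D \<and> (\<forall>x\<in>D. way_below QH x f) \<and> is_lub QH f D"
      using approx_way_below[OF f] by blast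
  qed
qed

end


text \<open>A morphism \<open>\<phi>\<close> from \<open>A\<close> to \<open>B\<close> is a map of
  algebras from \<open>B\<close> to \<open>A\<close>. Composing with it on the left in Q means
  applying it before the algebra map \<open>\<psi>\<close>, and composing on the right means
  applying it after \<open>\<psi>\<close>; only the latter case draws on the normality of
  \<open>\<phi>\<close> for the limits.\<close>

theorem mainTheorem4:
  fixes A :: "'a star_algebra" and B :: "'b star_algebra"
  assumes "hereditarily_atomic A" and "hereditarily_atomic B"
  shows "continuous_kegelspitze (Q_hom A B) \<and>
    (\<forall>\<phi> \<in> carrier (Q_hom A B). \<forall>C :: 'c star_algebra. hereditarily_atomic C \<longrightarrow>
       scott_continuous (Q_hom C A) (Q_hom C B) (\<lambda>\<psi>. Q_comp B \<phi> \<psi>) \<and>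
       kegelspitze_linear (Q_hom C A) (Q_hom C B) (\<lambda>\<psi>. Q_comp B \<phi> \<psi>) \<and>
       scott_continuous (Q_hom B C) (Q_hom A C) (\<lambda>\<psi>. Q_comp C \<psi> \<phi>) \<and>
       kegelspitze_linear (Q_hom B C) (Q_hom A C) (\<lambda>\<psi>. Q_comp C \<psi> \<phi>))"
proof -
  obtain I :: "'a set" and d ca where A: "coords A I d ca" using hereditarily_atomic_coords[OF assms(1)] .
  obtain J :: "'b set" and e cb where B: "coords B J e cb" using hereditarily_atomic_coords[OF assms(2)] .
  interpret BA: coords2 B J e cb A I d ca by (intro coords2.intro A B)
  show ?thesis
  proof (intro conjI ballI allI impI)
    show "continuous_kegelspitze (Q_hom A B)" by (rule BA.QH_continuous_kegelspitze)
    fix \<phi> and C :: "'c star_algebra"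
    assume "\<phi> \<in> carrier (Q_hom A B)" and "hereditarily_atomic C"
    then have \<phi>: "\<phi> \<in> ncpsu B A" by (simp add: BA.QH_carrier)
    obtain K :: "'c set" and m cc where C: "coords C K m cc"
      using hereditarily_atomic_coords[OF \<open>hereditarily_atomic C\<close>] .
    interpret BAC: coords3 B J e cb A I d ca C K m cc by (intro coords3.intro coords2.intro A B C)
    interpret CBA: coords3 C K m cc B J e cb A I d ca by (intro coords3.intro coords2.intro A B C)
    show "scott_continuous (Q_hom C A) (Q_hom C B) (\<lambda>\<psi>. Q_comp B \<phi> \<psi>)"
      unfolding Q_comp_def by (rule BAC.compose_right_scott[OF \<phi>])
    show "kegelspitze_linear (Q_hom C A) (Q_hom C B) (\<lambda>\<psi>. Q_comp B \<phi> \<psi>)"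
      unfolding Q_comp_def by (rule BAC.compose_right_linear[OF \<phi>])
    show "scott_continuous (Q_hom B C) (Q_hom A C) (\<lambda>\<psi>. Q_comp C \<psi> \<phi>)"
      unfolding Q_comp_def by (rule CBA.compose_left_scott[OF \<phi>])
    show "kegelspitze_linear (Q_hom B C) (Q_hom A C) (\<lambda>\<psi>. Q_comp C \<psi> \<phi>)"
      unfolding Q_comp_def by (rule CBA.compose_left_linear[OF \<phi>])
  qed
qed

end
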